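(* Let $V:[0,\infty)\to\mathbb{R}$ be a function such that, for some $\alpha>0$, the function $x\mapsto V(x^2)-\frac{\alpha}{2}x^2$ is convex on $\mathbb{R}$. Let $n\ge 2$ and let $X$ be a random $n\times n$ complex matrix whose law is the probability measure proportional to $e^{-n\operatorname{Tr}V(M^*M)}\,dM$, where $dM$ is Lebesgue measure on the space of $n\times n$ complex matrices. Let $z,z'\in\mathbb{C}$. Let $\lambda$ and $\lambda'$ be the eigenvalues of $X$ that are the closest to $z$ and $z'$ respectively, with the convention that if $z=z'$, or if $\lambda$ is the eigenvalue closest to both $z$ and $z'$, then $\lambda'$ is the second closest eigenvalue to $z'$. Let $\mathbf{v},\mathbf{v}'$ be associated (right) eigenvectors of unit $\ell_2$ norm, and define $$Y:=n\,\frac{|\lambda'-\lambda|^2}{|\langle\mathbf{v},\mathbf{v}'\rangle|^{-2}-1}.$$ Then for any $\delta>0$, $$\mathbb{P}(Y\ge\delta)\le 2\exp\left(-\frac{\alpha}{2}\delta\right).$$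
   Context: Almost surely all eigenvalues of $X$ are distinct, and $|\langle\mathbf{v},\mathbf{v}'\rangle|$ does not depend on the choice of unit eigenvectors (which are determined up to a complex scalar of modulus $1$), so $Y$ is almost surely well defined (with $Y=0$ if $\langle\mathbf{v},\mathbf{v}'\rangle=0$). $\langle\cdot,\cdot\rangle$ is the standard Hermitian inner product on $\mathbb{C}^n$. $V(M^*M)$ is defined by functional calculus of the nonnegative Hermitian matrix $M^*M$. *)

theory Defs
  imports "HOL-Probability.Probability"
begin

definition ctranspose :: "complex^'n^'m \<Rightarrow> complex^'m^'n" where
  "ctranspose A = (\<chi> i j. cnj (A $ j $ i))"

definition unitary_matrix :: "complex^'n^'n \<Rightarrow> bool" where
  "unitary_matrix U \<longleftrightarrow> ctranspose U ** U = mat 1"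

definition real_diag :: "('n \<Rightarrow> real) \<Rightarrow> complex^'n^'n" where
  "real_diag d = (\<chi> i j. if i = j then complex_of_real (d i) else 0)"

(* Functional calculus f(A) for Hermitian A: by the spectral theorem such a B exists, and it
   does not depend on the diagonalization chosen.  Only the values of f on the spectrum of A
   matter, so for A = M^* M only the values of f on [0, \<infinity>) do. *)
definition hermitian_fun :: "(real \<Rightarrow> real) \<Rightarrow> complex^'n^'n \<Rightarrow> complex^'n^'n" where
  "hermitian_fun f A = (THE B. \<exists>U d. unitary_matrix U \<and>
     A = U ** real_diag d ** ctranspose U \<and>
     B = U ** real_diag (\<lambda>i. f (d i)) ** ctranspose U)"

(* The trace is real; Re only converts its type. *)
definition gibbs_weight :: "(real \<Rightarrow> real) \<Rightarrow> complex^'n^'n \<Rightarrow> real" where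
  "gibbs_weight V M =
     exp (- (real CARD('n) * Re (trace (hermitian_fun V (ctranspose M ** M)))))"

definition gibbs_density :: "(real \<Rightarrow> real) \<Rightarrow> complex^'n^'n \<Rightarrow> ennreal" where
  "gibbs_density V M =
     ennreal (gibbs_weight V M) / (\<integral>\<^sup>+ M'. ennreal (gibbs_weight V (M' :: complex^'n^'n)) \<partial>lborel)"

definition hermitian_inner :: "complex^'n \<Rightarrow> complex^'n \<Rightarrow> complex" where
  "hermitian_inner u v = (\<Sum>i\<in>UNIV. cnj (u $ i) * v $ i)"

definition spectrum :: "complex^'n^'n \<Rightarrow> complex set" where
  "spectrum A = {l. \<exists>v. v \<noteq> 0 \<and> A *v v = l *s v}"

definition unit_eigenvector :: "complex^'n^'n \<Rightarrow> complex \<Rightarrow> complex^'n \<Rightarrow> bool" where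
  "unit_eigenvector A l v \<longleftrightarrow> A *v v = l *s v \<and> norm v = 1"

definition closest_in :: "complex set \<Rightarrow> complex \<Rightarrow> complex \<Rightarrow> bool" where
  "closest_in S w l \<longleftrightarrow> is_arg_min (\<lambda>m. cmod (m - w)) (\<lambda>m. m \<in> S) l"

(* When l is the eigenvalue closest to z', the second closest one to z' is the closest among
   the others.  If z = z', then l is always closest to z' as well.  Ties, and multiple
   eigenvalues, only occur on a null set of matrices. *)
definition selected_eigenvalues ::
    "complex \<Rightarrow> complex \<Rightarrow> complex^'n^'n \<Rightarrow> complex \<Rightarrow> complex \<Rightarrow> bool" where
  "selected_eigenvalues z z' A l l' \<longleftrightarrow>
     closest_in (spectrum A) z l \<and>
     (if z = z' \<or> closest_in (spectrum A) z' l
      then closest_in (spectrum A - {l}) z' l'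
      else closest_in (spectrum A) z' l')"

(* The value is 0 for orthogonal eigenvectors, where |<v,v'>|^(-2) is infinite. *)
definition Y_value :: "complex \<Rightarrow> complex \<Rightarrow> complex^'n \<Rightarrow> complex^'n \<Rightarrow> real" where
  "Y_value l l' v v' =
     (if hermitian_inner v v' = 0 then 0
      else real CARD('n) *
        ((cmod (l' - l))\<^sup>2 / (cmod (hermitian_inner v v') powi (-2) - 1)))"

end

theory Submission
  imports Defs
begin

text \<open>
  Conjugating \<open>M\<close> to a Schur form with \<open>\<lambda>\<close> and \<open>\<lambda>'\<close> in the first two diagonal positions, one has
  \<open>Y = n |t|\<^sup>2\<close> for the entry \<open>t\<close> at position \<open>(1, 2)\<close>. Deflate only the first eigenvector,
  \<open>M = L P inverse(L)\<close> with \<open>P\<close> block upper triangular, \<open>P = (\<lambda>, r; 0, K)\<close>, and \<open>L\<close> unipotent: the Jacobian of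
  this parametrisation does not depend on the row \<open>r\<close>, and neither do the eigenvalues. For fixed
  \<open>\<lambda>\<close>, \<open>L\<close> and \<open>K\<close> the density is, as a function of \<open>r\<close>, of the form \<open>exp (- c |t|\<^sup>2 - \<Gamma>)\<close>, where \<open>t\<close> is
  affine in \<open>r\<close> and \<open>\<Gamma>\<close> is convex because \<open>M \<mapsto> Tr V(M\<^sup>*M) - \<alpha>/2 |M|\<^sup>2\<close> is; moreover \<open>\<Gamma>\<close> is even about the
  zero of \<open>t\<close>, since conjugating by a Householder reflection flips the first row. By the
  Prekopa-Leindler inequality the marginal weight of \<open>t\<close> under \<open>exp (- \<Gamma>)\<close> decreases along rays, hence
  the mass of \<open>{|t|\<^sup>2 < u}\<close> is subadditive in \<open>u\<close>, and integrating against \<open>c exp (- c u) du\<close> gives the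
  exact Gaussian tail on every fibre.
\<close>

section \<open>Singular values and trace functions\<close>

text \<open>A unipotent \<open>L\<close> keeps the parametrisation polynomial between subsets of the
  same matrix space, so Lebesgue change of variables applies and no measure on the unitary group
  enters. The price is an eigenvector x that is not normalised, so t carries a factor 1 / (|x| |u|),
  where u spans the second Schur direction. The obstacle is that on a fibre the weight of t is even
  but not rotation invariant. Decrease along rays is enough: a plane disc of squared radius u has
  area proportional to u, so mass divided by u does not increase, and subadditivity follows. As t
  need not have a density that can be evaluated pointwise, masses of small discs stand in for it and
  their radius tends to 0. Since the row r does not influence the eigenvalues, being closest to z or
  to z' selects whole fibres, and the selection never interferes with the integration over r. The
  rate is c = n \<alpha>/2, and Y \<ge> \<delta> means |t|^2 \<ge> \<delta>/n, whence the exponent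
  \<alpha> \<delta>/2. The argument gives this tail with constant 1 in place of 2.\<close>

lemma ctranspose_nth [simp]: "ctranspose A $ i $ j = cnj (A $ j $ i)"
  by (simp add: ctranspose_def)

lemma real_diag_nth [simp]: "real_diag d $ i $ j = (if i = j then complex_of_real (d i) else 0)"
  by (simp add: real_diag_def)

lemma ctranspose_ctranspose [simp]: "ctranspose (ctranspose A) = A"
  by (simp add: vec_eq_iff)

lemma ctranspose_mult: "ctranspose (A ** B) = ctranspose B ** ctranspose A"
  by (simp add: vec_eq_iff matrix_matrix_mult_def mult.commute)

section \<open>The Hermitian inner product and Bessel's inequality\<close>

lemma inner_complex: "inner a b = Re (cnj a * b)"
  by (simp add: inner_complex_def)

lemma inner_eq_hermitian: "inner u v = Re (hermitian_inner u v)"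
  by (simp add: inner_vec_def hermitian_inner_def inner_complex)

lemma hermitian_inner_add_right: "hermitian_inner u (v + w) = hermitian_inner u v + hermitian_inner u w"
  and hermitian_inner_add_left: "hermitian_inner (u + v) w = hermitian_inner u w + hermitian_inner v w"
  and hermitian_inner_diff_right: "hermitian_inner u (v - w) = hermitian_inner u v - hermitian_inner u w"
  and hermitian_inner_diff_left: "hermitian_inner (u - v) w = hermitian_inner u w - hermitian_inner v w"
  by (simp_all add: hermitian_inner_def algebra_simps sum.distrib sum_subtractf)

lemma hermitian_inner_scale_right: "hermitian_inner u (c *s v) = c * hermitian_inner u v"
  and hermitian_inner_scale_left: "hermitian_inner (c *s u) v = cnj c * hermitian_inner u v"
  by (simp_all add: hermitian_inner_def algebra_simps sum_distrib_left)

lemma hermitian_inner_zero [simp]: "hermitian_inner u 0 = 0" "hermitian_inner 0 v = 0"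
  by (simp_all add: hermitian_inner_def)

lemma hermitian_inner_sum_right: "hermitian_inner u (\<Sum>i\<in>I. f i) = (\<Sum>i\<in>I. hermitian_inner u (f i))"
  by (induction I rule: infinite_finite_induct) (simp_all add: hermitian_inner_add_right)

lemma hermitian_inner_sum_left: "hermitian_inner (\<Sum>i\<in>I. f i) u = (\<Sum>i\<in>I. hermitian_inner (f i) u)"
  by (induction I rule: infinite_finite_induct) (simp_all add: hermitian_inner_add_left)

lemma hermitian_inner_commute: "hermitian_inner v u = cnj (hermitian_inner u v)"
  by (simp add: hermitian_inner_def mult.commute)

lemma hermitian_inner_self: "hermitian_inner v v = complex_of_real ((norm v)\<^sup>2)"
proof (rule complex_eqI)
  show "Re (hermitian_inner v v) = Re (complex_of_real ((norm v)\<^sup>2))"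
    using inner_eq_hermitian[of v v] by (simp add: power2_norm_eq_inner)
  show "Im (hermitian_inner v v) = Im (complex_of_real ((norm v)\<^sup>2))"
    by (simp add: hermitian_inner_def)
qed

lemma norm_scale_vec: "norm (c *s v) = cmod c * norm (v :: complex^'n)"
proof -
  have "complex_of_real ((norm (c *s v))\<^sup>2) = c * cnj c * hermitian_inner v v"
    unfolding hermitian_inner_self[symmetric] hermitian_inner_scale_left hermitian_inner_scale_right
    by (simp only: ac_simps)
  also have "\<dots> = complex_of_real ((cmod c * norm v)\<^sup>2)"
    unfolding hermitian_inner_self complex_norm_square[symmetric] by (simp add: power_mult_distrib)
  finally have "complex_of_real ((norm (c *s v))\<^sup>2) = complex_of_real ((cmod c * norm v)\<^sup>2)" .
  then have "(norm (c *s v))\<^sup>2 = (cmod c * norm v)\<^sup>2" by (simp only: of_real_eq_iff)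
  then show ?thesis by (simp add: power2_eq_iff_nonneg)
qed

lemma complex_of_real_scale_vec: "complex_of_real r *s (y::complex^'n) = r *\<^sub>R y"
  unfolding vec_eq_iff vector_scaleR_component vector_smult_component by (simp add: scaleR_conv_of_real)

lemma hermitian_Cauchy_Schwarz: "cmod (hermitian_inner u v) \<le> norm u * norm v"
proof (cases "hermitian_inner u v = 0")
  case False
  let ?w = "hermitian_inner u v"
  \<comment> \<open>Scaling \<open>u\<close> by the product itself makes the product real and
    nonnegative, so the real Cauchy-Schwarz inequality applies.\<close>
  have "(cmod ?w)\<^sup>2 = inner (?w *s u) v"
    unfolding inner_eq_hermitian hermitian_inner_scale_left
    by (metis Re_complex_of_real complex_norm_square mult.commute)
  also have "\<dots> \<le> norm (?w *s u) * norm v" by (rule norm_cauchy_schwarz)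
  finally show ?thesis using False by (simp add: norm_scale_vec power2_eq_square)
qed simp

lemma hermitian_inner_matrix_right: "hermitian_inner u (A *v w) = hermitian_inner (ctranspose A *v u) w"
  unfolding hermitian_inner_def matrix_vector_mult_def
  by (simp add: sum_distrib_left sum_distrib_right) (subst sum.swap, simp add: ac_simps)

lemma hermitian_Bessel:
  fixes a :: "'n::finite \<Rightarrow> complex^'m"
  assumes orth: "\<And>i j. i \<noteq> j \<Longrightarrow> hermitian_inner (a i) (a j) = 0" and le1: "\<And>i. norm (a i) \<le> 1"
  shows "(\<Sum>i\<in>UNIV. (cmod (hermitian_inner (a i) x))\<^sup>2) \<le> (norm x)\<^sup>2"
proof -
  define c where "c i = hermitian_inner (a i) x" for i
  define p where "p = (\<Sum>i\<in>UNIV. c i *s a i)"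
  have ap: "hermitian_inner (a j) p = c j * complex_of_real ((norm (a j))\<^sup>2)" for j
  proof -
    have "hermitian_inner (a j) p = (\<Sum>i\<in>UNIV. if i = j then c j * complex_of_real ((norm (a j))\<^sup>2) else 0)"
      unfolding p_def hermitian_inner_sum_right hermitian_inner_scale_right
      by (intro sum.cong) (auto simp: orth hermitian_inner_self)
    then show ?thesis by simp
  qed
  have xp: "hermitian_inner p x = (\<Sum>i\<in>UNIV. complex_of_real ((cmod (c i))\<^sup>2))"
    unfolding p_def hermitian_inner_sum_left hermitian_inner_scale_left
    by (intro sum.cong refl) (simp only: c_def complex_norm_square mult.commute)
  have pp: "hermitian_inner p p = (\<Sum>i\<in>UNIV. complex_of_real ((cmod (c i))\<^sup>2 * (norm (a i))\<^sup>2))"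
  proof -
    have "hermitian_inner p p = (\<Sum>i\<in>UNIV. cnj (c i) * hermitian_inner (a i) p)"
      by (subst p_def) (simp add: hermitian_inner_sum_left hermitian_inner_scale_left)
    also have "\<dots> = (\<Sum>i\<in>UNIV. c i * cnj (c i) * complex_of_real ((norm (a i))\<^sup>2))"
      unfolding ap by (simp only: ac_simps)
    finally show ?thesis
      unfolding complex_norm_square[symmetric] of_real_mult[symmetric] .
  qed
  have "hermitian_inner (x - p) (x - p) = hermitian_inner x x - cnj (hermitian_inner p x) - hermitian_inner p x + hermitian_inner p p"
    by (simp add: hermitian_inner_diff_left hermitian_inner_diff_right hermitian_inner_commute[of x p])
  then have "Re (hermitian_inner (x - p) (x - p)) = (norm x)\<^sup>2 - 2 * (\<Sum>i\<in>UNIV. (cmod (c i))\<^sup>2) + (\<Sum>i\<in>UNIV. (cmod (c i))\<^sup>2 * (norm (a i))\<^sup>2)"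
    unfolding xp pp by (simp add: hermitian_inner_self)
  moreover have "0 \<le> Re (hermitian_inner (x - p) (x - p))" by (simp add: hermitian_inner_self)
  moreover have "(\<Sum>i\<in>UNIV. (cmod (c i))\<^sup>2 * (norm (a i))\<^sup>2) \<le> (\<Sum>i\<in>UNIV. (cmod (c i))\<^sup>2)"
    using le1 by (intro sum_mono) (simp add: mult_left_le power_le_one)
  ultimately show ?thesis by (simp add: c_def)
qed

section \<open>The spectral theorem and functional calculus\<close>

lemma hermitian_Rayleigh:
  fixes A :: "complex^'n^'n"
  assumes herm: "ctranspose A = A" and S: "subspace S" and inv: "\<And>x. x \<in> S \<Longrightarrow> A *v x \<in> S"
    and ne: "\<exists>x\<in>S. x \<noteq> 0"
  obtains x \<mu> where "x \<in> S" "norm x = 1" "A *v x = complex_of_real \<mu> *s x"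
proof -
  define q where "q x = inner x (A *v x)" for x
  note sc = complex_of_real_scale_vec
  have lin: "linear ((*v) A)" by (rule matrix_vector_mul_linear)
  have sym: "inner u (A *v w) = inner (A *v u) w" for u w
    by (simp add: inner_eq_hermitian hermitian_inner_matrix_right herm)
  have comp: "compact (S \<inter> sphere 0 1)" using compact_Int_closed[OF compact_sphere closed_subspace[OF S]] by (simp add: Int_commute)
  obtain y where y: "y \<in> S" "y \<noteq> 0" using ne by blast
  have "(1 / norm y) *\<^sub>R y \<in> S \<inter> sphere 0 1" using y S by (simp add: subspace_scale)
  then have ne': "S \<inter> sphere 0 1 \<noteq> {}" by blast
  have cont: "continuous_on (S \<inter> sphere 0 1) q"
    unfolding q_def by (intro continuous_intros linear_continuous_on)
      (simp add: linear_conv_bounded_linear[symmetric] lin)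
  obtain x where x: "x \<in> S" "norm x = 1" and max: "\<And>y. y \<in> S \<Longrightarrow> norm y = 1 \<Longrightarrow> q y \<le> q x"
    using continuous_attains_sup[OF comp ne' cont] by auto
  define \<mu> where "\<mu> = q x"
  have qle: "q y \<le> \<mu> * (norm y)\<^sup>2" if "y \<in> S" for y
  proof (cases "y = 0")
    case True then show ?thesis by (simp add: q_def)
  next
    case False
    have "q ((1 / norm y) *\<^sub>R y) \<le> \<mu>"
      unfolding \<mu>_def using False that S by (intro max) (auto simp: subspace_scale)
    moreover have "q ((1 / norm y) *\<^sub>R y) = q y / (norm y)\<^sup>2"
      unfolding q_def by (simp add: linear_scale[OF lin] power2_eq_square)
    ultimately show ?thesis using False by (simp add: field_simps)
  qed
  \<comment> \<open>The residue is, up to a factor, the gradient of the Rayleigh quotient at its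
    maximiser \<open>x\<close>. Moving along it would raise the quotient to first order, so it must
    vanish.\<close>
  define s where "s = A *v x - \<mu> *\<^sub>R x"
  have sS: "s \<in> S" unfolding s_def using S inv x by (simp add: subspace_diff subspace_scale)
  have ineq: "2 * r * inner s s \<le> r\<^sup>2 * (\<mu> * (norm s)\<^sup>2 - q s)" for r
  proof -
    have "q (x + r *\<^sub>R s) \<le> \<mu> * (norm (x + r *\<^sub>R s))\<^sup>2"
      using S x sS by (intro qle) (simp add: subspace_add subspace_scale)
    moreover have "q (x + r *\<^sub>R s) = \<mu> + 2 * r * inner s (A *v x) + r\<^sup>2 * q s"
    proof -
      have "q (x + r *\<^sub>R s) = q x + r * inner x (A *v s) + r * inner s (A *v x) + r\<^sup>2 * q s"
      proof -
        have "A *v (x + r *\<^sub>R s) = A *v x + r *\<^sub>R (A *v s)"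
          by (simp only: linear_add[OF lin] linear_scale[OF lin])
        then show ?thesis
          unfolding q_def by (simp add: inner_add_left inner_add_right power2_eq_square distrib_left)
      qed
      moreover have "inner x (A *v s) = inner s (A *v x)" by (metis sym inner_commute)
      ultimately show ?thesis by (simp add: \<mu>_def)
    qed
    moreover have "(norm (x + r *\<^sub>R s))\<^sup>2 = 1 + 2 * r * inner s x + r\<^sup>2 * (norm s)\<^sup>2"
      using x(2) unfolding power2_norm_eq_inner
      by (simp add: inner_add_left inner_add_right power2_eq_square inner_commute norm_eq_1)
    moreover have "inner s (A *v x) = inner s s + \<mu> * inner s x"
      by (subst (2) s_def) (simp add: inner_diff_right)
    ultimately have "\<mu> + 2 * r * (inner s s + \<mu> * inner s x) + r\<^sup>2 * q s
      \<le> \<mu> * (1 + 2 * r * inner s x + r\<^sup>2 * (norm s)\<^sup>2)" by (simp only:)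
    then show ?thesis by (simp add: algebra_simps)
  qed
  have "inner s s = 0"
  proof (rule ccontr)
    assume "inner s s \<noteq> 0"
    then have pos: "inner s s > 0" using inner_ge_zero[of s] by linarith
    define C where "C = \<bar>\<mu> * (norm s)\<^sup>2 - q s\<bar> + 1"
    have C: "C > 0" "\<mu> * (norm s)\<^sup>2 - q s \<le> C" unfolding C_def by linarith+
    \<comment> \<open>With this size of step the quadratic error \<open>r\<^sup>2 * C\<close> equals
      \<open>r * inner s s\<close>, half of the first order gain.\<close>
    define r where "r = inner s s / C"
    have r: "r > 0" using pos C by (simp add: r_def)
    have "2 * r * inner s s \<le> r\<^sup>2 * C" using ineq[of r] mult_left_mono[OF C(2), of "r\<^sup>2"] by simp
    also have "\<dots> = r * inner s s" unfolding r_def using C by (simp add: power2_eq_square)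
    finally show False using r pos by simp
  qed
  then have "A *v x = complex_of_real \<mu> *s x" by (simp add: s_def sc)
  with x show ?thesis using that by blast
qed

text \<open>The orthogonal complement of the eigenvectors found so far is invariant under
  \<open>A\<close>, so the Rayleigh maximum on it supplies the next one.\<close>

lemma hermitian_eigenbasis:
  fixes A :: "complex^'n^'n" and J :: "'n set"
  assumes herm: "ctranspose A = A"
  shows "\<exists>e d. (\<forall>i\<in>J. A *v e i = complex_of_real (d i) *s e i) \<and>
    (\<forall>i\<in>J. \<forall>j\<in>J. hermitian_inner (e i) (e j) = (if i = j then 1 else 0))"
proof (induction J rule: infinite_finite_induct)
  case (infinite J) then show ?case by simp
next
  case empty then show ?case by simp
next
  case (insert k J)
  then obtain e d where ev: "\<And>i. i \<in> J \<Longrightarrow> A *v e i = complex_of_real (d i) *s e i"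
    and on: "\<And>i j. i \<in> J \<Longrightarrow> j \<in> J \<Longrightarrow> hermitian_inner (e i) (e j) = (if i = j then 1 else 0)"
    by blast
  define S where "S = {x :: complex^'n. \<forall>j\<in>J. hermitian_inner (e j) x = 0}"
  note sc = complex_of_real_scale_vec[symmetric]
  have S: "subspace S"
    unfolding S_def subspace_def by (simp add: hermitian_inner_add_right sc hermitian_inner_scale_right)
  have inv: "A *v x \<in> S" if "x \<in> S" for x
    using that unfolding S_def by (auto simp: hermitian_inner_matrix_right herm ev hermitian_inner_scale_left)
  have ne: "\<exists>x\<in>S. x \<noteq> 0"
  proof (rule ccontr)
    assume "\<not> ?thesis"
    then have triv: "\<And>x. x \<in> S \<Longrightarrow> x = 0" by blast
    \<comment> \<open>If the complement were trivial, recording the products with \<open>e j\<close>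
      would be an injective endomorphism, hence onto; but its entry \<open>k\<close> is always
      0.\<close>
    define L where "L x = (\<chi> j. if j \<in> J then hermitian_inner (e j) x else 0)" for x :: "complex^'n"
    have lin: "linear L"
      by (rule linearI) (simp_all add: L_def vec_eq_iff hermitian_inner_add_right sc hermitian_inner_scale_right)
    have "inj L"
      unfolding linear_injective_0[OF lin] using triv by (auto simp: L_def S_def vec_eq_iff split: if_splits)
    then have "surj L" by (rule linear_injective_imp_surjective[OF lin]) simp
    then obtain x where "L x = axis k 1" by (metis surjD)
    then have "L x $ k = 1" by simp
    then show False using insert.hyps by (simp add: L_def)
  qed
  obtain x \<mu> where x: "x \<in> S" "norm x = 1" "A *v x = complex_of_real \<mu> *s x"
    by (rule hermitian_Rayleigh[OF herm S inv ne])
  have ox: "hermitian_inner (e j) x = 0" "hermitian_inner x (e j) = 0" if "j \<in> J" for j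
    using x(1) that hermitian_inner_commute[of x "e j"] by (auto simp: S_def)
  show ?case
  proof (intro exI conjI)
    show "\<forall>i\<in>insert k J. A *v (e(k := x)) i = complex_of_real ((d(k := \<mu>)) i) *s (e(k := x)) i"
      using x(3) ev insert.hyps by auto
    show "\<forall>i\<in>insert k J. \<forall>j\<in>insert k J. hermitian_inner ((e(k := x)) i) ((e(k := x)) j) = (if i = j then 1 else 0)"
    proof -
      have "hermitian_inner x x = 1" using x(2) by (simp add: hermitian_inner_self)
      then show ?thesis using on ox insert.hyps by auto
    qed
  qed
qed

lemma mult_real_diag_nth: "(A ** real_diag d) $ i $ j = A $ i $ j * complex_of_real (d j)"
  by (simp add: matrix_matrix_mult_def if_distrib[where f="\<lambda>x. _ * x"] cong: if_cong)

lemma real_diag_mult_nth: "(real_diag d ** A) $ i $ j = complex_of_real (d i) * A $ i $ j"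
  by (simp add: matrix_matrix_mult_def if_distrib[where f="\<lambda>x. x * _"] cong: if_cong)

lemma hermitian_diagonalizable:
  fixes A :: "complex^'n^'n"
  assumes herm: "ctranspose A = A"
  shows "\<exists>U d. unitary_matrix U \<and> A = U ** real_diag d ** ctranspose U"
proof -
  obtain e d where "(\<forall>i\<in>(UNIV :: 'n set). A *v e i = complex_of_real (d i) *s e i) \<and>
    (\<forall>i\<in>(UNIV :: 'n set). \<forall>j\<in>UNIV. hermitian_inner (e i) (e j) = (if i = j then 1 else 0))"
    using hermitian_eigenbasis[OF herm, of UNIV] by (elim exE)
  then have ev: "\<And>i. A *v e i = complex_of_real (d i) *s e i"
    and on: "\<And>i j. hermitian_inner (e i) (e j) = (if i = j then 1 else 0)" by simp_all
  define U :: "complex^'n^'n" where "U = (\<chi> i j. e j $ i)"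
  have un: "ctranspose U ** U = mat 1"
    using on by (simp add: vec_eq_iff matrix_matrix_mult_def mat_def U_def hermitian_inner_def)
  then have un': "U ** ctranspose U = mat 1" by (simp add: matrix_left_right_inverse)
  have "A ** U = U ** real_diag d"
    unfolding vec_eq_iff mult_real_diag_nth
  proof (intro allI)
    fix i j
    have "(A ** U) $ i $ j = (A *v e j) $ i"
      by (simp add: matrix_matrix_mult_def matrix_vector_mult_def U_def)
    also have "\<dots> = U $ i $ j * complex_of_real (d j)" unfolding ev by (simp add: U_def)
    finally show "(A ** U) $ i $ j = U $ i $ j * complex_of_real (d j)" .
  qed
  then have "U ** real_diag d ** ctranspose U = A ** (U ** ctranspose U)" by (simp add: matrix_mul_assoc)
  then show ?thesis using un un' unfolding unitary_matrix_def by (intro exI[of _ U] exI[of _ d]) simp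
qed


text \<open>Two diagonalisations differ by a matrix \<open>X\<close> that intertwines their
  eigenvalues: \<open>X $ i $ j\<close> vanishes unless \<open>e i = d j\<close>. Such an
  \<open>X\<close> intertwines the values of \<open>f\<close> at them as well, so the description in
  \<open>hermitian_fun\<close> is unambiguous.\<close>

lemma hermitian_fun_eq:
  fixes A :: "complex^'n^'n"
  assumes U: "unitary_matrix U" and A: "A = U ** real_diag d ** ctranspose U"
  shows "hermitian_fun f A = U ** real_diag (\<lambda>i. f (d i)) ** ctranspose U"
  unfolding hermitian_fun_def
proof (rule the_equality)
  show "\<exists>Ua da. unitary_matrix Ua \<and> A = Ua ** real_diag da ** ctranspose Ua \<and>
    U ** real_diag (\<lambda>i. f (d i)) ** ctranspose U = Ua ** real_diag (\<lambda>i. f (da i)) ** ctranspose Ua"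
    using U A by blast
next
  fix B assume "\<exists>U d. unitary_matrix U \<and> A = U ** real_diag d ** ctranspose U \<and> B = U ** real_diag (\<lambda>i. f (d i)) ** ctranspose U"
  then obtain W e where W: "unitary_matrix W" and AW: "A = W ** real_diag e ** ctranspose W"
    and B: "B = W ** real_diag (\<lambda>i. f (e i)) ** ctranspose W" by blast
  have u: "ctranspose U ** U = mat 1" "U ** ctranspose U = mat 1" "ctranspose W ** W = mat 1" "W ** ctranspose W = mat 1"
    using U W by (simp_all add: unitary_matrix_def matrix_left_right_inverse)
  define X where "X = ctranspose W ** U"
  have "real_diag e ** X = ctranspose W ** (W ** real_diag e ** ctranspose W) ** U"
    unfolding X_def by (simp add: matrix_mul_assoc u)
  also have "\<dots> = ctranspose W ** (U ** real_diag d ** ctranspose U) ** U" using A AW by simp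
  also have "\<dots> = X ** real_diag d ** (ctranspose U ** U)" unfolding X_def by (simp only: matrix_mul_assoc)
  finally have eX: "real_diag e ** X = X ** real_diag d" by (simp add: u)
  have "complex_of_real (f (e i)) * X $ i $ j = X $ i $ j * complex_of_real (f (d j))" for i j
  proof (cases "X $ i $ j = 0")
    case False
    have "complex_of_real (e i) * X $ i $ j = X $ i $ j * complex_of_real (d j)"
      using eX by (metis mult_real_diag_nth real_diag_mult_nth)
    then show ?thesis using False by (simp add: mult.commute)
  qed simp
  then have fX: "real_diag (\<lambda>i. f (e i)) ** X = X ** real_diag (\<lambda>i. f (d i))"
    by (simp add: vec_eq_iff mult_real_diag_nth real_diag_mult_nth)
  have "B = W ** real_diag (\<lambda>i. f (e i)) ** ctranspose W ** (U ** ctranspose U)" using B u by simp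
  also have "\<dots> = W ** (real_diag (\<lambda>i. f (e i)) ** X) ** ctranspose U" unfolding X_def by (simp only: matrix_mul_assoc)
  also have "\<dots> = (W ** ctranspose W) ** U ** real_diag (\<lambda>i. f (d i)) ** ctranspose U"
    unfolding fX by (simp only: X_def matrix_mul_assoc)
  finally show "B = U ** real_diag (\<lambda>i. f (d i)) ** ctranspose U" by (simp add: u)
qed

lemma trace_real_diag_conj:
  fixes U :: "complex^'n^'n"
  assumes "unitary_matrix U"
  shows "trace (U ** real_diag d ** ctranspose U) = complex_of_real (\<Sum>i\<in>UNIV. d i)"
proof -
  have "trace (U ** real_diag d ** ctranspose U) = trace (ctranspose U ** (U ** real_diag d))" by (rule trace_mul_sym)
  also have "ctranspose U ** (U ** real_diag d) = real_diag d"
    using assms by (simp add: matrix_mul_assoc unitary_matrix_def)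
  finally show ?thesis by (simp add: trace_def)
qed

section \<open>The Hilbert-Schmidt norm and singular values\<close>

lemma trace_ctranspose_mult: "trace (ctranspose M ** M) = complex_of_real ((norm (M :: complex^'n^'n))\<^sup>2)"
proof -
  have "trace (ctranspose M ** M) = (\<Sum>j\<in>UNIV. \<Sum>i\<in>UNIV. complex_of_real ((cmod (M $ i $ j))\<^sup>2))"
    unfolding trace_def matrix_matrix_mult_def complex_norm_square by (simp add: mult.commute)
  also have "\<dots> = (\<Sum>i\<in>UNIV. \<Sum>j\<in>UNIV. complex_of_real ((cmod (M $ i $ j))\<^sup>2))" by (rule sum.swap)
  also have "\<dots> = complex_of_real ((norm M)\<^sup>2)"
    by (simp add: norm_vec_def L2_set_def sum_nonneg)
  finally show ?thesis .
qed


lemma ctranspose_vector_mult: "(ctranspose M ** M) *v u = ctranspose M *v (M *v u)"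
  by (rule matrix_vector_mul_assoc[symmetric])

text \<open>The left singular vectors are taken to be zero where the singular value vanishes; Bessel's
  inequality is all that is needed of them, so no completion to an orthonormal basis is required.\<close>

lemma singular_value_decomposition:
  fixes M :: "complex^'n^'n"
  obtains v a :: "'n \<Rightarrow> complex^'n" and s :: "'n \<Rightarrow> real"
  where "\<And>i j. hermitian_inner (v i) (v j) = (if i = j then 1 else 0)"
    and "\<And>x. x = (\<Sum>i\<in>UNIV. hermitian_inner (v i) x *s v i)"
    and "\<And>i. 0 \<le> s i"
    and "\<And>i. M *v v i = complex_of_real (s i) *s a i"
    and "\<And>i j. i \<noteq> j \<Longrightarrow> hermitian_inner (a i) (a j) = 0" and "\<And>i. norm (a i) \<le> 1"
    and "\<And>i. hermitian_inner (a i) (M *v v i) = complex_of_real (s i)"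
    and "\<And>f. Re (trace (hermitian_fun f (ctranspose M ** M))) = (\<Sum>i\<in>UNIV. f ((s i)\<^sup>2))"
proof -
  have "ctranspose (ctranspose M ** M) = ctranspose M ** M" by (simp add: ctranspose_mult)
  then obtain U d where U: "unitary_matrix U" and A: "ctranspose M ** M = U ** real_diag d ** ctranspose U"
    using hermitian_diagonalizable by blast
  have u: "ctranspose U ** U = mat 1" "U ** ctranspose U = mat 1"
    using U by (simp_all add: unitary_matrix_def matrix_left_right_inverse)
  define v where "v i = column i U" for i
  have on: "hermitian_inner (v i) (v j) = (if i = j then 1 else 0)" for i j
  proof -
    have "hermitian_inner (v i) (v j) = (ctranspose U ** U) $ i $ j"
      by (simp add: v_def column_def hermitian_inner_def matrix_matrix_mult_def)
    then show ?thesis by (simp add: u mat_def)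
  qed
  have expand: "x = (\<Sum>i\<in>UNIV. hermitian_inner (v i) x *s v i)" for x
  proof -
    have "x = U *v (ctranspose U *v x)" by (simp add: matrix_vector_mul_assoc u)
    also have "\<dots> = (\<Sum>i\<in>UNIV. hermitian_inner (v i) x *s v i)"
      by (simp add: vec_eq_iff matrix_vector_mult_def v_def column_def hermitian_inner_def mult.commute)
    finally show ?thesis .
  qed
  have ev: "(ctranspose M ** M) *v v j = complex_of_real (d j) *s v j" for j
  proof -
    have "(ctranspose M ** M) ** U = U ** real_diag d ** (ctranspose U ** U)"
      unfolding A by (simp only: matrix_mul_assoc)
    then have "((ctranspose M ** M) ** U) $ i $ j = (U ** real_diag d) $ i $ j" for i by (simp add: u)
    then show ?thesis
      unfolding mult_real_diag_nth
      by (simp add: vec_eq_iff v_def column_def) (simp add: matrix_matrix_mult_def matrix_vector_mult_def mult.commute)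
  qed
  have gram: "hermitian_inner (M *v v i) (M *v v j) = (if i = j then complex_of_real (d i) else 0)" for i j
  proof -
    have "hermitian_inner (M *v v i) (M *v v j) = hermitian_inner (v i) ((ctranspose M ** M) *v v j)"
      by (simp add: ctranspose_vector_mult hermitian_inner_matrix_right)
    then show ?thesis unfolding ev hermitian_inner_scale_right on by simp
  qed
  have d: "d i = (norm (M *v v i))\<^sup>2" for i
    using gram[of i i] by (simp only: hermitian_inner_self if_True simp_thms of_real_eq_iff)
  define s where "s i = norm (M *v v i)" for i
  \<comment> \<open>Division by zero yields 0, so \<open>a i\<close> vanishes together with
    \<open>s i\<close>.\<close>
  define a where "a i = complex_of_real (1 / s i) *s (M *v v i)" for i
  show ?thesis
  proof
    show "M *v v i = complex_of_real (s i) *s a i" for i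
      by (cases "s i = 0") (simp_all add: a_def s_def vector_smult_assoc)
    show "hermitian_inner (a i) (a j) = 0" if "i \<noteq> j" for i j
      using that by (simp add: a_def hermitian_inner_scale_left hermitian_inner_scale_right gram)
    show "norm (a i) \<le> 1" for i by (simp add: a_def norm_scale_vec s_def norm_divide)
    show "hermitian_inner (a i) (M *v v i) = complex_of_real (s i)" for i
      by (cases "s i = 0") (simp_all add: a_def hermitian_inner_scale_left gram d s_def[symmetric] power2_eq_square)
    show "Re (trace (hermitian_fun f (ctranspose M ** M))) = (\<Sum>i\<in>UNIV. f ((s i)\<^sup>2))" for f
      unfolding hermitian_fun_eq[OF U A] trace_real_diag_conj[OF U] by (simp add: d s_def)
  qed (fact on expand | simp add: s_def)+
qed

section \<open>Convexity of trace functions of singular values\<close>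

lemma even_convex_mono:
  fixes \<phi> :: "real \<Rightarrow> real"
  assumes conv: "convex_on UNIV \<phi>" and even: "\<And>x. \<phi> (- x) = \<phi> x" and xy: "\<bar>x\<bar> \<le> y"
  shows "\<phi> x \<le> \<phi> y"
proof (cases "y = 0")
  case False
  then have y: "y > 0" using xy by linarith
  \<comment> \<open>The weight that writes \<open>x\<close> as a convex combination of
    \<open>y\<close> and \<open>- y\<close>, where \<phi> takes the same value.\<close>
  define t where "t = (y - x) / (2 * y)"
  have t: "0 \<le> t" "t \<le> 1" using xy y by (auto simp: t_def field_simps)
  have "\<phi> ((1 - t) *\<^sub>R y + t *\<^sub>R (- y)) \<le> (1 - t) * \<phi> y + t * \<phi> (- y)"
    using convex_onD[OF conv t, of y "- y"] by simp
  moreover have "(1 - t) *\<^sub>R y + t *\<^sub>R (- y) = x" using y by (simp add: t_def field_simps)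
  ultimately have "\<phi> x \<le> (1 - t) * \<phi> y + t * \<phi> y" by (simp only: even)
  then show ?thesis by (simp add: algebra_simps)
qed (use xy in simp)

text \<open>Jensen's inequality after placing the missing mass, 1 minus the sum of \<open>S\<close>,
  at the point 0.\<close>

lemma convex_substochastic:
  fixes \<phi> :: "real \<Rightarrow> real" and S :: "'n::finite \<Rightarrow> real"
  assumes conv: "convex_on UNIV \<phi>" and S: "\<And>k. 0 \<le> S k" "(\<Sum>k\<in>UNIV. S k) \<le> 1"
  shows "\<phi> (\<Sum>k\<in>UNIV. S k * \<tau> k) \<le> \<phi> 0 + (\<Sum>k\<in>UNIV. S k * (\<phi> (\<tau> k) - \<phi> 0))"
proof (cases "(\<Sum>k\<in>UNIV. S k) = 0")
  case True
  then have "S k = 0" for k using S(1) by (simp add: sum_nonneg_eq_0_iff)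
  then show ?thesis by simp
next
  case False
  define r where "r = (\<Sum>k\<in>UNIV. S k)"
  have r: "0 < r" "r \<le> 1" using S False sum_nonneg[of UNIV S] by (auto simp: r_def)
  have "\<phi> (\<Sum>k\<in>UNIV. (S k / r) *\<^sub>R \<tau> k) \<le> (\<Sum>k\<in>UNIV. (S k / r) * \<phi> (\<tau> k))"
  proof (rule convex_on_sum[OF _ _ conv])
    show "(\<Sum>k\<in>UNIV. S k / r) = 1" using r by (simp add: sum_divide_distrib[symmetric] r_def[symmetric])
  qed (use S r in auto)
  moreover have "\<phi> (r * (\<Sum>k\<in>UNIV. (S k / r) *\<^sub>R \<tau> k)) \<le> (1 - r) * \<phi> 0 + r * \<phi> (\<Sum>k\<in>UNIV. (S k / r) *\<^sub>R \<tau> k)"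
    using convex_onD[OF conv, of r 0] r by simp
  moreover have "r * (\<Sum>k\<in>UNIV. (S k / r) *\<^sub>R \<tau> k) = (\<Sum>k\<in>UNIV. S k * \<tau> k)"
    using r by (simp add: sum_distrib_left)
  moreover have "r * (\<Sum>k\<in>UNIV. (S k / r) * \<phi> (\<tau> k)) = (\<Sum>k\<in>UNIV. S k * \<phi> (\<tau> k))"
    using r by (simp add: sum_distrib_left)
  ultimately have "\<phi> (\<Sum>k\<in>UNIV. S k * \<tau> k) \<le> (1 - r) * \<phi> 0 + (\<Sum>k\<in>UNIV. S k * \<phi> (\<tau> k))"
    using r by (smt (verit) mult_left_mono)
  also have "(1 - r) * \<phi> 0 + (\<Sum>k\<in>UNIV. S k * \<phi> (\<tau> k)) = \<phi> 0 + (\<Sum>k\<in>UNIV. S k * (\<phi> (\<tau> k) - \<phi> 0))"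
    by (simp add: r_def right_diff_distrib sum_subtractf left_diff_distrib sum_distrib_right)
  finally show ?thesis .
qed

text \<open>Expanding \<open>v i\<close> in the right singular vectors of \<open>M\<close> bounds
  the diagonal of \<open>M\<close> in the frames \<open>v\<close> and \<open>a\<close> by the
  singular values, through a doubly substochastic matrix; Jensen's inequality does the rest.
  Singular vectors of \<open>M\<close> give equality, so the trace is a maximum, over frames, of
  functions that are convex in \<open>M\<close>.\<close>

lemma trace_variational:
  fixes M :: "complex^'n^'n" and v a :: "'n \<Rightarrow> complex^'n" and \<phi> :: "real \<Rightarrow> real"
  assumes conv: "convex_on UNIV \<phi>" and even: "\<And>x. \<phi> (- x) = \<phi> x"
    and von: "\<And>i j. hermitian_inner (v i) (v j) = (if i = j then 1 else 0)"
    and aorth: "\<And>i j. i \<noteq> j \<Longrightarrow> hermitian_inner (a i) (a j) = 0" and ale: "\<And>i. norm (a i) \<le> 1"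
    and f: "\<And>x. 0 \<le> x \<Longrightarrow> f (x\<^sup>2) = \<phi> x"
  shows "(\<Sum>i\<in>UNIV. \<phi> (Re (hermitian_inner (a i) (M *v v i)))) \<le> Re (trace (hermitian_fun f (ctranspose M ** M)))"
proof -
  obtain b c :: "'n \<Rightarrow> complex^'n" and \<tau> :: "'n \<Rightarrow> real" where bon: "\<And>i j. hermitian_inner (b i) (b j) = (if i = j then 1 else 0)"
    and expand: "\<And>x. x = (\<Sum>i\<in>UNIV. hermitian_inner (b i) x *s b i)"
    and \<tau>: "\<And>i. 0 \<le> \<tau> i"
    and Mb: "\<And>i. M *v b i = complex_of_real (\<tau> i) *s c i"
    and corth: "\<And>i j. i \<noteq> j \<Longrightarrow> hermitian_inner (c i) (c j) = 0" and cle: "\<And>i. norm (c i) \<le> 1"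
    and "\<And>i. hermitian_inner (c i) (M *v b i) = complex_of_real (\<tau> i)"
    and tr: "\<And>f. Re (trace (hermitian_fun f (ctranspose M ** M))) = (\<Sum>i\<in>UNIV. f ((\<tau> i)\<^sup>2))"
    by (rule singular_value_decomposition[of M], rule that; assumption)
  have norm1: "norm (e i) = 1" if "\<And>i j. hermitian_inner (e i) (e j) = (if i = j then 1 else 0)" for e :: "'n \<Rightarrow> complex^'n" and i
  proof -
    have "complex_of_real ((norm (e i))\<^sup>2) = complex_of_real 1" using that[of i i] hermitian_inner_self[of "e i"] by simp
    then have "(norm (e i))\<^sup>2 = 1" by (simp only: of_real_eq_iff)
    then show ?thesis using norm_ge_zero[of "e i"] by (auto simp: power2_eq_1_iff)
  qed
  define p where "p i k = (cmod (hermitian_inner (b k) (v i)))\<^sup>2" for i k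
  define q where "q i k = (cmod (hermitian_inner (a i) (c k)))\<^sup>2" for i k
  \<comment> \<open>Each term of the expansion carries a product of two overlaps. The
    arithmetic-geometric mean separates them, and Bessel's inequality then bounds all row and column
    sums.\<close>
  define S where "S i k = (p i k + q i k) / 2" for i k
  have S0: "0 \<le> S i k" for i k by (simp add: S_def p_def q_def)
  have p_row: "(\<Sum>k\<in>UNIV. p i k) \<le> 1" for i
    using hermitian_Bessel[of b "v i"] bon norm1[OF bon] norm1[OF von] by (simp add: p_def)
  have p_col: "(\<Sum>i\<in>UNIV. p i k) \<le> 1" for k
    using hermitian_Bessel[of v "b k"] von norm1[OF bon] norm1[OF von]
    by (simp add: p_def hermitian_inner_commute[of "b k"])
  have q_row: "(\<Sum>k\<in>UNIV. q i k) \<le> 1" for i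
    using hermitian_Bessel[of c "a i"] corth cle ale[of i] power_le_one[of "norm (a i)" 2]
    by (simp add: q_def hermitian_inner_commute[of "a i"])
  have q_col: "(\<Sum>i\<in>UNIV. q i k) \<le> 1" for k
    using hermitian_Bessel[of a "c k"] aorth ale cle[of k] power_le_one[of "norm (c k)" 2]
    by (simp add: q_def)
  have row: "(\<Sum>k\<in>UNIV. S i k) \<le> 1" for i
    using p_row[of i] q_row[of i] by (simp add: S_def sum_divide_distrib[symmetric] sum.distrib)
  have col: "(\<Sum>i\<in>UNIV. S i k) \<le> 1" for k
    using p_col[of k] q_col[of k] by (simp add: S_def sum_divide_distrib[symmetric] sum.distrib)
  have entry: "\<phi> (Re (hermitian_inner (a i) (M *v v i))) \<le> \<phi> (\<Sum>k\<in>UNIV. S i k * \<tau> k)" for i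
  proof (rule even_convex_mono[OF conv even])
    have lin: "M *v (\<Sum>k\<in>UNIV. g k) = (\<Sum>k\<in>UNIV. M *v g k)" for g :: "'n \<Rightarrow> complex^'n"
      by (rule linear_sum[OF matrix_vector_mul_linear])
    have "M *v v i = (\<Sum>k\<in>UNIV. (hermitian_inner (b k) (v i) * complex_of_real (\<tau> k)) *s c k)"
      by (subst expand[of "v i"]) (simp add: lin Mb vector_smult_assoc vector_scalar_commute)
    then have "hermitian_inner (a i) (M *v v i) = (\<Sum>k\<in>UNIV. hermitian_inner (b k) (v i) * complex_of_real (\<tau> k) * hermitian_inner (a i) (c k))"
      by (simp add: hermitian_inner_sum_right hermitian_inner_scale_right)
    then have "cmod (hermitian_inner (a i) (M *v v i)) \<le> (\<Sum>k\<in>UNIV. cmod (hermitian_inner (b k) (v i) * complex_of_real (\<tau> k) * hermitian_inner (a i) (c k)))"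
      by (simp add: norm_sum)
    also have "\<dots> \<le> (\<Sum>k\<in>UNIV. S i k * \<tau> k)"
    proof (rule sum_mono)
      fix k
      have "cmod (hermitian_inner (b k) (v i)) * cmod (hermitian_inner (a i) (c k)) \<le> S i k"
        using sum_squares_bound[of "cmod (hermitian_inner (b k) (v i))" "cmod (hermitian_inner (a i) (c k))"]
        by (simp add: S_def p_def q_def)
      from mult_right_mono[OF this \<tau>[of k]]
      show "cmod (hermitian_inner (b k) (v i) * complex_of_real (\<tau> k) * hermitian_inner (a i) (c k)) \<le> S i k * \<tau> k"
        using \<tau>[of k] by (simp add: norm_mult ac_simps)
    qed
    finally show "\<bar>Re (hermitian_inner (a i) (M *v v i))\<bar> \<le> (\<Sum>k\<in>UNIV. S i k * \<tau> k)"
      using abs_Re_le_cmod order_trans by blast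
  qed
  \<comment> \<open>An even convex function is least at 0. The differences below are therefore
    nonnegative, and column sums at most 1 may be replaced by 1.\<close>
  have ge0: "\<phi> 0 \<le> \<phi> x" for x
    using even_convex_mono[OF conv even, of 0 "\<bar>x\<bar>"] even by (cases "x \<ge> 0") auto
  have "(\<Sum>i\<in>UNIV. \<phi> (Re (hermitian_inner (a i) (M *v v i)))) \<le> (\<Sum>i\<in>UNIV. \<phi> 0 + (\<Sum>k\<in>UNIV. S i k * (\<phi> (\<tau> k) - \<phi> 0)))"
    by (rule sum_mono) (rule order_trans[OF entry convex_substochastic[OF conv S0 row]])
  also have "\<dots> = (\<Sum>k\<in>(UNIV::'n set). \<phi> 0) + (\<Sum>i\<in>UNIV. \<Sum>k\<in>UNIV. S i k * (\<phi> (\<tau> k) - \<phi> 0))"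
    by (simp add: sum.distrib)
  also have "(\<Sum>i\<in>UNIV. \<Sum>k\<in>UNIV. S i k * (\<phi> (\<tau> k) - \<phi> 0)) = (\<Sum>k\<in>UNIV. (\<Sum>i\<in>UNIV. S i k) * (\<phi> (\<tau> k) - \<phi> 0))"
    by (subst sum.swap) (simp add: sum_distrib_right)
  also have "\<dots> \<le> (\<Sum>k\<in>UNIV. 1 * (\<phi> (\<tau> k) - \<phi> 0))"
    using col ge0 by (intro sum_mono mult_right_mono) (auto simp: algebra_simps)
  also have "(\<Sum>k\<in>(UNIV::'n set). \<phi> 0) + (\<Sum>k\<in>UNIV. 1 * (\<phi> (\<tau> k) - \<phi> 0)) = (\<Sum>k\<in>UNIV. f ((\<tau> k)\<^sup>2))"
    using f \<tau> by (simp add: sum_subtractf)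
  finally show ?thesis unfolding tr by simp
qed

text \<open>A maximum of convex functions is convex: the frames are the singular vectors of the
  intermediate point, where the variational bound is an equality, and the same frames give lower
  bounds at \<open>A\<close> and \<open>B\<close>.\<close>

lemma convex_trace_function:
  fixes f \<phi> :: "real \<Rightarrow> real"
  assumes conv: "convex_on UNIV \<phi>" and even: "\<And>x. \<phi> (- x) = \<phi> x" and f: "\<And>x. 0 \<le> x \<Longrightarrow> f (x\<^sup>2) = \<phi> x"
  shows "convex_on UNIV (\<lambda>M :: complex^'n^'n. Re (trace (hermitian_fun f (ctranspose M ** M))))"
proof (rule convex_onI)
  fix t and A B :: "complex^'n^'n" assume t: "0 < t" "t < (1::real)"
  let ?M = "(1 - t) *\<^sub>R A + t *\<^sub>R B"
  obtain v a :: "'n \<Rightarrow> complex^'n" and s :: "'n \<Rightarrow> real"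
    where von: "\<And>i j. hermitian_inner (v i) (v j) = (if i = j then 1 else 0)"
    and "\<And>x. x = (\<Sum>i\<in>UNIV. hermitian_inner (v i) x *s v i)"
    and s: "\<And>i. 0 \<le> s i"
    and "\<And>i. ?M *v v i = complex_of_real (s i) *s a i"
    and aorth: "\<And>i j. i \<noteq> j \<Longrightarrow> hermitian_inner (a i) (a j) = 0" and ale: "\<And>i. norm (a i) \<le> 1"
    and diag: "\<And>i. hermitian_inner (a i) (?M *v v i) = complex_of_real (s i)"
    and tr: "\<And>f. Re (trace (hermitian_fun f (ctranspose ?M ** ?M))) = (\<Sum>i\<in>UNIV. f ((s i)\<^sup>2))"
    by (rule singular_value_decomposition[of ?M], rule that; assumption)
  have lin: "?M *v x = complex_of_real (1 - t) *s (A *v x) + complex_of_real t *s (B *v x)" for x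
  proof -
    have "(r *\<^sub>R C) *v x = complex_of_real r *s (C *v x)" for r and C :: "complex^'n^'n"
      by (simp add: vec_eq_iff matrix_vector_mult_def scaleR_conv_of_real[where 'a=complex] sum_distrib_left mult.assoc)
    then show ?thesis by (simp only: matrix_vector_mult_add_rdistrib)
  qed
  have "Re (trace (hermitian_fun f (ctranspose ?M ** ?M))) = (\<Sum>i\<in>UNIV. \<phi> (Re (hermitian_inner (a i) (?M *v v i))))"
    unfolding tr diag using f s by simp
  also have "\<dots> \<le> (\<Sum>i\<in>UNIV. (1 - t) * \<phi> (Re (hermitian_inner (a i) (A *v v i))) + t * \<phi> (Re (hermitian_inner (a i) (B *v v i))))"
  proof (rule sum_mono)
    fix i
    have "Re (hermitian_inner (a i) (?M *v v i)) = (1 - t) *\<^sub>R Re (hermitian_inner (a i) (A *v v i)) + t *\<^sub>R Re (hermitian_inner (a i) (B *v v i))"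
      unfolding lin hermitian_inner_add_right hermitian_inner_scale_right by simp
    then show "\<phi> (Re (hermitian_inner (a i) (?M *v v i))) \<le> (1 - t) * \<phi> (Re (hermitian_inner (a i) (A *v v i))) + t * \<phi> (Re (hermitian_inner (a i) (B *v v i)))"
      using convex_onD[OF conv] t by simp
  qed
  also have "\<dots> = (1 - t) * (\<Sum>i\<in>UNIV. \<phi> (Re (hermitian_inner (a i) (A *v v i)))) + t * (\<Sum>i\<in>UNIV. \<phi> (Re (hermitian_inner (a i) (B *v v i))))"
    by (simp add: sum.distrib sum_distrib_left)
  also have "\<dots> \<le> (1 - t) * Re (trace (hermitian_fun f (ctranspose A ** A))) + t * Re (trace (hermitian_fun f (ctranspose B ** B)))"
    using t trace_variational[OF conv even von aorth ale f] by (intro add_mono mult_left_mono) auto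
  finally show "Re (trace (hermitian_fun f (ctranspose ?M ** ?M)))
    \<le> (1 - t) * Re (trace (hermitian_fun f (ctranspose A ** A))) + t * Re (trace (hermitian_fun f (ctranspose B ** B)))" .
qed simp

section \<open>Invariance under unitary factors\<close>

lemma trace_function_unitary_conj:
  fixes M D E :: "complex^'n^'n"
  assumes D: "unitary_matrix D" and E: "unitary_matrix E"
  shows "trace (hermitian_fun f (ctranspose (D ** M ** E) ** (D ** M ** E))) = trace (hermitian_fun f (ctranspose M ** M))"
proof -
  have "ctranspose (ctranspose M ** M) = ctranspose M ** M" by (simp add: ctranspose_mult)
  then obtain U d where U: "unitary_matrix U" and A: "ctranspose M ** M = U ** real_diag d ** ctranspose U"
    using hermitian_diagonalizable by blast
  have EE: "E ** ctranspose E = mat 1" using E by (simp add: unitary_matrix_def matrix_left_right_inverse)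
  have W: "unitary_matrix (ctranspose E ** U)"
  proof -
    have "ctranspose (ctranspose E ** U) ** (ctranspose E ** U) = ctranspose U ** (E ** ctranspose E) ** U"
      by (simp add: ctranspose_mult matrix_mul_assoc)
    then show ?thesis using U by (simp add: unitary_matrix_def EE)
  qed
  have "ctranspose (D ** M ** E) ** (D ** M ** E) = ctranspose E ** ctranspose M ** (ctranspose D ** D) ** M ** E"
    by (simp add: ctranspose_mult matrix_mul_assoc)
  also have "\<dots> = ctranspose E ** (ctranspose M ** M) ** E"
    using D by (simp add: unitary_matrix_def matrix_mul_assoc)
  also have "\<dots> = (ctranspose E ** U) ** real_diag d ** ctranspose (ctranspose E ** U)"
    unfolding A by (simp add: ctranspose_mult matrix_mul_assoc)
  finally show ?thesis
    using hermitian_fun_eq[OF W] hermitian_fun_eq[OF U A] trace_real_diag_conj[OF U] trace_real_diag_conj[OF W] by simp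
qed

lemma norm_unitary_conj:
  fixes M D E :: "complex^'n^'n"
  assumes D: "unitary_matrix D" and E: "unitary_matrix E"
  shows "norm (D ** M ** E) = norm M"
proof -
  have EE: "E ** ctranspose E = mat 1" using E by (simp add: unitary_matrix_def matrix_left_right_inverse)
  have "ctranspose (D ** M ** E) ** (D ** M ** E) = ctranspose E ** (ctranspose M ** (ctranspose D ** D) ** M ** E)"
    by (simp add: ctranspose_mult matrix_mul_assoc)
  also have "\<dots> = ctranspose E ** ((ctranspose M ** M) ** E)" using D by (simp add: unitary_matrix_def matrix_mul_assoc)
  finally have eq: "ctranspose (D ** M ** E) ** (D ** M ** E) = ctranspose E ** ((ctranspose M ** M) ** E)" .
  have "trace (ctranspose (D ** M ** E) ** (D ** M ** E)) = trace (((ctranspose M ** M) ** E) ** ctranspose E)"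
    unfolding eq by (rule trace_mul_sym)
  also have "((ctranspose M ** M) ** E) ** ctranspose E = (ctranspose M ** M) ** (E ** ctranspose E)"
    by (simp only: matrix_mul_assoc)
  finally have "complex_of_real ((norm (D ** M ** E))\<^sup>2) = complex_of_real ((norm M)\<^sup>2)"
    by (simp add: EE trace_ctranspose_mult del: of_real_power)
  then show ?thesis by (simp only: of_real_eq_iff) (simp add: power2_eq_iff_nonneg)
qed

section \<open>Change of variables in Euclidean spaces\<close>

text \<open>Indexing coordinates by the basis vectors themselves identifies every Euclidean space,
  complex matrices included, with a space of real tuples.\<close>

typedef (overloaded) ('a::euclidean_space) basis_index = "Basis :: 'a set"
  by (auto simp: ex_in_conv)

lemma bij_Rep_basis_index: "bij_betw Rep_basis_index UNIV (Basis :: 'a::euclidean_space set)"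
  unfolding bij_betw_def
  using Rep_basis_index_inject[where 'a='a] type_definition.Rep_range[OF type_definition_basis_index[where 'a='a]]
  by (auto simp: inj_on_def)

instance basis_index :: (euclidean_space) finite
proof
  show "finite (UNIV :: 'a basis_index set)"
    using bij_betw_finite[OF bij_Rep_basis_index[where 'a='a]] by simp
qed

definition basis_rank :: "'a::euclidean_space basis_index \<Rightarrow> nat" where
  "basis_rank = (SOME f. inj f)"

lemma inj_basis_rank: "inj (basis_rank :: 'a::euclidean_space basis_index \<Rightarrow> nat)"
proof -
  have "\<exists>f :: 'a basis_index \<Rightarrow> nat. inj f"
    using finite_imp_inj_to_nat_seg[OF finite_class.finite_UNIV] by blast
  then show ?thesis unfolding basis_rank_def by (rule someI_ex)
qed

text \<open>The change of variables formula of the library needs a well-ordered index type; any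
  enumeration of the basis provides one.\<close>

instantiation basis_index :: (euclidean_space) wellorder
begin

definition less_eq_basis_index :: "'a basis_index \<Rightarrow> 'a basis_index \<Rightarrow> bool" where
  "less_eq_basis_index x y \<longleftrightarrow> basis_rank x \<le> basis_rank y"

definition less_basis_index :: "'a basis_index \<Rightarrow> 'a basis_index \<Rightarrow> bool" where
  "less_basis_index x y \<longleftrightarrow> basis_rank x < basis_rank y"

instance
proof
  fix P :: "'a basis_index \<Rightarrow> bool" and a
  assume step: "\<And>x. (\<And>y. y < x \<Longrightarrow> P y) \<Longrightarrow> P x"
  show "P a" by (induction a rule: measure_induct_rule[of basis_rank]) (rule step, simp add: less_basis_index_def)
qed (auto simp: less_eq_basis_index_def less_basis_index_def dest: injD[OF inj_basis_rank])

end

definition to_vec :: "'a::euclidean_space \<Rightarrow> real ^ 'a basis_index" where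
  "to_vec x = (\<chi> i. x \<bullet> Rep_basis_index i)"

definition of_vec :: "real ^ 'a::euclidean_space basis_index \<Rightarrow> 'a" where
  "of_vec v = (\<Sum>i\<in>UNIV. v $ i *\<^sub>R Rep_basis_index i)"

lemma of_vec_to_vec [simp]: "of_vec (to_vec x) = x"
proof -
  have "of_vec (to_vec x) = (\<Sum>b\<in>Basis. (x \<bullet> b) *\<^sub>R b)"
    unfolding of_vec_def to_vec_def
    using sum.reindex_bij_betw[OF bij_Rep_basis_index, of "\<lambda>b. (x \<bullet> b) *\<^sub>R b"] by simp
  then show ?thesis by (simp add: euclidean_representation)
qed

lemma Rep_basis_index_Basis [simp]: "Rep_basis_index i \<in> Basis"
  by (rule Rep_basis_index)

lemma to_vec_of_vec [simp]: "to_vec (of_vec v) = v"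
proof -
  have "(\<Sum>i\<in>UNIV. v $ i * (Rep_basis_index i \<bullet> Rep_basis_index j)) = v $ j" for j
  proof -
    have "v $ i * (Rep_basis_index i \<bullet> Rep_basis_index j) = (if i = j then v $ i else 0)" for i
      by (simp add: inner_Basis Rep_basis_index_inject)
    then show ?thesis by simp
  qed
  then show ?thesis by (simp add: to_vec_def of_vec_def vec_eq_iff inner_sum_left)
qed

lemma linear_to_vec: "linear to_vec"
  by (rule linearI) (simp_all add: to_vec_def vec_eq_iff inner_add_left)

lemma linear_of_vec: "linear of_vec"
  by (rule linearI) (simp_all add: of_vec_def sum.distrib scaleR_add_left scaleR_sum_right)

lemma bounded_linear_to_vec: "bounded_linear to_vec" and bounded_linear_of_vec: "bounded_linear of_vec"
  by (simp_all add: linear_conv_bounded_linear[symmetric] linear_to_vec linear_of_vec)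

lemma to_vec_meas[measurable]: "to_vec \<in> borel_measurable borel"
  and of_vec_meas[measurable]: "of_vec \<in> borel_measurable borel"
  by (intro borel_measurable_continuous_onI linear_continuous_on bounded_linear_to_vec bounded_linear_of_vec)+

text \<open>Coordinates carry boxes to boxes with the same side lengths, and volumes of boxes
  determine Lebesgue measure.\<close>

lemma distr_of_vec: "distr lborel borel of_vec = (lborel :: 'a::euclidean_space measure)"
proof (rule lborel_eqI[symmetric])
  fix l u :: 'a assume lu: "\<And>b. b \<in> Basis \<Longrightarrow> l \<bullet> b \<le> u \<bullet> b"
  have eq: "of_vec -` box l u = box (to_vec l) (to_vec u)"
  proof -
    have "x \<in> box l u \<longleftrightarrow> to_vec x \<in> box (to_vec l) (to_vec u)" for x :: 'a
      unfolding mem_box_cart mem_box to_vec_def bij_betw_imp_surj_on[OF bij_Rep_basis_index, symmetric]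
      by simp
    then show ?thesis by (metis (no_types, lifting) to_vec_of_vec vimage_eq set_eqI)
  qed
  have "emeasure (distr lborel borel of_vec) (box l u) = emeasure lborel (box (to_vec l) (to_vec u))"
    by (subst emeasure_distr) (auto simp: eq)
  also have "\<dots> = (\<Prod>b\<in>Basis. (to_vec u - to_vec l) \<bullet> b)"
  proof (rule emeasure_lborel_box)
    fix b :: "real ^ 'a basis_index" assume "b \<in> Basis"
    then show "to_vec l \<bullet> b \<le> to_vec u \<bullet> b" using lu by (auto simp: Basis_vec_def inner_axis to_vec_def)
  qed
  also have "(\<Prod>b\<in>Basis. (to_vec u - to_vec l) \<bullet> b) = (\<Prod>i\<in>UNIV. (u - l) \<bullet> Rep_basis_index i)"
  proof -
    have "bij_betw (\<lambda>i. axis i 1) UNIV (Basis :: (real ^ 'a basis_index) set)"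
      by (auto simp: bij_betw_def inj_on_def axis_eq_axis Basis_vec_def)
    from prod.reindex_bij_betw[OF this, of "\<lambda>b. (to_vec u - to_vec l) \<bullet> b"]
    show ?thesis by (simp add: inner_axis to_vec_def inner_diff_left)
  qed
  also have "\<dots> = (\<Prod>b\<in>Basis. (u - l) \<bullet> b)" by (simp add: prod.reindex_bij_betw[OF bij_Rep_basis_index])
  finally show "emeasure (distr lborel borel of_vec) (box l u) = (\<Prod>b\<in>Basis. (u - l) \<bullet> b)" .
qed simp

lemma nn_integral_of_vec:
  fixes F :: "'a::euclidean_space \<Rightarrow> ennreal"
  assumes [measurable]: "F \<in> borel_measurable borel"
  shows "(\<integral>\<^sup>+x. F x \<partial>lborel) = (\<integral>\<^sup>+v. F (of_vec v) \<partial>lborel)"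
proof -
  have "(\<integral>\<^sup>+x. F x \<partial>lborel) = (\<integral>\<^sup>+x. F x \<partial>distr lborel borel of_vec)" by (simp add: distr_of_vec)
  also have "\<dots> = (\<integral>\<^sup>+v. F (of_vec v) \<partial>lborel)" by (rule nn_integral_distr) auto
  finally show ?thesis .
qed

section \<open>Real Jacobians and the change of variables formula\<close>

definition jac :: "('a::euclidean_space \<Rightarrow> 'a) \<Rightarrow> real" where
  "jac A = \<bar>det (matrix (to_vec \<circ> A \<circ> of_vec))\<bar>"

lemma jac_nonneg: "0 \<le> jac A" by (simp add: jac_def)

lemma jac_compose:
  assumes "linear A" "linear B"
  shows "jac (A \<circ> B) = jac A * jac B"
proof -
  have lin: "linear (to_vec \<circ> A \<circ> of_vec)" "linear (to_vec \<circ> B \<circ> of_vec)"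
    using assms by (auto intro!: linear_compose linear_to_vec linear_of_vec)
  have "to_vec \<circ> (A \<circ> B) \<circ> of_vec = (to_vec \<circ> A \<circ> of_vec) \<circ> (to_vec \<circ> B \<circ> of_vec)" by (auto simp: fun_eq_iff)
  then show ?thesis unfolding jac_def using matrix_compose[OF lin(2,1)] by (simp add: det_mul abs_mult)
qed

lemma jac_id: "jac id = 1"
proof -
  have "to_vec \<circ> id \<circ> of_vec = (id :: real ^ 'a basis_index \<Rightarrow> _)" by (auto simp: fun_eq_iff)
  then show ?thesis by (simp add: jac_def matrix_id_mat_1 flip: id_def)
qed

lemma borel_measurable_jac:
  assumes "\<And>v. (\<lambda>x. A x v) \<in> borel_measurable borel"
  shows "(\<lambda>x. jac (A x)) \<in> borel_measurable borel"
proof -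
  have [measurable]: "(\<lambda>x. matrix (to_vec \<circ> A x \<circ> of_vec) $ i $ j) \<in> borel_measurable borel" for i j
    unfolding matrix_def to_vec_def using assms by (auto intro!: borel_measurable_inner)
  show ?thesis unfolding jac_def det_def by measurable
qed

text \<open>The formula for absolutely integrable functions on real tuples, read off in coordinates;
  nonnegativity and the finite integral of \<open>f\<close> convert between the two kinds of
  integral. The determinant is that of a real linear map, so complex \<open>n\<close> by
  \<open>n\<close> matrices count with dimension \<open>2 * n * n\<close>. The image of
  \<open>S\<close> is treated as a Lebesgue set, hence the completed measure on the left.\<close>

theorem nn_integral_change_of_variables:
  fixes g :: "'a::euclidean_space \<Rightarrow> 'a" and f :: "'a \<Rightarrow> real"
  assumes S: "S \<in> sets borel"
    and der: "\<And>x. x \<in> S \<Longrightarrow> (g has_derivative g' x) (at x within S)"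
    and inj: "inj_on g S"
    and f[measurable]: "f \<in> borel_measurable borel" and f0: "\<And>x. 0 \<le> f x"
    and fin: "(\<integral>\<^sup>+x. f x \<partial>lborel) < \<infinity>"
    and J[measurable]: "(\<lambda>x. jac (g' x)) \<in> borel_measurable borel"
    and g[measurable]: "g \<in> borel_measurable borel"
  shows "g ` S \<in> sets lebesgue"
    and "(\<integral>\<^sup>+x. ennreal (f x) * indicator (g ` S) x \<partial>lebesgue) = (\<integral>\<^sup>+x. ennreal (jac (g' x)) * ennreal (f (g x)) * indicator S x \<partial>lborel)"
proof -
  show gS: "g ` S \<in> sets lebesgue"
  proof (rule differentiable_image_in_sets_lebesgue)
    show "g differentiable_on S" unfolding differentiable_on_def differentiable_def using der by blast
  qed (use S in auto)
  define Sv where "Sv = (of_vec -` S :: (real ^ 'a basis_index) set)"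
  define gv where "gv = to_vec \<circ> g \<circ> of_vec"
  define gv' where "gv' = (\<lambda>x. to_vec \<circ> g' (of_vec x) \<circ> (of_vec :: real ^ 'a basis_index \<Rightarrow> 'a))"
  define fv where "fv = (\<lambda>v. vec (f (of_vec v)) :: real ^ 1)"
  have Sv[measurable]: "Sv \<in> sets borel"
    unfolding Sv_def using measurable_sets[OF of_vec_meas S] by simp
  have oS: "of_vec ` Sv = S" unfolding Sv_def by (metis surj_image_vimage_eq surjI of_vec_to_vec)
  have derv: "(gv has_derivative gv' x) (at x within Sv)" if "x \<in> Sv" for x
    unfolding gv_def gv'_def
  proof (intro diff_chain_within)
    show "(of_vec has_derivative of_vec) (at x within Sv)"
      by (rule bounded_linear_imp_has_derivative[OF bounded_linear_of_vec])
    show "(g has_derivative g' (of_vec x)) (at (of_vec x) within of_vec ` Sv)"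
      unfolding oS using that by (intro der) (simp add: Sv_def)
    show "(to_vec has_derivative to_vec) (at (g (of_vec x)) within g ` of_vec ` Sv)"
      by (rule bounded_linear_imp_has_derivative[OF bounded_linear_to_vec])
  qed
  have injv: "inj_on gv Sv"
  proof (rule inj_onI)
    fix x y assume xy: "x \<in> Sv" "y \<in> Sv" "gv x = gv y"
    then have "of_vec (gv x) = of_vec (gv y)" by simp
    then have "of_vec x = of_vec y" using inj_onD[OF inj] xy by (simp add: gv_def Sv_def)
    then show "x = y" by (metis to_vec_of_vec)
  qed
  have gvS: "gv ` Sv \<in> sets lebesgue"
  proof (rule differentiable_image_in_sets_lebesgue)
    show "gv differentiable_on Sv" unfolding differentiable_on_def differentiable_def using derv by blast
  qed auto
  have detv: "\<bar>det (matrix (gv' x))\<bar> = jac (g' (of_vec x))" for x by (simp add: jac_def gv'_def)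
  \<comment> \<open>\<open>of_vec\<close> preserves Lebesgue measure on Borel sets. A function
    measurable only for the completion is first replaced by a Borel function equal to it almost
    everywhere.\<close>
  have transfer: "(\<integral>\<^sup>+x. F x \<partial>lebesgue) = (\<integral>\<^sup>+v. F (of_vec v) \<partial>lebesgue)"
    if F: "F \<in> borel_measurable lebesgue" for F :: "'a \<Rightarrow> ennreal"
  proof -
    obtain F' where F'[measurable]: "F' \<in> borel_measurable lborel" and ae: "AE x in lborel. F x = F' x"
      using completion_ex_borel_measurable[OF F] by blast
    have "AE x in distr lborel borel of_vec. F x = F' x" unfolding distr_of_vec by (rule ae)
    then have ae': "AE v in (lborel :: (real ^ 'a basis_index) measure). F (of_vec v) = F' (of_vec v)"
      by (rule AE_distrD[rotated]) measurable
    have "(\<integral>\<^sup>+x. F x \<partial>lebesgue) = (\<integral>\<^sup>+x. F' x \<partial>lborel)"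
      unfolding nn_integral_completion by (rule nn_integral_cong_AE[OF ae])
    also have "\<dots> = (\<integral>\<^sup>+v. F' (of_vec v) \<partial>lborel)"
      using F' by (intro nn_integral_of_vec) simp
    also have "\<dots> = (\<integral>\<^sup>+v. F (of_vec v) \<partial>lebesgue)"
      unfolding nn_integral_completion using ae' by (intro nn_integral_cong_AE) auto
    finally show ?thesis .
  qed
  have fin': "integrable lborel (\<lambda>v. f (of_vec v))"
  proof (rule integrableI_nonneg)
    have "(\<integral>\<^sup>+v. f (of_vec v) \<partial>lborel) = (\<integral>\<^sup>+x. f x \<partial>lborel)"
      by (rule nn_integral_of_vec[symmetric]) simp
    then show "(\<integral>\<^sup>+v. ennreal (f (of_vec v)) \<partial>lborel) < \<infinity>" using fin by simp
  qed (use f0 in auto)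
  have abs1: "(\<lambda>v. f (of_vec v)) absolutely_integrable_on (gv ` Sv)"
    unfolding set_integrable_def using fin' gvS
    by (intro integrable_mult_indicator) (simp_all add: integrable_completion)
  then have "fv absolutely_integrable_on (gv ` Sv)" unfolding absolutely_integrable_on_1_iff by (simp add: fv_def)
  then have cov: "(\<lambda>x. \<bar>det (matrix (gv' x))\<bar> *\<^sub>R fv (gv x)) absolutely_integrable_on Sv \<and>
      integral Sv (\<lambda>x. \<bar>det (matrix (gv' x))\<bar> *\<^sub>R fv (gv x)) = integral (gv ` Sv) fv"
    using has_absolute_integral_change_of_variables[OF _ derv injv, of fv "integral (gv ` Sv) fv"] by auto
  have abs2: "(\<lambda>v. jac (g' (of_vec v)) * f (of_vec (gv v))) absolutely_integrable_on Sv"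
    using cov unfolding absolutely_integrable_on_1_iff by (simp add: fv_def detv)
  have int: "integral Sv (\<lambda>v. jac (g' (of_vec v)) * f (of_vec (gv v))) = integral (gv ` Sv) (\<lambda>v. f (of_vec v))"
    using cov[THEN conjunct2] unfolding integral_on_1_eq by (simp add: fv_def detv vec_eq_iff)
  have nn: "(\<integral>\<^sup>+v. ennreal (h v) * indicator A v \<partial>lebesgue) = ennreal (integral A h)"
    if "h absolutely_integrable_on A" "\<And>v. 0 \<le> h v" for h :: "real ^ 'a basis_index \<Rightarrow> real" and A
  proof -
    have "(\<integral>\<^sup>+v. ennreal (h v) * indicator A v \<partial>lebesgue) = (\<integral>\<^sup>+v. ennreal (indicator A v *\<^sub>R h v) \<partial>lebesgue)"
      by (intro nn_integral_cong) (auto simp: indicator_def)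
    also have "\<dots> = ennreal (LINT v:A|lebesgue. h v)"
      unfolding set_lebesgue_integral_def using that
      by (intro nn_integral_eq_integral) (auto simp: set_integrable_def)
    also have "(LINT v:A|lebesgue. h v) = integral A h"
      by (rule set_lebesgue_integral_eq_integral(2)[OF that(1)])
    finally show ?thesis .
  qed
  have "(\<integral>\<^sup>+x. ennreal (f x) * indicator (g ` S) x \<partial>lebesgue)
    = (\<integral>\<^sup>+v. ennreal (f (of_vec v)) * indicator (g ` S) (of_vec v) \<partial>lebesgue)"
  proof (rule transfer)
    have "(\<lambda>x. ennreal (f x)) \<in> borel_measurable lebesgue" by (rule measurable_completion) simp
    moreover have "(indicator (g ` S) :: 'a \<Rightarrow> ennreal) \<in> borel_measurable lebesgue"
      by (rule borel_measurable_indicator[OF gS])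
    ultimately show "(\<lambda>x. ennreal (f x) * indicator (g ` S) x) \<in> borel_measurable lebesgue"
      by (rule borel_measurable_times_ennreal)
  qed
  also have "\<dots> = (\<integral>\<^sup>+v. ennreal (f (of_vec v)) * indicator (gv ` Sv) v \<partial>lebesgue)"
  proof -
    have "of_vec v \<in> g ` S \<longleftrightarrow> v \<in> gv ` Sv" for v
    proof -
      have "gv ` Sv = to_vec ` g ` S" unfolding gv_def by (simp only: image_comp[symmetric] oS)
      moreover have "v \<in> to_vec ` X \<longleftrightarrow> of_vec v \<in> X" for X
        using to_vec_of_vec[of v] by (metis image_eqI image_iff of_vec_to_vec)
      ultimately show ?thesis by simp
    qed
    then show ?thesis by (simp add: indicator_def)
  qed
  also have "\<dots> = (\<integral>\<^sup>+v. ennreal (jac (g' (of_vec v)) * f (of_vec (gv v))) * indicator Sv v \<partial>lebesgue)"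
    using nn[OF abs1 f0] nn[OF abs2 mult_nonneg_nonneg[OF jac_nonneg f0]] int by simp
  also have "\<dots> = (\<integral>\<^sup>+v. ennreal (jac (g' (of_vec v))) * ennreal (f (g (of_vec v))) * indicator S (of_vec v) \<partial>lebesgue)"
    by (intro nn_integral_cong) (auto simp: gv_def Sv_def ennreal_mult f0 jac_nonneg indicator_def)
  also have "\<dots> = (\<integral>\<^sup>+x. ennreal (jac (g' x)) * ennreal (f (g x)) * indicator S x \<partial>lebesgue)"
  proof (rule transfer[symmetric], rule measurable_completion)
    have [measurable]: "S \<in> sets borel" by (rule S)
    show "(\<lambda>x. ennreal (jac (g' x)) * ennreal (f (g x)) * indicator S x) \<in> borel_measurable lborel"
      by measurable
  qed
  finally show "(\<integral>\<^sup>+x. ennreal (f x) * indicator (g ` S) x \<partial>lebesgue)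
      = (\<integral>\<^sup>+x. ennreal (jac (g' x)) * ennreal (f (g x)) * indicator S x \<partial>lborel)"
    unfolding nn_integral_completion .
qed

section \<open>Integration along coordinate directions\<close>

lemma nn_integral_lborel_split:
  fixes f :: "'a::euclidean_space \<Rightarrow> ennreal"
  assumes B: "B \<subseteq> Basis" and [measurable]: "f \<in> borel_measurable borel"
  shows "(\<integral>\<^sup>+x. f x \<partial>lborel) = (\<integral>\<^sup>+y. (\<integral>\<^sup>+h. f ((\<Sum>b\<in>Basis - B. y b *\<^sub>R b) + (\<Sum>b\<in>B. h b *\<^sub>R b))
     \<partial>Pi\<^sub>M B (\<lambda>_. lborel)) \<partial>Pi\<^sub>M (Basis - B) (\<lambda>_. lborel))"
proof -
  interpret product_sigma_finite "\<lambda>_::'a. lborel :: real measure" ..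
  have fin: "finite B" using B by (rule finite_subset) simp
  have un: "(Basis - B) \<union> B = Basis" using B by auto
  have "(\<integral>\<^sup>+x. f x \<partial>lborel) = (\<integral>\<^sup>+y. f (\<Sum>b\<in>Basis. y b *\<^sub>R b) \<partial>Pi\<^sub>M Basis (\<lambda>_. lborel))"
    by (subst lborel_eq, subst nn_integral_distr) auto
  also have "\<dots> = (\<integral>\<^sup>+y. (\<integral>\<^sup>+h. f (\<Sum>b\<in>Basis. merge (Basis - B) B (y, h) b *\<^sub>R b) \<partial>Pi\<^sub>M B (\<lambda>_. lborel)) \<partial>Pi\<^sub>M (Basis - B) (\<lambda>_. lborel))"
    using product_nn_integral_fold[of "Basis - B" B "\<lambda>y. f (\<Sum>b\<in>Basis. y b *\<^sub>R b)"] fin unfolding un by auto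
  also have "\<dots> = (\<integral>\<^sup>+y. (\<integral>\<^sup>+h. f ((\<Sum>b\<in>Basis - B. y b *\<^sub>R b) + (\<Sum>b\<in>B. h b *\<^sub>R b))
     \<partial>Pi\<^sub>M B (\<lambda>_. lborel)) \<partial>Pi\<^sub>M (Basis - B) (\<lambda>_. lborel))"
  proof (intro nn_integral_cong arg_cong[where f=f])
    fix y h
    have "(\<Sum>b\<in>Basis. merge (Basis - B) B (y, h) b *\<^sub>R b)
      = (\<Sum>b\<in>Basis - B. merge (Basis - B) B (y, h) b *\<^sub>R b) + (\<Sum>b\<in>B. merge (Basis - B) B (y, h) b *\<^sub>R b)"
      by (rule sum.subset_diff[OF B finite_Basis])
    also have "(\<Sum>b\<in>Basis - B. merge (Basis - B) B (y, h) b *\<^sub>R b) = (\<Sum>b\<in>Basis - B. y b *\<^sub>R b)"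
      by (intro sum.cong) (auto simp: merge_def)
    also have "(\<Sum>b\<in>B. merge (Basis - B) B (y, h) b *\<^sub>R b) = (\<Sum>b\<in>B. h b *\<^sub>R b)"
      by (intro sum.cong) (auto simp: merge_def)
    finally show "(\<Sum>b\<in>Basis. merge (Basis - B) B (y, h) b *\<^sub>R b)
      = (\<Sum>b\<in>Basis - B. y b *\<^sub>R b) + (\<Sum>b\<in>B. h b *\<^sub>R b)" .
  qed
  finally show ?thesis .
qed

text \<open>Tonelli along \<open>b\<close>: every line in this direction meets \<open>C\<close> in a
  countable set, which has length 0.\<close>

lemma negligible_line_slices:
  fixes C :: "'a::euclidean_space set"
  assumes C: "C \<in> sets borel" and b: "b \<in> Basis"
    and slice: "\<And>x. countable {s. x + s *\<^sub>R b \<in> C}"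
  shows "negligible C"
proof -
  interpret product_sigma_finite "\<lambda>_::'a. lborel :: real measure" ..
  have "emeasure lborel C = (\<integral>\<^sup>+x. indicator C x \<partial>lborel)" using C by simp
  also have "\<dots> = (\<integral>\<^sup>+y. (\<integral>\<^sup>+h. indicator C ((\<Sum>b\<in>Basis - {b}. y b *\<^sub>R b) + (\<Sum>b\<in>{b}. h b *\<^sub>R b))
     \<partial>Pi\<^sub>M {b} (\<lambda>_. lborel)) \<partial>Pi\<^sub>M (Basis - {b}) (\<lambda>_. lborel))"
    using b C by (intro nn_integral_lborel_split) auto
  also have "\<dots> = (\<integral>\<^sup>+y. 0 \<partial>Pi\<^sub>M (Basis - {b}) (\<lambda>_. lborel :: real measure))"
  proof (intro nn_integral_cong)
    fix y :: "'a \<Rightarrow> real"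
    let ?x = "\<Sum>b\<in>Basis - {b}. y b *\<^sub>R b"
    have m[measurable]: "(\<lambda>s. indicator C (?x + s *\<^sub>R b) :: ennreal) \<in> borel_measurable borel"
      using C by measurable
    have "(\<integral>\<^sup>+h. indicator C (?x + (\<Sum>b\<in>{b}. h b *\<^sub>R b)) \<partial>Pi\<^sub>M {b} (\<lambda>_. lborel))
      = (\<integral>\<^sup>+s. indicator C (?x + s *\<^sub>R b) \<partial>lborel)"
      using product_nn_integral_singleton[of "\<lambda>s. indicator C (?x + s *\<^sub>R b)" b] by simp
    also have "\<dots> = (\<integral>\<^sup>+s. indicator {s. ?x + s *\<^sub>R b \<in> C} s \<partial>lborel)"
      by (intro nn_integral_cong) (simp add: indicator_def)
    also have "\<dots> = 0"
      using countable_imp_null_set_lborel[OF slice[of ?x]]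
      by (subst nn_integral_indicator) (auto simp: null_sets_def)
    finally show "(\<integral>\<^sup>+h. indicator C (?x + (\<Sum>b\<in>{b}. h b *\<^sub>R b)) \<partial>Pi\<^sub>M {b} (\<lambda>_. lborel)) = 0" .
  qed
  finally have "emeasure lborel C = 0" by simp
  then show ?thesis using C by (simp add: negligible_iff_null_sets null_sets_def)
qed

section \<open>The Prekopa-Leindler inequality and even log-concave weights\<close>

text \<open>Tonelli on the region below the graph; as \<open>f\<close> is at most 1, only levels
  between 0 and 1 contribute.\<close>

lemma nn_integral_layer_cake:
  fixes f :: "'a \<Rightarrow> ennreal"
  assumes "sigma_finite_measure M" and [measurable]: "f \<in> borel_measurable M"
    and le1: "\<And>x. x \<in> space M \<Longrightarrow> f x \<le> 1"
  shows "(\<integral>\<^sup>+x. f x \<partial>M) = (\<integral>\<^sup>+s. emeasure M {x\<in>space M. ennreal s < f x} * indicator {0<..<1::real} s \<partial>lborel)"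
proof -
  interpret sigma_finite_measure M by fact
  interpret pair_sigma_finite M "lborel :: real measure" ..
  have one: "f x = (\<integral>\<^sup>+s. indicator {s. ennreal s < f x} s * indicator {0<..<1::real} s \<partial>lborel)"
    if "x \<in> space M" for x
  proof -
    have l: "f x \<le> 1" by (rule le1[OF that])
    obtain r where r: "f x = ennreal r" "0 \<le> r" "r \<le> 1"
    proof -
      have "f x \<noteq> top" using l by (auto simp: top_unique)
      then have "f x = ennreal (enn2real (f x))" by (simp add: less_top)
      moreover have "enn2real (f x) \<le> 1" using enn2real_mono[OF l] by simp
      ultimately show thesis using that[of "enn2real (f x)"] by simp
    qed
    have "(\<integral>\<^sup>+s. indicator {s. ennreal s < f x} s * indicator {0<..<1::real} s \<partial>lborel)
        = (\<integral>\<^sup>+s. indicator {0<..<r} s \<partial>lborel)"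
      using r by (intro nn_integral_cong) (auto simp: indicator_def ennreal_less_iff)
    also have "\<dots> = ennreal r" using r by simp
    finally show ?thesis using r by simp
  qed
  have "(\<integral>\<^sup>+x. f x \<partial>M) = (\<integral>\<^sup>+x. (\<integral>\<^sup>+s. indicator {s. ennreal s < f x} s * indicator {0<..<1::real} s \<partial>lborel) \<partial>M)"
    using one by (intro nn_integral_cong) auto
  also have "\<dots> = (\<integral>\<^sup>+s. (\<integral>\<^sup>+x. indicator {s. ennreal s < f x} s * indicator {0<..<1::real} s \<partial>M) \<partial>lborel)"
    by (rule Fubini'[symmetric]) (simp add: indicator_def)
  also have "\<dots> = (\<integral>\<^sup>+s. emeasure M {x\<in>space M. ennreal s < f x} * indicator {0<..<1::real} s \<partial>lborel)"
  proof (intro nn_integral_cong)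
    fix s :: real
    have "(\<integral>\<^sup>+x. indicator {s. ennreal s < f x} s * indicator {0<..<1::real} s \<partial>M)
      = (\<integral>\<^sup>+x. indicator {x\<in>space M. ennreal s < f x} x * indicator {0<..<1::real} s \<partial>M)"
      by (intro nn_integral_cong) (auto simp: indicator_def)
    also have "\<dots> = emeasure M {x\<in>space M. ennreal s < f x} * indicator {0<..<1::real} s"
      by (subst nn_integral_multc) auto
    finally show "(\<integral>\<^sup>+x. indicator {s. ennreal s < f x} s * indicator {0<..<1::real} s \<partial>M)
      = emeasure M {x\<in>space M. ennreal s < f x} * indicator {0<..<1::real} s" .
  qed
  finally show ?thesis .
qed

section \<open>The Brunn-Minkowski inequality on the line\<close>

lemma emeasure_Sup_atMost:
  fixes A :: "real set"
  assumes A[measurable]: "A \<in> sets borel" and ne: "A \<noteq> {}"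
  shows "emeasure lborel A \<le> (SUP a\<in>A. emeasure lborel (A \<inter> {..a}))"
proof (cases "\<exists>m\<in>A. \<forall>a\<in>A. a \<le> m")
  case True
  then obtain m where m: "m \<in> A" "\<forall>a\<in>A. a \<le> m" by blast
  then have "A \<inter> {..m} = A" by auto
  then show ?thesis using m(1) by (metis SUP_upper)
next
  case False
  \<comment> \<open>Without a largest element, the open rays below points of \<open>A\<close> cover
    \<open>A\<close>. Lindelof extracts countably many of them, and the running maxima
    \<open>c\<close> of their endpoints increase inside \<open>A\<close> past every point of
    \<open>A\<close>.\<close>
  define F where "F = (\<lambda>a. {..<a}) ` A"
  have cover: "A \<subseteq> \<Union>F" using False unfolding F_def by (force simp: not_le)
  have "\<And>S. S \<in> F \<Longrightarrow> open S" unfolding F_def by auto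
  then obtain F' where F': "F' \<subseteq> F" "countable F'" "\<Union>F' = \<Union>F" by (rule Lindelof)
  then obtain B where B: "B \<subseteq> A" "countable B" "F' = (\<lambda>a. {..<a}) ` B"
    unfolding F_def by (metis countable_subset_image)
  have Bne: "B \<noteq> {}" using cover ne unfolding F'(3)[symmetric] B(3) by auto
  define b where "b = from_nat_into B"
  have b: "range b = B" unfolding b_def by (simp add: Bne B(2) range_from_nat_into)
  define c where "c n = Max (b ` {..n})" for n
  have cA: "c n \<in> A" for n
  proof -
    have "c n \<in> b ` {..n}" unfolding c_def by (rule Max_in) auto
    then show ?thesis using b B(1) by auto
  qed
  have mono: "mono c" unfolding c_def by (intro monoI Max_mono) auto
  have "A = (\<Union>n. A \<inter> {..c n})"
  proof (intro equalityI subsetI)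
    fix a assume a: "a \<in> A"
    then have "a \<in> \<Union>F'" using cover F'(3) by blast
    then obtain u where "u \<in> B" "a < u" unfolding B(3) by blast
    then obtain n where "a < b n" using b by auto
    moreover have "b n \<le> c n" unfolding c_def by (rule Max_ge) auto
    ultimately show "a \<in> (\<Union>n. A \<inter> {..c n})" using a by (auto intro!: exI[of _ n])
  qed auto
  then have "emeasure lborel A = emeasure lborel (\<Union>n. A \<inter> {..c n})" by simp
  also have "\<dots> = (SUP n. emeasure lborel (A \<inter> {..c n}))"
    using mono by (intro SUP_emeasure_incseq[symmetric]) (auto simp: incseq_def mono_def intro: order_trans)
  also have "\<dots> \<le> (SUP a\<in>A. emeasure lborel (A \<inter> {..a}))"
    using cA by (intro SUP_least SUP_upper)
  finally show ?thesis .
qed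

lemma emeasure_lborel_uminus:
  fixes A :: "real set"
  assumes [measurable]: "A \<in> sets borel"
  shows "emeasure lborel (uminus -` A) = emeasure lborel A"
  by (subst (2) lborel_distr_uminus[symmetric], subst emeasure_distr) auto

lemma emeasure_Sup_atLeast:
  fixes A :: "real set"
  assumes A[measurable]: "A \<in> sets borel" and ne: "A \<noteq> {}"
  shows "emeasure lborel A \<le> (SUP a\<in>A. emeasure lborel (A \<inter> {a..}))"
proof -
  have m: "uminus -` A \<in> sets borel" using measurable_sets[OF borel_measurable_uminus[OF measurable_ident] A] by auto
  have ne': "uminus -` A \<noteq> {}" using ne by (metis all_not_in_conv minus_minus vimage_eq)
  have e: "emeasure lborel ((uminus -` A) \<inter> {..a}) = emeasure lborel (A \<inter> {-a..})" for a
  proof -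
    have "(uminus -` A) \<inter> {..a} = uminus -` (A \<inter> {-a..})" by auto
    then show ?thesis using emeasure_lborel_uminus[of "A \<inter> {-a..}"] by simp
  qed
  have "emeasure lborel A = emeasure lborel (uminus -` A)" by (simp add: emeasure_lborel_uminus)
  also have "\<dots> \<le> (SUP a\<in>uminus -` A. emeasure lborel ((uminus -` A) \<inter> {..a}))"
    using ne' m by (intro emeasure_Sup_atMost) auto
  also have "\<dots> \<le> (SUP a\<in>A. emeasure lborel (A \<inter> {a..}))"
    unfolding e by (intro SUP_least) (auto intro: SUP_upper)
  finally show ?thesis .
qed

lemma emeasure_half_translate:
  fixes A :: "real set"
  assumes [measurable]: "A \<in> sets borel"
  shows "2 * emeasure lborel ((\<lambda>c. 2 * c - t) -` A) = emeasure lborel A"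
proof -
  have "emeasure lborel A = (\<integral>\<^sup>+x. indicator A x \<partial>lborel)" by simp
  also have "\<dots> = ennreal \<bar>2\<bar> * (\<integral>\<^sup>+x. indicator A (-t + 2 * x) \<partial>lborel)"
    by (rule nn_integral_real_affine) auto
  also have "(\<integral>\<^sup>+x. indicator A (-t + 2 * x) \<partial>lborel) = (\<integral>\<^sup>+x. indicator ((\<lambda>c. 2 * c - t) -` A) x \<partial>lborel)"
    by (intro nn_integral_cong) (auto simp: indicator_def)
  also have "\<dots> = emeasure lborel ((\<lambda>c. 2 * c - t) -` A)"
  proof (rule nn_integral_indicator)
    have "(\<lambda>c. 2 * c - t) \<in> borel_measurable borel" by simp
    from measurable_sets[OF this assms] show "(\<lambda>c. 2 * c - t) -` A \<in> sets lborel" by simp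
  qed
  finally show ?thesis by simp
qed

text \<open>Cut \<open>A\<close> above at one of its points \<open>a\<close> and \<open>B\<close>
  below at one of its points \<open>b\<close>. The half-size copies (A + b)/2 and (B + a)/2 lie in
  \<open>C\<close> and meet at most in (a + b)/2, so their lengths add up inside \<open>C\<close>.
  Suprema over \<open>a\<close> and \<open>b\<close> remove the cuts, for unbounded sets
  too.\<close>

lemma Brunn_Minkowski_1:
  fixes A B C :: "real set"
  assumes A[measurable]: "A \<in> sets borel" and B[measurable]: "B \<in> sets borel" and C[measurable]: "C \<in> sets borel"
    and "A \<noteq> {}" "B \<noteq> {}" and mid: "\<And>a b. a \<in> A \<Longrightarrow> b \<in> B \<Longrightarrow> (a + b) / 2 \<in> C"
  shows "emeasure lborel A + emeasure lborel B \<le> 2 * emeasure lborel C"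
proof -
  have key: "emeasure lborel (A \<inter> {..a}) + emeasure lborel (B \<inter> {b..}) \<le> 2 * emeasure lborel C"
    if ab: "a \<in> A" "b \<in> B" for a b
  proof -
    define A1 where "A1 = (\<lambda>c. 2 * c - b) -` (A \<inter> {..a})"
    define B1 where "B1 = (\<lambda>c. 2 * c - a) -` (B \<inter> {b..})"
    \<comment> \<open>Removing the common endpoint makes the two copies disjoint and costs no
      length.\<close>
    define B2 where "B2 = B1 - {(a + b)/2}"
    have mA: "A1 \<in> sets borel"
      unfolding A1_def using measurable_sets[of "\<lambda>c::real. 2 * c - b" borel borel "A \<inter> {..a}"] by auto
    have mB: "B1 \<in> sets borel"
      unfolding B1_def using measurable_sets[of "\<lambda>c::real. 2 * c - a" borel borel "B \<inter> {b..}"] by auto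
    have mB2: "B2 \<in> sets borel" unfolding B2_def using mB by auto
    have "emeasure lborel B1 \<le> emeasure lborel (B2 \<union> {(a+b)/2})"
      unfolding B2_def using mB by (intro emeasure_mono) auto
    also have "\<dots> \<le> emeasure lborel B2 + emeasure lborel {(a+b)/2}"
      using mB2 by (intro emeasure_subadditive) auto
    finally have B12: "emeasure lborel B1 \<le> emeasure lborel B2" by simp
    have sub: "A1 \<union> B2 \<subseteq> C"
    proof
      fix c assume "c \<in> A1 \<union> B2"
      then consider "2 * c - b \<in> A" | "2 * c - a \<in> B" unfolding A1_def B2_def B1_def by auto
      then show "c \<in> C"
      proof cases
        case 1 then show ?thesis using mid[OF 1 ab(2)] by simp
      next
        case 2 then show ?thesis using mid[OF ab(1) 2] by simp
      qed
    qed
    have disj: "A1 \<inter> B2 = {}" unfolding A1_def B2_def B1_def by (auto simp: field_simps)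
    have "emeasure lborel (A \<inter> {..a}) + emeasure lborel (B \<inter> {b..})
      = 2 * emeasure lborel A1 + 2 * emeasure lborel B1"
      unfolding A1_def B1_def by (subst (1 2) emeasure_half_translate) auto
    also have "\<dots> \<le> 2 * emeasure lborel A1 + 2 * emeasure lborel B2"
      using B12 by (intro add_left_mono mult_left_mono) auto
    also have "\<dots> = 2 * emeasure lborel (A1 \<union> B2)"
      using mA mB2 disj by (subst plus_emeasure[symmetric]) (auto simp: distrib_left)
    also have "\<dots> \<le> 2 * emeasure lborel C"
      using sub mA mB2 by (intro mult_left_mono emeasure_mono) auto
    finally show ?thesis .
  qed
  have "emeasure lborel A + emeasure lborel B \<le>
    (SUP a\<in>A. emeasure lborel (A \<inter> {..a})) + (SUP b\<in>B. emeasure lborel (B \<inter> {b..}))"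
    using assms by (intro add_mono emeasure_Sup_atMost emeasure_Sup_atLeast)
  also have "\<dots> \<le> 2 * emeasure lborel C"
  proof -
    have "(SUP a\<in>A. emeasure lborel (A \<inter> {..a})) + emeasure lborel (B \<inter> {b..}) \<le> 2 * emeasure lborel C"
      if "b \<in> B" for b
      using key that \<open>A \<noteq> {}\<close> by (subst ennreal_SUP_add_left[symmetric]) (auto intro: SUP_least)
    then show ?thesis
      using \<open>B \<noteq> {}\<close>
      by (subst add.commute, subst ennreal_SUP_add_left[symmetric]) (auto intro!: SUP_least simp: add.commute)
  qed
  finally show ?thesis .
qed


section \<open>The Prekopa-Leindler inequality\<close>

lemma ennreal_amgm:
  fixes a b c :: ennreal
  assumes "a + b \<le> 2 * c"
  shows "a * b \<le> c\<^sup>2"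
proof (cases "c = top")
  case True then show ?thesis by (simp add: power2_eq_square ennreal_mult_eq_top_iff)
next
  case False
  then have "2 * c < top" by (simp add: ennreal_mult_less_top less_top)
  then have "a + b < top" using assms by (rule le_less_trans[rotated])
  then obtain x y where xy: "a = ennreal x" "b = ennreal y" "0 \<le> x" "0 \<le> y"
    by (metis add_strict_increasing ennreal_add_eq_top ennreal_cases less_top)
  obtain z where z: "c = ennreal z" "0 \<le> z" using False by (cases c) auto
  have "ennreal (x + y) \<le> ennreal (2 * z)"
    using assms xy z by (simp add: ennreal_mult ennreal_plus)
  then have "x + y \<le> 2 * z" using z by (simp add: ennreal_le_iff)
  then have "(x + y)\<^sup>2 \<le> (2 * z)\<^sup>2" using xy by (intro power_mono) auto
  moreover have "4 * (x * y) \<le> (x + y)\<^sup>2"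
    using zero_le_power2[of "x - y"] by (simp add: power2_eq_square algebra_simps)
  ultimately have "x * y \<le> z\<^sup>2" by (simp add: power2_eq_square)
  then show ?thesis unfolding xy z using xy z
    by (simp add: ennreal_mult[symmetric] ennreal_power)
qed

text \<open>At a level s strictly between 0 and 1 both superlevel sets are nonempty, and midpoints
  between them lie where \<open>h\<close> exceeds s. Brunn-Minkowski at each level and the layer
  cake formula give the sum. Normalising both suprema to 1 keeps the two sets nonempty at the same
  levels.\<close>

lemma Prekopa_Leindler_normalized:
  fixes f g h :: "real \<Rightarrow> ennreal"
  assumes [measurable]: "f \<in> borel_measurable borel" "g \<in> borel_measurable borel" "h \<in> borel_measurable borel"
    and fgh: "\<And>x y. f x * g y \<le> (h ((x + y) / 2))\<^sup>2"
    and f1: "\<And>x. f x \<le> 1" and g1: "\<And>x. g x \<le> 1"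
    and f_near: "\<And>s. s < 1 \<Longrightarrow> \<exists>x. ennreal s < f x" and g_near: "\<And>s. s < 1 \<Longrightarrow> \<exists>x. ennreal s < g x"
  shows "(\<integral>\<^sup>+x. f x \<partial>lborel) + (\<integral>\<^sup>+x. g x \<partial>lborel) \<le> 2 * (\<integral>\<^sup>+x. h x \<partial>lborel)"
proof -
  have sf: "sigma_finite_measure (lborel :: real measure)" by (rule lborel.sigma_finite_measure_axioms)
  \<comment> \<open>Only levels below 1 are compared, so \<open>h\<close> may be capped at 1, which
    fits the layer cake formula and does not enlarge the integral.\<close>
  define k where "k x = min (h x) 1" for x
  have [measurable]: "k \<in> borel_measurable borel" unfolding k_def by measurable
  let ?I = "indicator {0<..<1::real} :: real \<Rightarrow> ennreal"
  have lev: "emeasure lborel {x. ennreal s < f x} * ?I s + emeasure lborel {x. ennreal s < g x} * ?I s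
    \<le> 2 * (emeasure lborel {x. ennreal s < k x} * ?I s)" for s
  proof (cases "0 < s \<and> s < 1")
    case True
    have "emeasure lborel {x. ennreal s < f x} + emeasure lborel {x. ennreal s < g x} \<le> 2 * emeasure lborel {x. ennreal s < k x}"
    proof (rule Brunn_Minkowski_1)
      fix a b assume "a \<in> {x. ennreal s < f x}" "b \<in> {x. ennreal s < g x}"
      then have *: "ennreal s < f a" "ennreal s < g b" by auto
      have "ennreal s * ennreal s < f a * ennreal s"
        using * True by (intro ennreal_mult_strict_right_mono) auto
      also have "\<dots> \<le> f a * g b" using * by (intro mult_left_mono) auto
      also have "\<dots> \<le> (h ((a + b)/2))\<^sup>2" by (rule fgh)
      finally have *: "ennreal s * ennreal s < (h ((a + b)/2))\<^sup>2" .
      have "ennreal s < h ((a + b)/2)"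
      proof (rule ccontr)
        assume "\<not> ennreal s < h ((a + b)/2)"
        then have "h ((a + b)/2) * h ((a + b)/2) \<le> ennreal s * ennreal s"
          by (intro mult_mono) auto
        with * show False by (simp add: power2_eq_square)
      qed
      moreover have "ennreal s < 1" using True by (simp add: ennreal_less_one_iff)
      ultimately show "(a + b) / 2 \<in> {x. ennreal s < k x}" by (simp add: k_def)
    qed (use True f_near g_near in auto)
    then show ?thesis using True by simp
  qed auto
  have "(\<integral>\<^sup>+x. f x \<partial>lborel) + (\<integral>\<^sup>+x. g x \<partial>lborel)
    = (\<integral>\<^sup>+s. emeasure lborel {x. ennreal s < f x} * ?I s \<partial>lborel) + (\<integral>\<^sup>+s. emeasure lborel {x. ennreal s < g x} * ?I s \<partial>lborel)"
    using nn_integral_layer_cake[OF sf, of f] nn_integral_layer_cake[OF sf, of g] f1 g1 by simp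
  also have "\<dots> = (\<integral>\<^sup>+s. emeasure lborel {x. ennreal s < f x} * ?I s + emeasure lborel {x. ennreal s < g x} * ?I s \<partial>lborel)"
    by (rule nn_integral_add[symmetric]) measurable
  also have "\<dots> \<le> (\<integral>\<^sup>+s. 2 * (emeasure lborel {x. ennreal s < k x} * ?I s) \<partial>lborel)"
    by (intro nn_integral_mono lev)
  also have "\<dots> = 2 * (\<integral>\<^sup>+s. emeasure lborel {x. ennreal s < k x} * ?I s \<partial>lborel)"
    by (rule nn_integral_cmult) measurable
  also have "\<dots> = 2 * (\<integral>\<^sup>+x. k x \<partial>lborel)"
    using nn_integral_layer_cake[OF sf, of k] by (simp add: k_def)
  also have "\<dots> \<le> 2 * (\<integral>\<^sup>+x. h x \<partial>lborel)"
    by (intro mult_left_mono nn_integral_mono) (auto simp: k_def)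
  finally show ?thesis .
qed

text \<open>Dividing \<open>f\<close> and \<open>g\<close> by their suprema \<open>p\<close> and
  \<open>q\<close>, and \<open>h\<close> by \<open>sqrt (p * q)\<close>, preserves the hypothesis
  and reaches the normalised case. The arithmetic-geometric mean turns the bound on the sum into one
  on the product, where the factors cancel.\<close>

lemma Prekopa_Leindler_bounded:
  fixes f g h :: "real \<Rightarrow> ennreal"
  assumes [measurable]: "f \<in> borel_measurable borel" "g \<in> borel_measurable borel" "h \<in> borel_measurable borel"
    and fgh: "\<And>x y. f x * g y \<le> (h ((x + y) / 2))\<^sup>2"
    and fb: "\<And>x. f x \<le> ennreal b" and gb: "\<And>x. g x \<le> ennreal b"
  shows "(\<integral>\<^sup>+x. f x \<partial>lborel) * (\<integral>\<^sup>+x. g x \<partial>lborel) \<le> (\<integral>\<^sup>+x. h x \<partial>lborel)\<^sup>2"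
proof (cases "(\<forall>x. f x = 0) \<or> (\<forall>x. g x = 0)")
  case True then show ?thesis by auto
next
  case False
  have sup: "\<exists>p>0. (SUP x. u x) = ennreal p" if u: "\<And>x. u x \<le> ennreal b" and nz: "\<not> (\<forall>x. u x = 0)"
    for u :: "real \<Rightarrow> ennreal"
  proof -
    have le: "(SUP x. u x) \<le> ennreal b" using u by (intro SUP_least)
    have nt: "(SUP x. u x) \<noteq> top"
    proof
      assume "(SUP x. u x) = top"
      with le have "top \<le> ennreal b" by simp
      then show False by (simp add: top_unique)
    qed
    then obtain p where p: "(SUP x. u x) = ennreal p" "0 \<le> p" by (cases "SUP x. u x") auto
    obtain x where "u x \<noteq> 0" using nz by auto
    moreover have "u x \<le> ennreal p" unfolding p(1)[symmetric] by (rule SUP_upper) simp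
    ultimately have "p \<noteq> 0" by auto
    then show ?thesis using p by (auto intro!: exI[of _ p])
  qed
  obtain p where p: "p > 0" "(SUP x. f x) = ennreal p" using sup[of f] fb False by blast
  obtain q where q: "q > 0" "(SUP x. g x) = ennreal q" using sup[of g] gb False by blast
  define r where "r = sqrt (p * q)"
  have r: "r > 0" "r * r = p * q" unfolding r_def using p q by auto
  have le1: "u x * ennreal (1/p) \<le> 1" if "p > 0" "(SUP x. u x) = ennreal p" for u :: "real \<Rightarrow> ennreal" and p x
  proof -
    have "u x \<le> ennreal p" unfolding that(2)[symmetric] by (rule SUP_upper) simp
    then have "u x * ennreal (1/p) \<le> ennreal p * ennreal (1/p)" by (intro mult_right_mono) auto
    also have "\<dots> = 1" using that(1) by (simp add: ennreal_mult[symmetric])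
    finally show ?thesis .
  qed
  have near: "\<exists>x. ennreal s < u x * ennreal (1/p)" if "p > 0" "(SUP x. u x) = ennreal p" "s < 1"
    for u :: "real \<Rightarrow> ennreal" and p s
  proof -
    have "ennreal (s * p) < (SUP x. u x)"
      unfolding that(2) using that(1,3) by (intro ennreal_lessI) auto
    then obtain x where x: "ennreal (s * p) < u x" unfolding less_SUP_iff by auto
    have "ennreal s < u x * ennreal (1/p)"
    proof (rule ccontr)
      assume "\<not> ennreal s < u x * ennreal (1/p)"
      then have "u x * ennreal (1/p) * ennreal p \<le> ennreal s * ennreal p" by (intro mult_right_mono) auto
      moreover have "ennreal (1/p) * ennreal p = 1" using that(1) by (simp add: ennreal_mult[symmetric])
      moreover have "ennreal s * ennreal p = ennreal (s * p)"
        using that(1) by (cases "s \<ge> 0") (auto simp: ennreal_mult ennreal_neg mult_nonpos_nonneg)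
      ultimately show False using x by (simp add: mult.assoc)
    qed
    then show ?thesis by blast
  qed
  have rr: "ennreal (1/p) * ennreal (1/q) = (ennreal (1/r))\<^sup>2"
    using p q r by (simp add: ennreal_mult[symmetric] power2_eq_square)
  have "(\<integral>\<^sup>+x. f x * ennreal (1/p) \<partial>lborel) + (\<integral>\<^sup>+x. g x * ennreal (1/q) \<partial>lborel)
     \<le> 2 * (\<integral>\<^sup>+x. h x * ennreal (1/r) \<partial>lborel)"
  proof (rule Prekopa_Leindler_normalized)
    fix x y
    have "f x * ennreal (1 / p) * (g y * ennreal (1 / q)) = f x * g y * (ennreal (1/p) * ennreal (1/q))"
      by (simp add: ac_simps)
    also have "\<dots> \<le> (h ((x + y) / 2))\<^sup>2 * (ennreal (1/p) * ennreal (1/q))"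
      by (intro mult_right_mono fgh) auto
    also have "\<dots> = (h ((x + y) / 2) * ennreal (1 / r))\<^sup>2" unfolding rr by (simp add: power_mult_distrib)
    finally show "f x * ennreal (1 / p) * (g y * ennreal (1 / q)) \<le> (h ((x + y) / 2) * ennreal (1 / r))\<^sup>2" .
  qed (use le1 near p q in auto)
  then have "(\<integral>\<^sup>+x. f x \<partial>lborel) * ennreal (1/p) + (\<integral>\<^sup>+x. g x \<partial>lborel) * ennreal (1/q)
     \<le> 2 * ((\<integral>\<^sup>+x. h x \<partial>lborel) * ennreal (1/r))"
    by (simp add: nn_integral_multc)
  from ennreal_amgm[OF this]
  have "(\<integral>\<^sup>+x. f x \<partial>lborel) * (\<integral>\<^sup>+x. g x \<partial>lborel) * (ennreal (1/r))\<^sup>2 \<le> (\<integral>\<^sup>+x. h x \<partial>lborel)\<^sup>2 * (ennreal (1/r))\<^sup>2"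
    unfolding rr[symmetric] by (simp add: power_mult_distrib ac_simps rr)
  moreover have e: "(ennreal (1/r))\<^sup>2 * (ennreal r)\<^sup>2 = 1"
    using r by (simp add: power_mult_distrib[symmetric] ennreal_mult[symmetric])
  have cancel: "x * (ennreal (1/r))\<^sup>2 * (ennreal r)\<^sup>2 = x" for x
    by (simp only: mult.assoc e mult_1_right)
  ultimately show ?thesis
    using mult_right_mono[of _ _ "(ennreal r)\<^sup>2"] cancel by (metis zero_le)
qed

text \<open>Truncating \<open>f\<close> and \<open>g\<close> keeps the hypothesis, and monotone
  convergence removes the truncation.\<close>

lemma Prekopa_Leindler_1:
  fixes f g h :: "real \<Rightarrow> ennreal"
  assumes [measurable]: "f \<in> borel_measurable borel" "g \<in> borel_measurable borel" "h \<in> borel_measurable borel"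
    and fgh: "\<And>x y. f x * g y \<le> (h ((x + y) / 2))\<^sup>2"
  shows "(\<integral>\<^sup>+x. f x \<partial>lborel) * (\<integral>\<^sup>+x. g x \<partial>lborel) \<le> (\<integral>\<^sup>+x. h x \<partial>lborel)\<^sup>2"
proof -
  have mc: "(\<integral>\<^sup>+x. u x \<partial>lborel) = (SUP n. \<integral>\<^sup>+x. min (u x) (ennreal (real n)) \<partial>lborel)"
    if [measurable]: "u \<in> borel_measurable borel" for u :: "real \<Rightarrow> ennreal"
  proof -
    have "(SUP n. min (u x) (ennreal (real n))) = u x" for x
    proof (rule antisym)
      show "u x \<le> (SUP n. min (u x) (ennreal (real n)))"
      proof (cases "u x = top")
        case True
        have "(SUP n. ennreal (real n)) = top"
          using ennreal_SUP_of_nat_eq_top by (simp only: ennreal_of_nat_eq_real_of_nat)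
        then show ?thesis using True by (simp only: min_top)
      next
        case False
        then obtain y where y: "u x = ennreal y" by (cases "u x") auto
        obtain n where "y \<le> real n" using real_arch_simple by blast
        then have "u x \<le> min (u x) (ennreal (real n))" unfolding y by (auto simp: ennreal_leI)
        then show ?thesis by (meson SUP_upper2 UNIV_I)
      qed
    qed (auto intro: SUP_least)
    then have "(\<integral>\<^sup>+x. u x \<partial>lborel) = (\<integral>\<^sup>+x. (SUP n. min (u x) (ennreal (real n))) \<partial>lborel)" by simp
    also have "\<dots> = (SUP n. \<integral>\<^sup>+x. min (u x) (ennreal (real n)) \<partial>lborel)"
      by (rule nn_integral_monotone_convergence_SUP)
        (auto simp: incseq_def le_fun_def intro: min.coboundedI2 ennreal_leI)
    finally show ?thesis .
  qed
  have "(\<integral>\<^sup>+x. min (f x) (ennreal (real m)) \<partial>lborel) * (\<integral>\<^sup>+x. min (g x) (ennreal (real n)) \<partial>lborel)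
    \<le> (\<integral>\<^sup>+x. h x \<partial>lborel)\<^sup>2" for m n
  proof (rule Prekopa_Leindler_bounded[where b="real (max m n)"])
    fix x y
    have "min (f x) (ennreal (real m)) * min (g y) (ennreal (real n)) \<le> f x * g y" by (intro mult_mono) auto
    also have "\<dots> \<le> (h ((x + y) / 2))\<^sup>2" by (rule fgh)
    finally show "min (f x) (ennreal (real m)) * min (g y) (ennreal (real n)) \<le> (h ((x + y) / 2))\<^sup>2" .
    show "min (f x) (ennreal (real m)) \<le> ennreal (real (max m n))"
      by (intro min.coboundedI2 ennreal_leI) auto
    show "min (g x) (ennreal (real n)) \<le> ennreal (real (max m n))"
      by (intro min.coboundedI2 ennreal_leI) auto
  qed auto
  then show ?thesis
    by (subst (1 2) mc) (auto simp: SUP_mult_left_ennreal SUP_mult_right_ennreal intro!: SUP_least)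
qed

text \<open>Induction on the coordinates: the one-dimensional inequality for sections says precisely
  that the integrals over one coordinate satisfy the hypothesis on the others.\<close>

lemma Prekopa_Leindler_PiM:
  fixes f g h :: "('i \<Rightarrow> real) \<Rightarrow> ennreal"
  assumes "finite I"
    and "f \<in> borel_measurable (Pi\<^sub>M I (\<lambda>_. lborel))" "g \<in> borel_measurable (Pi\<^sub>M I (\<lambda>_. lborel))"
      "h \<in> borel_measurable (Pi\<^sub>M I (\<lambda>_. lborel))"
    and "\<And>x y. x \<in> extensional I \<Longrightarrow> y \<in> extensional I \<Longrightarrow> f x * g y \<le> (h (\<lambda>i\<in>I. (x i + y i) / 2))\<^sup>2"
  shows "(\<integral>\<^sup>+x. f x \<partial>Pi\<^sub>M I (\<lambda>_. lborel)) * (\<integral>\<^sup>+x. g x \<partial>Pi\<^sub>M I (\<lambda>_. lborel)) \<le> (\<integral>\<^sup>+x. h x \<partial>Pi\<^sub>M I (\<lambda>_. lborel))\<^sup>2"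
  using assms
proof (induction I arbitrary: f g h rule: finite_induct)
  case empty
  interpret product_sigma_finite "\<lambda>_::'i. lborel :: real measure" ..
  show ?case using empty(4)[of "\<lambda>_. undefined" "\<lambda>_. undefined"]
    by (simp add: PiM_empty nn_integral_count_space_finite restrict_def)
next
  case (insert i I)
  interpret product_sigma_finite "\<lambda>_::'i. lborel :: real measure" ..
  note [measurable] = insert.prems(1-3)
  have sect: "(\<lambda>t. u (x(i := t))) \<in> borel_measurable borel"
    if "x \<in> extensional I" and u: "u \<in> borel_measurable (Pi\<^sub>M (insert i I) (\<lambda>_. lborel))"
    for x and u :: "('i \<Rightarrow> real) \<Rightarrow> ennreal"
  proof -
    have x: "x \<in> space (Pi\<^sub>M I (\<lambda>_. lborel))" using that by (simp add: space_PiM PiE_def)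
    show ?thesis
      using measurable_comp[OF measurable_component_update[OF x \<open>i \<notin> I\<close>] u] by (simp add: comp_def)
  qed
  have outer: "(\<lambda>x. \<integral>\<^sup>+t. u (x(i := t)) \<partial>lborel) \<in> borel_measurable (Pi\<^sub>M I (\<lambda>_. lborel))"
    if [measurable]: "u \<in> borel_measurable (Pi\<^sub>M (insert i I) (\<lambda>_. lborel))" for u :: "('i \<Rightarrow> real) \<Rightarrow> ennreal"
    by measurable
  have "(\<integral>\<^sup>+x. (\<integral>\<^sup>+t. f (x(i := t)) \<partial>lborel) \<partial>Pi\<^sub>M I (\<lambda>_. lborel)) * (\<integral>\<^sup>+x. (\<integral>\<^sup>+t. g (x(i := t)) \<partial>lborel) \<partial>Pi\<^sub>M I (\<lambda>_. lborel))
    \<le> (\<integral>\<^sup>+x. (\<integral>\<^sup>+t. h (x(i := t)) \<partial>lborel) \<partial>Pi\<^sub>M I (\<lambda>_. lborel))\<^sup>2"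
  proof (rule insert.IH)
    fix x y :: "'i \<Rightarrow> real" assume xy: "x \<in> extensional I" "y \<in> extensional I"
    let ?m = "\<lambda>i\<in>I. (x i + y i) / 2"
    show "(\<integral>\<^sup>+t. f (x(i := t)) \<partial>lborel) * (\<integral>\<^sup>+t. g (y(i := t)) \<partial>lborel) \<le> (\<integral>\<^sup>+t. h (?m(i := t)) \<partial>lborel)\<^sup>2"
    proof (rule Prekopa_Leindler_1)
      fix s t :: real
      have "f (x(i := s)) * g (y(i := t)) \<le> (h (\<lambda>j\<in>insert i I. ((x(i := s)) j + (y(i := t)) j) / 2))\<^sup>2"
        using xy by (intro insert.prems(4)) (auto simp: extensional_def)
      also have "(\<lambda>j\<in>insert i I. ((x(i := s)) j + (y(i := t)) j) / 2) = ?m(i := (s + t) / 2)"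
        by (auto simp: fun_eq_iff restrict_def)
      finally show "f (x(i := s)) * g (y(i := t)) \<le> (h (?m(i := (s + t) / 2)))\<^sup>2" .
    qed (use xy in \<open>auto intro!: sect\<close>)
  qed (rule outer insert.prems)+
  then show ?case using insert.hyps by (simp add: product_nn_integral_insert)
qed

lemma nn_integral_PiM_reflect:
  fixes f :: "('i \<Rightarrow> real) \<Rightarrow> ennreal"
  assumes "finite I" and "f \<in> borel_measurable (Pi\<^sub>M I (\<lambda>_. lborel))"
  shows "(\<integral>\<^sup>+x. f (\<lambda>i\<in>I. 2 * c i - x i) \<partial>Pi\<^sub>M I (\<lambda>_. lborel)) = (\<integral>\<^sup>+x. f x \<partial>Pi\<^sub>M I (\<lambda>_. lborel))"
  using assms
proof (induction I arbitrary: f rule: finite_induct)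
  case empty
  interpret product_sigma_finite "\<lambda>_::'i. lborel :: real measure" ..
  show ?case by (simp add: PiM_empty nn_integral_count_space_finite restrict_def)
next
  case (insert i I)
  interpret product_sigma_finite "\<lambda>_::'i. lborel :: real measure" ..
  note [measurable] = insert.prems
  have m: "(\<lambda>x. \<lambda>j\<in>insert i I. 2 * c j - x j) \<in> Pi\<^sub>M (insert i I) (\<lambda>_. lborel) \<rightarrow>\<^sub>M Pi\<^sub>M (insert i I) (\<lambda>_. lborel :: real measure)"
    by (rule measurable_restrict) simp
  have sect: "(\<lambda>t. f (x(i := t))) \<in> borel_measurable borel" if x: "x \<in> space (Pi\<^sub>M I (\<lambda>_. lborel))" for x
    using measurable_comp[OF measurable_component_update[OF x \<open>i \<notin> I\<close>] insert.prems] by (simp add: comp_def)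
  have sp: "(\<lambda>j\<in>I. 2 * c j - x j) \<in> space (Pi\<^sub>M I (\<lambda>_. lborel))" for x by (simp add: space_PiM)
  have "(\<integral>\<^sup>+x. f (\<lambda>j\<in>insert i I. 2 * c j - x j) \<partial>Pi\<^sub>M (insert i I) (\<lambda>_. lborel))
    = (\<integral>\<^sup>+x. (\<integral>\<^sup>+t. f (\<lambda>j\<in>insert i I. 2 * c j - (x(i := t)) j) \<partial>lborel) \<partial>Pi\<^sub>M I (\<lambda>_. lborel))"
    using insert.hyps measurable_comp[OF m insert.prems] by (subst product_nn_integral_insert) (auto simp: comp_def)
  also have "\<dots> = (\<integral>\<^sup>+x. (\<integral>\<^sup>+t. f ((\<lambda>j\<in>I. 2 * c j - x j)(i := 2 * c i + (-1) * t)) \<partial>lborel) \<partial>Pi\<^sub>M I (\<lambda>_. lborel))"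
    using insert.hyps by (intro nn_integral_cong arg_cong[where f=f]) (auto simp: fun_eq_iff restrict_def)
  also have "\<dots> = (\<integral>\<^sup>+x. (\<integral>\<^sup>+t. f ((\<lambda>j\<in>I. 2 * c j - x j)(i := t)) \<partial>lborel) \<partial>Pi\<^sub>M I (\<lambda>_. lborel))"
    using nn_integral_real_affine[OF sect[OF sp], where c="-1" and t="2 * c i"] by simp
  also have "\<dots> = (\<integral>\<^sup>+x. (\<integral>\<^sup>+t. f (x(i := t)) \<partial>lborel) \<partial>Pi\<^sub>M I (\<lambda>_. lborel))"
    by (rule insert.IH) measurable
  also have "\<dots> = (\<integral>\<^sup>+x. f x \<partial>Pi\<^sub>M (insert i I) (\<lambda>_. lborel))"
    using insert.hyps by (simp add: product_nn_integral_insert)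
  finally show ?case .
qed


section \<open>Even log-concave weights and masses of discs\<close>

lemma ball_in_sets_borel[measurable]: "ball (a::'a::metric_space) r \<in> sets borel"
  by (rule borel_open) simp

lemma ennreal_square_le_imp_le:
  fixes u v :: ennreal
  assumes "u * u \<le> v\<^sup>2"
  shows "u \<le> v"
proof (rule ccontr)
  assume "\<not> u \<le> v"
  then have vu: "v < u" by simp
  have "v * v < u * u"
  proof (cases "v = 0")
    case True
    then show ?thesis using vu by (metis ennreal_zero_less_mult_iff mult_zero_left)
  next
    case False
    then have "v * v < v * u"
      using vu by (intro ennreal_mult_strict_left_mono) (auto simp: zero_less_iff_neq_zero less_top[symmetric])
    also have "\<dots> \<le> u * u" using vu by (intro mult_right_mono) auto
    finally show ?thesis .
  qed
  then show False using assms by (simp add: power2_eq_square)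
qed

lemma dyadic_between:
  fixes s t :: real
  assumes "0 \<le> s" "s < t"
  obtains j k :: nat where "s < real j / 2 ^ k" "real j / 2 ^ k < t"
proof -
  obtain k where k: "1 / (t - s) < 2 ^ k" using real_arch_pow[of 2 "1 / (t - s)"] by auto
  then have k': "1 < (t - s) * 2 ^ k" using assms by (simp add: field_simps)
  define j where "j = nat \<lfloor>s * 2 ^ k\<rfloor> + 1"
  have "real (nat \<lfloor>s * 2 ^ k\<rfloor>) = of_int \<lfloor>s * 2 ^ k\<rfloor>" using assms by simp
  then have "s * 2 ^ k < real j" "real j \<le> s * 2 ^ k + 1"
    unfolding j_def by linarith+
  then have "s < real j / 2 ^ k" "real j / 2 ^ k < t" using k' by (simp_all add: field_simps)
  then show ?thesis by (rule that)
qed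

text \<open>The model of a single fibre: \<open>I\<close> indexes the real coordinates of the row
  and \<open>c\<close> is the centre of the reflection. Convexity of \<Gamma> and affinity of
  \<open>t\<close> are stated at midpoints, the form in which Prekopa-Leindler uses them;
  extensional functions are the points of the product space.\<close>

locale even_log_concave =
  fixes I :: "'i set" and \<Gamma> :: "('i \<Rightarrow> real) \<Rightarrow> real" and t :: "('i \<Rightarrow> real) \<Rightarrow> complex" and c :: "'i \<Rightarrow> real"
  assumes fin: "finite I"
    and \<Gamma>_meas[measurable]: "\<Gamma> \<in> borel_measurable (Pi\<^sub>M I (\<lambda>_. lborel))"
    and t_meas[measurable]: "t \<in> borel_measurable (Pi\<^sub>M I (\<lambda>_. lborel))"
    and \<Gamma>_mid: "\<And>x y. x \<in> extensional I \<Longrightarrow> y \<in> extensional I \<Longrightarrow> \<Gamma> (\<lambda>i\<in>I. (x i + y i) / 2) \<le> (\<Gamma> x + \<Gamma> y) / 2"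
    and t_mid: "\<And>x y. x \<in> extensional I \<Longrightarrow> y \<in> extensional I \<Longrightarrow> t (\<lambda>i\<in>I. (x i + y i) / 2) = (t x + t y) / 2"
    and \<Gamma>_even: "\<And>x. x \<in> extensional I \<Longrightarrow> \<Gamma> (\<lambda>i\<in>I. 2 * c i - x i) = \<Gamma> x"
    and t_odd: "\<And>x. x \<in> extensional I \<Longrightarrow> t (\<lambda>i\<in>I. 2 * c i - x i) = - t x"
begin

abbreviation "N \<equiv> Pi\<^sub>M I (\<lambda>_. lborel :: real measure)"

definition weight :: "('i \<Rightarrow> real) \<Rightarrow> ennreal" where "weight x = ennreal (exp (- \<Gamma> x))"

lemma weight_meas[measurable]: "weight \<in> borel_measurable N" unfolding weight_def by measurable

lemma t_in_ball_meas[measurable]: "Measurable.pred N (\<lambda>x. t x \<in> ball a e)"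
  unfolding mem_ball by measurable

sublocale NN: sigma_finite_measure N
proof -
  interpret finite_product_sigma_finite "\<lambda>_::'i. lborel :: real measure" I by standard (rule fin)
  show "sigma_finite_measure N" by (rule sigma_finite_measure_axioms)
qed

text \<open>Up to the area of the disc, the density of \<open>t\<close> averaged around
  \<open>a\<close>. It is defined at every point, whether or not such a density exists.\<close>

definition smooth_density :: "real \<Rightarrow> complex \<Rightarrow> ennreal" where
  "smooth_density e a = (\<integral>\<^sup>+x. indicator (ball a e) (t x) * weight x \<partial>N)"

text \<open>As \<open>t\<close> is affine, values in the discs about \<open>a\<close> and
  \<open>b\<close> have their midpoint in the disc of the same radius about the midpoint of
  \<open>a\<close> and \<open>b\<close>. Together with midpoint convexity of \<Gamma> this is the
  hypothesis of Prekopa-Leindler.\<close>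

lemma smooth_density_mid: "smooth_density e a * smooth_density e b \<le> (smooth_density e ((a + b) / 2))\<^sup>2"
  unfolding smooth_density_def
proof (rule Prekopa_Leindler_PiM[OF fin])
  fix x y :: "'i \<Rightarrow> real" assume xy: "x \<in> extensional I" "y \<in> extensional I"
  let ?m = "\<lambda>i\<in>I. (x i + y i) / 2"
  show "indicator (ball a e) (t x) * weight x * (indicator (ball b e) (t y) * weight y)
    \<le> (indicator (ball ((a + b) / 2) e) (t ?m) * weight ?m)\<^sup>2"
  proof (cases "t x \<in> ball a e \<and> t y \<in> ball b e")
    case True
    have "cmod ((a + b) / 2 - t ?m) = cmod ((a - t x) + (b - t y)) / 2"
    proof -
      have "(a + b) / 2 - t ?m = ((a - t x) + (b - t y)) / 2"
        unfolding t_mid[OF xy] by (simp add: field_simps)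
      then show ?thesis by (simp only: norm_divide) simp
    qed
    also have "\<dots> \<le> (cmod (a - t x) + cmod (b - t y)) / 2" by (intro divide_right_mono norm_triangle_ineq) auto
    also have "\<dots> < e" using True by (auto simp: dist_norm)
    finally have "t ?m \<in> ball ((a + b) / 2) e" by (simp add: dist_norm)
    moreover have "weight x * weight y \<le> (weight ?m)\<^sup>2"
      unfolding weight_def power2_eq_square using \<Gamma>_mid[OF xy]
      by (subst (1 2) ennreal_mult[symmetric]) (auto intro!: ennreal_leI simp: exp_add[symmetric])
    ultimately show ?thesis using True by (simp add: power_mult_distrib)
  qed (auto simp: indicator_def)
qed measurable

lemma smooth_density_even: "smooth_density e (- a) = smooth_density e a"
proof -
  have "smooth_density e (- a) = (\<integral>\<^sup>+x. indicator (ball (- a) e) (t (\<lambda>i\<in>I. 2 * c i - x i)) * weight (\<lambda>i\<in>I. 2 * c i - x i) \<partial>N)"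
    unfolding smooth_density_def by (rule nn_integral_PiM_reflect[OF fin, symmetric]) measurable
  also have "\<dots> = smooth_density e a"
    unfolding smooth_density_def
  proof (intro nn_integral_cong)
    fix x assume "x \<in> space N"
    then have x: "x \<in> extensional I" by (simp add: space_PiM PiE_def)
    have "dist (- a) (- t x) = dist a (t x)" by (rule dist_minus)
    then show "indicator (ball (- a) e) (t (\<lambda>i\<in>I. 2 * c i - x i)) * weight (\<lambda>i\<in>I. 2 * c i - x i)
      = indicator (ball a e) (t x) * weight x"
      unfolding t_odd[OF x] weight_def \<Gamma>_even[OF x] by (simp add: indicator_def)
  qed
  finally show ?thesis .
qed

text \<open>The values at \<open>a\<close> and \<open>- a\<close> agree, and midpoint log-concavity
  hands this lower bound on to the midpoint of any two points that already satisfy it. Repeated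
  halving reaches the dyadic points of the segment from \<open>- a\<close> to
  \<open>a\<close>.\<close>

lemma smooth_density_dyadic: "\<bar>j\<bar> \<le> 2 ^ k \<Longrightarrow> smooth_density e a \<le> smooth_density e ((of_int j / 2 ^ k) * a)"
proof (induction k arbitrary: j)
  case 0
  then consider "j = -1" | "j = 0" | "j = 1" by fastforce
  then show ?case
  proof cases
    case 1 then show ?thesis by (simp add: smooth_density_even)
  next
    case 2
    have "smooth_density e a * smooth_density e a \<le> (smooth_density e 0)\<^sup>2" using smooth_density_mid[of e a "- a"] by (simp add: smooth_density_even)
    from ennreal_square_le_imp_le[OF this] show ?thesis using 2 by simp
  qed simp
next
  case (Suc k)
  show ?case
  proof (cases "even j")
    case True
    then obtain i where "j = 2 * i" by blast
    then show ?thesis using Suc.IH[of i] Suc.prems by simp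
  next
    case False
    then obtain i where i: "j = 2 * i + 1" by (blast elim: oddE)
    have b: "\<bar>i\<bar> \<le> 2 ^ k" "\<bar>i + 1\<bar> \<le> 2 ^ k" using Suc.prems i by auto
    have "smooth_density e a * smooth_density e a \<le> smooth_density e ((of_int i / 2 ^ k) * a) * smooth_density e ((of_int (i + 1) / 2 ^ k) * a)"
      by (intro mult_mono Suc.IH b) auto
    also have "\<dots> \<le> (smooth_density e (((of_int i / 2 ^ k) * a + (of_int (i + 1) / 2 ^ k) * a) / 2))\<^sup>2" by (rule smooth_density_mid)
    also have "((of_int i / 2 ^ k) * a + (of_int (i + 1) / 2 ^ k) * a) / 2 = (of_int j / 2 ^ Suc k) * a"
      unfolding i by (simp add: field_simps)
    finally show ?thesis by (rule ennreal_square_le_imp_le)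
  qed
qed

definition mass :: "real \<Rightarrow> ennreal" where
  "mass r = (\<integral>\<^sup>+x. indicator (ball 0 r) (t x) * weight x \<partial>N)"

definition smooth_mass :: "real \<Rightarrow> real \<Rightarrow> ennreal" where
  "smooth_mass e r = (\<integral>\<^sup>+a. indicator (ball 0 r) a * smooth_density e a \<partial>lborel)"

lemma mass_mono: "r \<le> s \<Longrightarrow> mass r \<le> mass s"
  unfolding mass_def by (intro nn_integral_mono mult_right_mono) (auto simp: indicator_def)

lemma smooth_density_meas[measurable]: "smooth_density e \<in> borel_measurable borel"
proof -
  have "(\<lambda>a. \<integral>\<^sup>+x. indicator (ball a e) (t x) * weight x \<partial>N) \<in> borel_measurable borel"
    unfolding indicator_def mem_ball by measurable
  then show ?thesis unfolding smooth_density_def[abs_def] .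
qed

text \<open>Tonelli and the symmetry of distance: each \<open>x\<close> is counted with the area of
  the part of the disc about \<open>t x\<close> that lies in \<open>ball 0 r\<close>. This squeezes
  the smoothed mass between multiples of \<open>mass (r - e)\<close> and
  \<open>mass (r + e)\<close>.\<close>

lemma smooth_mass_eq:
  "smooth_mass e r = (\<integral>\<^sup>+x. emeasure lborel (ball 0 r \<inter> ball (t x) e) * weight x \<partial>N)"
proof -
  interpret pair_sigma_finite N "lborel :: complex measure" ..
  have "smooth_mass e r = (\<integral>\<^sup>+a. (\<integral>\<^sup>+x. indicator (ball 0 r) a * (indicator (ball a e) (t x) * weight x) \<partial>N) \<partial>lborel)"
    unfolding smooth_mass_def smooth_density_def by (intro nn_integral_cong nn_integral_cmult[symmetric]) measurable
  also have "\<dots> = (\<integral>\<^sup>+x. (\<integral>\<^sup>+a. indicator (ball 0 r) a * (indicator (ball a e) (t x) * weight x) \<partial>lborel) \<partial>N)"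
    unfolding indicator_def mem_ball by (rule Fubini') measurable
  also have "\<dots> = (\<integral>\<^sup>+x. emeasure lborel (ball 0 r \<inter> ball (t x) e) * weight x \<partial>N)"
  proof (intro nn_integral_cong)
    fix x
    have "(\<integral>\<^sup>+a. indicator (ball 0 r) a * (indicator (ball a e) (t x) * weight x) \<partial>lborel)
      = (\<integral>\<^sup>+a. indicator (ball 0 r \<inter> ball (t x) e) a * weight x \<partial>lborel)"
      by (intro nn_integral_cong) (auto simp: indicator_def dist_commute)
    also have "\<dots> = emeasure lborel (ball 0 r \<inter> ball (t x) e) * weight x"
    proof -
      have "ball 0 r \<inter> ball (t x) e \<in> sets lborel" by (simp add: borel_open open_Int)
      then show ?thesis by (simp add: nn_integral_multc)
    qed
    finally show "(\<integral>\<^sup>+a. indicator (ball 0 r) a * (indicator (ball a e) (t x) * weight x) \<partial>lborel)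
      = emeasure lborel (ball 0 r \<inter> ball (t x) e) * weight x" .
  qed
  finally show ?thesis .
qed

lemma emeasure_ball_shift: "emeasure lborel (ball (a::complex) e) = emeasure lborel (ball (0::complex) e)"
proof -
  have "emeasure lborel (ball a e) = emeasure (distr lborel borel ((+) a)) (ball a e)"
    by (simp add: lborel_distr_plus)
  also have "\<dots> = emeasure lborel ((+) a -` ball a e)" by (subst emeasure_distr) auto
  also have "(+) a -` ball a e = ball 0 e" by (auto simp: dist_norm)
  finally show ?thesis .
qed

lemma smooth_mass_lower: "mass (r - e) * emeasure lborel (ball (0::complex) e) \<le> smooth_mass e r"
proof -
  have "mass (r - e) * emeasure lborel (ball (0::complex) e)
    = (\<integral>\<^sup>+x. indicator (ball 0 (r - e)) (t x) * weight x * emeasure lborel (ball (0::complex) e) \<partial>N)"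
    unfolding mass_def by (rule nn_integral_multc[symmetric]) measurable
  also have "\<dots> \<le> smooth_mass e r"
    unfolding smooth_mass_eq
  proof (intro nn_integral_mono)
    fix x
    show "indicator (ball 0 (r - e)) (t x) * weight x * emeasure lborel (ball (0::complex) e)
      \<le> emeasure lborel (ball 0 r \<inter> ball (t x) e) * weight x"
    proof (cases "t x \<in> ball 0 (r - e)")
      case True
      have "ball (t x) e \<subseteq> ball 0 r"
      proof
        fix b assume "b \<in> ball (t x) e"
        then show "b \<in> ball 0 r" using True dist_triangle[of 0 b "t x"] by simp
      qed
      then have "ball 0 r \<inter> ball (t x) e = ball (t x) e" by auto
      then show ?thesis using True emeasure_ball_shift[of "t x" e] by (simp add: mult.commute)
    qed auto
  qed
  finally show ?thesis .
qed

lemma smooth_mass_upper: "smooth_mass e r \<le> mass (r + e) * emeasure lborel (ball (0::complex) e)"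
proof -
  have "smooth_mass e r \<le> (\<integral>\<^sup>+x. indicator (ball 0 (r + e)) (t x) * weight x * emeasure lborel (ball (0::complex) e) \<partial>N)"
    unfolding smooth_mass_eq
  proof (intro nn_integral_mono)
    fix x
    show "emeasure lborel (ball 0 r \<inter> ball (t x) e) * weight x
      \<le> indicator (ball 0 (r + e)) (t x) * weight x * emeasure lborel (ball (0::complex) e)"
    proof (cases "t x \<in> ball 0 (r + e)")
      case True
      have "emeasure lborel (ball 0 r \<inter> ball (t x) e) \<le> emeasure lborel (ball (0::complex) e)"
        unfolding emeasure_ball_shift[of "t x" e, symmetric] by (intro emeasure_mono) auto
      then show ?thesis using True by (simp add: mult.commute[of "weight x"] mult_right_mono)
    next
      case False
      have "ball 0 r \<inter> ball (t x) e = {}"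
      proof (rule equals0I)
        fix b assume "b \<in> ball 0 r \<inter> ball (t x) e"
        then show False using False dist_triangle[of 0 "t x" b] by (simp add: dist_commute)
      qed
      then show ?thesis by simp
    qed
  qed
  also have "\<dots> = mass (r + e) * emeasure lborel (ball (0::complex) e)"
    unfolding mass_def by (rule nn_integral_multc) measurable
  finally show ?thesis .
qed

text \<open>Dilation by \<open>d\<close> multiplies plane areas by \<open>d\<^sup>2\<close> and
  moves points towards 0 along rays, where \<open>smooth_density\<close> is at least as
  large.\<close>

lemma smooth_mass_scale:
  assumes d: "d = real j / 2 ^ k" "0 < d" "d \<le> 1"
  shows "ennreal (d\<^sup>2) * smooth_mass e r \<le> smooth_mass e (d * r)"
proof -
  have j: "\<bar>int j\<bar> \<le> 2 ^ k"
  proof -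
    have "real j = d * 2 ^ k" using d(1) by simp
    also have "\<dots> \<le> 1 * 2 ^ k" using d(3) by (intro mult_right_mono) auto
    finally show ?thesis by simp
  qed
  have "ennreal (d\<^sup>2) * smooth_mass e r = (\<integral>\<^sup>+a. ennreal (d\<^sup>2) * (indicator (ball 0 r) a * smooth_density e a) \<partial>lborel)"
    unfolding smooth_mass_def by (rule nn_integral_cmult[symmetric]) measurable
  also have "\<dots> \<le> (\<integral>\<^sup>+a. ennreal (d\<^sup>2) * (indicator (ball 0 (d * r)) (d *\<^sub>R a) * smooth_density e (d *\<^sub>R a)) \<partial>lborel)"
  proof (intro nn_integral_mono mult_left_mono mult_mono)
    fix a :: complex
    show "indicator (ball 0 r) a \<le> (indicator (ball 0 (d * r)) (d *\<^sub>R a) :: ennreal)"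
    proof -
      have "d *\<^sub>R a \<in> ball 0 (d * r)" if "a \<in> ball 0 r" using that d(2) by (simp add: dist_norm)
      then show ?thesis by (auto simp: indicator_def simp del: mem_ball mem_ball_0)
    qed
    show "smooth_density e a \<le> smooth_density e (d *\<^sub>R a)" using smooth_density_dyadic[OF j, of e a] unfolding d(1) by (simp add: scaleR_conv_of_real)
  qed auto
  also have "\<dots> = smooth_mass e (d * r)"
    unfolding smooth_mass_def using d(2)
    by (subst (2) lborel_affine[of d "0::complex"]) (auto simp: nn_integral_density nn_integral_distr)
  finally show ?thesis .
qed

text \<open>The scaled inequality for smoothed masses is squeezed between plain masses, and the area
  of the smoothing disc, positive and finite, cancels.\<close>

lemma mass_dyadic:
  assumes d: "d = real j / 2 ^ k" "0 < d" "d \<le> 1" and e: "e > 0"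
  shows "ennreal (d\<^sup>2) * mass (r - e) \<le> mass (d * r + e)"
proof -
  let ?V = "emeasure lborel (ball (0::complex) e)"
  have V: "0 < ?V" "?V < top"
  proof -
    show "0 < ?V" using e by (simp add: emeasure_ball zero_less_iff_neq_zero unit_ball_vol_2)
    show "?V < top" using emeasure_bounded_finite[of "ball (0::complex) e"] by auto
  qed
  have "ennreal (d\<^sup>2) * mass (r - e) * ?V \<le> ennreal (d\<^sup>2) * smooth_mass e r"
    unfolding mult.assoc by (intro mult_left_mono smooth_mass_lower) auto
  also have "\<dots> \<le> smooth_mass e (d * r)" by (rule smooth_mass_scale[OF d])
  also have "\<dots> \<le> mass (d * r + e) * ?V" by (rule smooth_mass_upper)
  finally have *: "ennreal (d\<^sup>2) * mass (r - e) * ?V \<le> mass (d * r + e) * ?V" .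
  show ?thesis
  proof (rule ccontr)
    assume "\<not> ?thesis"
    then have "mass (d * r + e) * ?V < ennreal (d\<^sup>2) * mass (r - e) * ?V"
      using V by (intro ennreal_mult_strict_right_mono) auto
    with * show False by simp
  qed
qed

lemma mass_left_cont: "mass r = (SUP n. mass (r - 1 / real (Suc n)))"
proof -
  have "(SUP n. mass (r - 1 / real (Suc n))) = (\<integral>\<^sup>+x. (SUP n. indicator (ball 0 (r - 1 / real (Suc n))) (t x) * weight x) \<partial>N)"
    unfolding mass_def
  proof (rule nn_integral_monotone_convergence_SUP[symmetric])
    show "incseq (\<lambda>n x. indicator (ball 0 (r - 1 / real (Suc n))) (t x) * weight x)"
    proof (intro incseq_SucI le_funI mult_right_mono)
      fix n x
      have "ball (0::complex) (r - 1 / real (Suc n)) \<subseteq> ball 0 (r - 1 / real (Suc (Suc n)))"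
        by (rule subset_ball) (simp add: frac_le)
      then show "indicator (ball 0 (r - 1 / real (Suc n))) (t x)
        \<le> (indicator (ball 0 (r - 1 / real (Suc (Suc n)))) (t x) :: ennreal)"
        by (auto simp: indicator_def simp del: mem_ball mem_ball_0)
    qed simp
  qed measurable
  also have "\<dots> = mass r"
    unfolding mass_def
  proof (intro nn_integral_cong antisym SUP_least)
    fix x n
    show "indicator (ball 0 (r - 1 / real (Suc n))) (t x) * weight x \<le> indicator (ball 0 r) (t x) * weight x"
    proof (intro mult_right_mono)
      have "ball (0::complex) (r - 1 / real (Suc n)) \<subseteq> ball 0 r" by (rule subset_ball) simp
      then show "indicator (ball 0 (r - 1 / real (Suc n))) (t x) \<le> (indicator (ball 0 r) (t x) :: ennreal)"
        by (auto simp: indicator_def simp del: mem_ball mem_ball_0)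
    qed simp
  next
    fix x
    show "indicator (ball 0 r) (t x) * weight x \<le> (SUP n. indicator (ball 0 (r - 1 / real (Suc n))) (t x) * weight x)"
    proof (cases "t x \<in> ball 0 r")
      case True
      then have "0 < r - cmod (t x)" by simp
      then obtain n where "inverse (real (Suc n)) < r - cmod (t x)" using reals_Archimedean by blast
      then have "t x \<in> ball 0 (r - 1 / real (Suc n))" by (simp add: inverse_eq_divide)
      then have "indicator (ball 0 r) (t x) * weight x \<le> indicator (ball 0 (r - 1 / real (Suc n))) (t x) * weight x"
        by (auto simp: indicator_def simp del: mem_ball mem_ball_0)
      then show ?thesis by (meson SUP_upper2 UNIV_I)
    qed auto
  qed
  finally show ?thesis by simp
qed

lemma mass_scale_less:
  assumes "0 < d'" "d' < s" "s \<le> 1" "0 < r"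
  shows "ennreal (d'\<^sup>2) * mass r \<le> mass (s * r)"
proof -
  obtain j k :: nat where jk: "d' < real j / 2 ^ k" "real j / 2 ^ k < s"
    using dyadic_between[of d' s] assms by auto
  define d where "d = real j / 2 ^ k"
  have "d < s" "d' < d" unfolding d_def by (fact jk)+
  then have d: "0 < d" "d \<le> 1" "d < s" "d' < d" using assms by auto
  have "ennreal (d\<^sup>2) * mass (r - 1 / real (Suc n)) \<le> mass (s * r)" for n
  proof -
    \<comment> \<open>The smoothing radius has to be at most \<open>1 / real (Suc n)\<close> on the
      left and to fit into the gap between \<open>d * r\<close> and \<open>s * r\<close> on the
      right.\<close>
    define e where "e = min (1 / real (Suc n)) ((s - d) * r)"
    have e: "e > 0" "e \<le> 1 / real (Suc n)" "d * r + e \<le> s * r"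
      using d assms unfolding e_def by (auto simp: algebra_simps min_def)
    have "ennreal (d\<^sup>2) * mass (r - 1 / real (Suc n)) \<le> ennreal (d\<^sup>2) * mass (r - e)"
      using e by (intro mult_left_mono mass_mono) auto
    also have "\<dots> \<le> mass (d * r + e)" using d e by (intro mass_dyadic[OF d_def]) auto
    also have "\<dots> \<le> mass (s * r)" using e by (intro mass_mono)
    finally show ?thesis .
  qed
  then have "ennreal (d\<^sup>2) * mass r \<le> mass (s * r)"
    by (subst mass_left_cont) (auto simp: SUP_mult_left_ennreal intro!: SUP_least)
  moreover have "ennreal (d'\<^sup>2) * mass r \<le> ennreal (d\<^sup>2) * mass r"
    using d assms by (intro mult_right_mono ennreal_leI power_mono) auto
  ultimately show ?thesis by (rule order_trans[rotated])
qed

lemma mass_scale: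
  assumes s: "0 < s" "s \<le> 1" "0 < r"
  shows "ennreal (s\<^sup>2) * mass r \<le> mass (s * r)"
proof (cases "mass r = top")
  case True
  then have "mass (s * r) = top"
    using mass_scale_less[of "s/2" s r] s by (simp add: ennreal_mult_top top_unique)
  then show ?thesis by simp
next
  case False
  \<comment> \<open>The offset 2 makes the factors start at 1/2, so they stay strictly between 0 and
    1 as the strict version demands. Finite mass makes the multiplication continuous.\<close>
  have "(\<lambda>n. ennreal ((s * (1 - 1 / real (n + 2)))\<^sup>2) * mass r) \<longlonglongrightarrow> ennreal ((s * (1 - 0))\<^sup>2) * mass r"
  proof (intro tendsto_mult_ennreal tendsto_ennrealI tendsto_intros)
    show "(\<lambda>n. 1 / real (n + 2)) \<longlonglongrightarrow> 0"
      using LIMSEQ_ignore_initial_segment[OF lim_1_over_n, of 2] by simp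
  qed (use False in auto)
  then have "ennreal ((s * (1 - 0))\<^sup>2) * mass r \<le> mass (s * r)"
  proof (rule LIMSEQ_le_const2)
    have "ennreal ((s * (1 - 1 / real (n + 2)))\<^sup>2) * mass r \<le> mass (s * r)" for n
      using s by (intro mass_scale_less) (auto simp: field_simps intro: add_pos_nonneg)
    then show "\<exists>N. \<forall>n\<ge>N. ennreal ((s * (1 - 1 / real (n + 2)))\<^sup>2) * mass r \<le> mass (s * r)" by blast
  qed
  then show ?thesis by simp
qed

lemma sq_less_iff: "cmod b < sqrt v \<longleftrightarrow> (cmod b)\<^sup>2 < v"
proof -
  have "cmod b = sqrt ((cmod b)\<^sup>2)" by simp
  then show ?thesis using real_sqrt_less_iff[of "(cmod b)\<^sup>2" v] by simp
qed

text \<open>In terms of squared radii, scaling says that \<open>mass (sqrt v)\<close> is at least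
  the fraction \<open>v / u\<close> of \<open>mass (sqrt u)\<close>; the fractions for
  \<open>w\<close> and \<open>u - w\<close> add up to 1.\<close>

lemma mass_subadditive:
  assumes "0 < w" "w < u"
  shows "mass (sqrt u) \<le> mass (sqrt w) + mass (sqrt (u - w))"
proof -
  have *: "ennreal (v / u) * mass (sqrt u) \<le> mass (sqrt v)" if "0 < v" "v \<le> u" for v
  proof -
    have "sqrt (v / u) * sqrt u = sqrt v" using that by (simp add: real_sqrt_mult[symmetric])
    then show ?thesis using mass_scale[of "sqrt (v / u)" "sqrt u"] that by simp
  qed
  have "ennreal (w / u) + ennreal ((u - w) / u) = ennreal 1"
    using assms by (subst ennreal_plus[symmetric]) (auto simp: add_divide_distrib[symmetric])
  then have "mass (sqrt u) = ennreal (w / u) * mass (sqrt u) + ennreal ((u - w) / u) * mass (sqrt u)"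
    by (simp add: distrib_right[symmetric])
  also have "\<dots> \<le> mass (sqrt w) + mass (sqrt (u - w))"
    using assms by (intro add_mono *) auto
  finally show ?thesis .
qed

text \<open>Shell and inner disc make up the disc of squared radius \<open>u\<close>, so
  subadditivity leaves the bound once the finite mass of the inner disc is cancelled. If
  \<open>mass (sqrt u)\<close> is infinite, scaling makes the right side infinite as well.\<close>

lemma mass_shell:
  assumes "0 < w" "w < u"
  shows "(\<integral>\<^sup>+x. indicator {w..<u} ((cmod (t x))\<^sup>2) * weight x \<partial>N) \<le> mass (sqrt (u - w))"
proof (cases "mass (sqrt u) = top")
  case True
  have "sqrt ((u - w) / u) * sqrt u = sqrt (u - w)" using assms by (simp add: real_sqrt_mult[symmetric])
  then have "ennreal ((u - w) / u) * mass (sqrt u) \<le> mass (sqrt (u - w))"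
    using mass_scale[of "sqrt ((u - w) / u)" "sqrt u"] assms by simp
  then have "mass (sqrt (u - w)) = top" using True assms by (simp add: ennreal_mult_top top_unique)
  then show ?thesis by simp
next
  case False
  have sq: "t x \<in> ball 0 (sqrt v) \<longleftrightarrow> (cmod (t x))\<^sup>2 < v" for x v
    by (simp add: sq_less_iff)
  have "(\<integral>\<^sup>+x. indicator {w..<u} ((cmod (t x))\<^sup>2) * weight x \<partial>N) + mass (sqrt w)
    = (\<integral>\<^sup>+x. indicator {w..<u} ((cmod (t x))\<^sup>2) * weight x + indicator (ball 0 (sqrt w)) (t x) * weight x \<partial>N)"
    unfolding mass_def by (rule nn_integral_add[symmetric]) measurable
  also have "\<dots> = mass (sqrt u)"
    unfolding mass_def using assms by (intro nn_integral_cong) (auto simp: indicator_def sq simp del: mem_ball mem_ball_0)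
  also have "\<dots> \<le> mass (sqrt (u - w)) + mass (sqrt w)"
    using mass_subadditive[OF assms] by (simp add: add.commute)
  finally have *: "mass (sqrt w) + (\<integral>\<^sup>+x. indicator {w..<u} ((cmod (t x))\<^sup>2) * weight x \<partial>N) \<le> mass (sqrt w) + mass (sqrt (u - w))"
    by (simp add: add.commute)
  have "mass (sqrt w) \<le> mass (sqrt u)" using assms by (intro mass_mono) auto
  then have "mass (sqrt w) \<noteq> top" using False by (auto simp: top_unique)
  then show ?thesis using * by (simp add: ennreal_add_left_cancel_le)
qed

section \<open>The Gaussian tail as a mixture over discs\<close>

lemma exp_layer:
  fixes a w :: real
  assumes "a > 0"
  shows "(\<integral>\<^sup>+u. indicator {w<..} u * ennreal (a * exp (- a * u)) \<partial>lborel) = ennreal (exp (- a * w))"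
proof -
  have "(\<integral>\<^sup>+u. indicator {w<..} u * ennreal (a * exp (- a * u)) \<partial>lborel)
    = (\<integral>\<^sup>+u. ennreal (a * exp (- a * u)) * indicator {w..} u \<partial>lborel)"
    by (rule nn_integral_cong_AE, rule AE_mp[OF AE_lborel_singleton[of w]]) (auto simp: indicator_def)
  also have "\<dots> = ennreal (0 - (- exp (- a * w)))"
  proof (rule nn_integral_FTC_atLeast)
    fix x
    show "((\<lambda>u. - exp (- a * u)) has_real_derivative a * exp (- a * x)) (at x)"
      by (auto intro!: derivative_eq_intros)
    show "0 \<le> a * exp (- a * x)" using assms by simp
  next
    have "filterlim (\<lambda>u. a * u) at_top at_top"
      by (rule filterlim_tendsto_pos_mult_at_top[OF tendsto_const assms filterlim_ident])
    then have "filterlim (\<lambda>u. - (a * u)) at_bot at_top" by (simp add: filterlim_uminus_at_bot)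
    from tendsto_minus[OF filterlim_compose[OF exp_at_bot this]]
    show "((\<lambda>u. - exp (- a * u)) \<longlongrightarrow> 0) at_top" by simp
  qed simp
  finally show ?thesis by simp
qed

text \<open>Writing exp (- a |t|^2) as the integral of a exp (- a u) over u > |t|^2 turns both sides
  into mixtures over u. The tail event leaves the shell between w and u, whose mass is at most that
  of the disc of squared radius u - w; shifting u by w produces the factor exp (- a w).\<close>

lemma gaussian_tail:
  assumes a: "a > 0" and w: "w > 0"
  shows "(\<integral>\<^sup>+x. indicator {w..} ((cmod (t x))\<^sup>2) * ennreal (exp (- a * (cmod (t x))\<^sup>2 - \<Gamma> x)) \<partial>N)
    \<le> ennreal (exp (- a * w)) * (\<integral>\<^sup>+x. ennreal (exp (- a * (cmod (t x))\<^sup>2 - \<Gamma> x)) \<partial>N)"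
proof -
  interpret pair_sigma_finite N "lborel :: real measure" ..
  let ?q = "\<lambda>x. (cmod (t x))\<^sup>2"
  let ?E = "\<lambda>u::real. ennreal (a * exp (- a * u))"
  have split: "ennreal (exp (- a * ?q x - \<Gamma> x)) = (\<integral>\<^sup>+u. indicator {?q x<..} u * ?E u \<partial>lborel) * weight x" for x
    unfolding exp_layer[OF a] weight_def by (simp add: ennreal_mult[symmetric] exp_diff exp_minus divide_inverse)
  have sq: "t x \<in> ball 0 (sqrt v) \<longleftrightarrow> ?q x < v" for x v
    by (simp add: sq_less_iff)
  have layered: "(\<integral>\<^sup>+x. b (?q x) * ennreal (exp (- a * ?q x - \<Gamma> x)) \<partial>N)
    = (\<integral>\<^sup>+u. ?E u * (\<integral>\<^sup>+x. b (?q x) * indicator {..<u} (?q x) * weight x \<partial>N) \<partial>lborel)"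
    if [measurable]: "b \<in> borel_measurable borel" for b :: "real \<Rightarrow> ennreal"
  proof -
    have "(\<integral>\<^sup>+x. b (?q x) * ennreal (exp (- a * ?q x - \<Gamma> x)) \<partial>N)
      = (\<integral>\<^sup>+x. (\<integral>\<^sup>+u. ?E u * (b (?q x) * indicator {..<u} (?q x) * weight x) \<partial>lborel) \<partial>N)"
    proof (intro nn_integral_cong)
      fix x
      have "(\<integral>\<^sup>+u. ?E u * (b (?q x) * indicator {..<u} (?q x) * weight x) \<partial>lborel)
        = (\<integral>\<^sup>+u. (b (?q x) * weight x) * (indicator {?q x<..} u * ?E u) \<partial>lborel)"
        by (intro nn_integral_cong) (auto simp: indicator_def ac_simps)
      also have "\<dots> = (b (?q x) * weight x) * (\<integral>\<^sup>+u. indicator {?q x<..} u * ?E u \<partial>lborel)"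
        by (rule nn_integral_cmult) measurable
      finally show "b (?q x) * ennreal (exp (- a * ?q x - \<Gamma> x))
        = (\<integral>\<^sup>+u. ?E u * (b (?q x) * indicator {..<u} (?q x) * weight x) \<partial>lborel)"
        unfolding split by (simp add: ac_simps)
    qed
    also have "\<dots> = (\<integral>\<^sup>+u. (\<integral>\<^sup>+x. ?E u * (b (?q x) * indicator {..<u} (?q x) * weight x) \<partial>N) \<partial>lborel)"
      unfolding indicator_def lessThan_iff by (rule Fubini'[symmetric]) measurable
    also have "\<dots> = (\<integral>\<^sup>+u. ?E u * (\<integral>\<^sup>+x. b (?q x) * indicator {..<u} (?q x) * weight x \<partial>N) \<partial>lborel)"
      by (intro nn_integral_cong nn_integral_cmult) measurable
    finally show ?thesis .
  qed
  \<comment> \<open>For negative \<open>u\<close> both sides are 0: \<open>sqrt u\<close> is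
    negative and the disc is empty. The mixture may therefore run over all real \<open>u\<close>,
    also after the shift.\<close>
  have mass_eq: "(\<integral>\<^sup>+x. indicator {..<u} (?q x) * weight x \<partial>N) = mass (sqrt u)" for u
    unfolding mass_def by (intro nn_integral_cong) (simp add: indicator_def sq del: mem_ball mem_ball_0)
  have mass_meas[measurable]: "(\<lambda>u. mass (sqrt u)) \<in> borel_measurable borel"
  proof -
    have "(\<lambda>u::real. \<integral>\<^sup>+x. indicator {..<u} (?q x) * weight x \<partial>N) \<in> borel_measurable borel"
      unfolding indicator_def lessThan_iff by measurable
    then show ?thesis unfolding mass_eq .
  qed
  have "(\<integral>\<^sup>+x. indicator {w..} (?q x) * ennreal (exp (- a * ?q x - \<Gamma> x)) \<partial>N)
    = (\<integral>\<^sup>+u. ?E u * (\<integral>\<^sup>+x. indicator {w..} (?q x) * indicator {..<u} (?q x) * weight x \<partial>N) \<partial>lborel)"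
    by (rule layered) simp
  also have "\<dots> \<le> (\<integral>\<^sup>+u. ?E u * mass (sqrt (u - w)) \<partial>lborel)"
  proof (intro nn_integral_mono mult_left_mono)
    fix u
    have eq: "(\<integral>\<^sup>+x. indicator {w..} (?q x) * indicator {..<u} (?q x) * weight x \<partial>N)
      = (\<integral>\<^sup>+x. indicator {w..<u} (?q x) * weight x \<partial>N)"
      by (intro nn_integral_cong) (auto simp: indicator_def)
    show "(\<integral>\<^sup>+x. indicator {w..} (?q x) * indicator {..<u} (?q x) * weight x \<partial>N) \<le> mass (sqrt (u - w))"
      unfolding eq by (cases "w < u") (auto intro: mass_shell[OF w])
  qed simp
  also have "\<dots> = (\<integral>\<^sup>+u. ?E (w + 1 * u) * mass (sqrt (w + 1 * u - w)) \<partial>lborel)"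
    using nn_integral_real_affine[of "\<lambda>u. ?E u * mass (sqrt (u - w))" 1 w] by simp
  also have "\<dots> = (\<integral>\<^sup>+u. ennreal (exp (- a * w)) * (?E u * mass (sqrt u)) \<partial>lborel)"
  proof (intro nn_integral_cong)
    fix u
    have "exp (- a * (w + 1 * u)) = exp (- a * w) * exp (- a * u)"
      by (simp add: exp_add[symmetric] algebra_simps)
    then have "a * exp (- a * (w + 1 * u)) = exp (- a * w) * (a * exp (- a * u))" by (simp only: mult.left_commute)
    then have "?E (w + 1 * u) = ennreal (exp (- a * w)) * ?E u"
      using a by (simp only: ennreal_mult' exp_ge_zero)
    then show "?E (w + 1 * u) * mass (sqrt (w + 1 * u - w)) = ennreal (exp (- a * w)) * (?E u * mass (sqrt u))"
      by (simp only: mult.assoc) simp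
  qed
  also have "\<dots> = ennreal (exp (- a * w)) * (\<integral>\<^sup>+u. ?E u * mass (sqrt u) \<partial>lborel)"
    by (rule nn_integral_cmult) measurable
  also have "(\<integral>\<^sup>+u. ?E u * mass (sqrt u) \<partial>lborel) = (\<integral>\<^sup>+x. ennreal (exp (- a * ?q x - \<Gamma> x)) \<partial>N)"
    using layered[of "\<lambda>_. 1"] by (simp add: mass_eq)
  finally show ?thesis .
qed

end

section \<open>Deflation of an eigenvector\<close>

lemma has_derivative_vec_lambda:
  fixes f :: "'i::finite \<Rightarrow> 'a::real_normed_vector \<Rightarrow> 'b::euclidean_space"
  assumes "\<And>i. (f i has_derivative f' i) (at x within S)"
  shows "((\<lambda>x. \<chi> i. f i x) has_derivative (\<lambda>h. \<chi> i. f' i h)) (at x within S)"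
  unfolding has_derivative_componentwise_within[of "\<lambda>x. \<chi> i. f i x"]
proof
  fix b :: "'b^'i" assume "b \<in> Basis"
  then obtain i c where "b = axis i c" unfolding Basis_vec_def by blast
  then show "((\<lambda>x. (\<chi> i. f i x) \<bullet> b) has_derivative (\<lambda>h. (\<chi> i. f' i h) \<bullet> b)) (at x within S)"
    using has_derivative_inner_left[OF assms[of i], of c] by (simp add: inner_axis)
qed

text \<open>A matrix \<open>P\<close> packs all the coordinates: the eigenvalue \<open>\<lambda>\<close> at \<open>(k, k)\<close>; in the rest of column
  \<open>k\<close> the entries \<open>y\<close> of the eigenvector, whose entry \<open>k\<close> is normalised to 1; the row \<open>r\<close> in the rest
  of row \<open>k\<close>; and the block \<open>K\<close> elsewhere. Then \<open>inflate k P\<close> is \<open>L (\<lambda>, r; 0, K) inverse(L)\<close> for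
  \<open>L = 1 + y e\<^sub>k\<^sup>T\<close>, and \<open>block_eigenpair\<close> describes the eigenpairs of \<open>K\<close> without reference to a type of
  cardinality \<open>n - 1\<close>.\<close>

definition deflation_vec :: "'n \<Rightarrow> complex^'n^'n \<Rightarrow> complex^'n" where
  "deflation_vec k P = (\<chi> i. if i = k then 1 else P $ i $ k)"

text \<open>For \<open>j\<close> other than \<open>k\<close>, column \<open>j\<close> of L
  (\<lambda>, r; 0, K). Multiplication by inverse(L) = 1 - y \<open>e\<^sub>k\<^sup>T\<close> from
  the right changes column \<open>k\<close> only.\<close>

definition deflation_rest :: "'n \<Rightarrow> complex^'n^'n \<Rightarrow> 'n \<Rightarrow> 'n \<Rightarrow> complex" where
  "deflation_rest k P i j = (if i = k then 0 else P $ i $ j) + deflation_vec k P $ i * P $ k $ j"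

definition inflate :: "'n \<Rightarrow> complex^'n^'n \<Rightarrow> complex^'n^'n" where
  "inflate k P = (\<chi> i j. if j = k then P $ k $ k * deflation_vec k P $ i - (\<Sum>l\<in>UNIV - {k}. deflation_rest k P i l * P $ l $ k)
     else deflation_rest k P i j)"

definition block_eigenpair :: "'n \<Rightarrow> complex^'n^'n \<Rightarrow> complex \<Rightarrow> complex^'n \<Rightarrow> bool" where
  "block_eigenpair k P \<mu> w \<longleftrightarrow> w \<noteq> 0 \<and> w $ k = 0 \<and> (\<forall>i. i \<noteq> k \<longrightarrow> (P *v w) $ i = \<mu> * w $ i)"

lemma deflation_vec_k [simp]: "deflation_vec k P $ k = 1"
  by (simp add: deflation_vec_def)

lemma deflation_vec_nonzero: "deflation_vec k P \<noteq> 0"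
  by (metis deflation_vec_k zero_index zero_neq_one)

lemma inflate_deflation_vec: "inflate k P *v deflation_vec k P = P $ k $ k *s deflation_vec k P"
proof -
  have "(inflate k P *v deflation_vec k P) $ i = P $ k $ k * deflation_vec k P $ i" for i
  proof -
    have "(inflate k P *v deflation_vec k P) $ i = inflate k P $ i $ k * deflation_vec k P $ k
        + (\<Sum>l\<in>UNIV - {k}. inflate k P $ i $ l * deflation_vec k P $ l)"
      unfolding matrix_vector_mult_def by (simp add: sum.remove[of UNIV k])
    also have "(\<Sum>l\<in>UNIV - {k}. inflate k P $ i $ l * deflation_vec k P $ l) = (\<Sum>l\<in>UNIV - {k}. deflation_rest k P i l * P $ l $ k)"
      by (intro sum.cong) (auto simp: inflate_def deflation_vec_def)
    finally show ?thesis by (simp add: inflate_def)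
  qed
  then show ?thesis by (simp add: vec_eq_iff)
qed

text \<open>inverse(L) fixes every vector whose entry \<open>k\<close> vanishes, so only the block
  matrix and \<open>L\<close> act.\<close>

lemma inflate_mult:
  assumes "w $ k = 0"
  shows "inflate k P *v w = (\<chi> i. if i = k then 0 else (P *v w) $ i) + (P *v w) $ k *s deflation_vec k P"
proof -
  have "(inflate k P *v w) $ i = (if i = k then 0 else (P *v w) $ i) + (P *v w) $ k * deflation_vec k P $ i" for i
  proof -
    have "(inflate k P *v w) $ i = (\<Sum>j\<in>UNIV. deflation_rest k P i j * w $ j)"
      unfolding matrix_vector_mult_def using assms by (auto simp: inflate_def intro!: sum.cong)
    also have "\<dots> = (\<Sum>j\<in>UNIV. (if i = k then 0 else P $ i $ j) * w $ j) + (\<Sum>j\<in>UNIV. P $ k $ j * w $ j) * deflation_vec k P $ i"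
      unfolding deflation_rest_def distrib_right sum.distrib sum_distrib_right by (simp add: ac_simps)
    finally show ?thesis by (simp add: matrix_vector_mult_def)
  qed
  then show ?thesis by (simp add: vec_eq_iff)
qed

lemma inflate_block_eigenpair:
  assumes "block_eigenpair k P \<mu> w"
  shows "inflate k P *v w = \<mu> *s w + (P *v w) $ k *s deflation_vec k P"
proof -
  have "(\<chi> i. if i = k then 0 else (P *v w) $ i) = \<mu> *s w"
    using assms by (auto simp: block_eigenpair_def vec_eq_iff)
  then show ?thesis using inflate_mult[of w k P] assms by (simp add: block_eigenpair_def)
qed

lemma deflate:
  assumes "M *v x = c *s x" "x $ k = 1"
  obtains P where "inflate k P = M" "deflation_vec k P = x" "P $ k $ k = c"
proof
  \<comment> \<open>Since \<open>x $ k = 1\<close>, row \<open>k\<close> of \<open>M\<close> is r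
    itself, and subtracting the rank one matrix x r from the other rows uncovers K.\<close>
  define P where "P = (\<chi> i j. if i = k then (if j = k then c else M $ k $ j)
    else (if j = k then x $ i else M $ i $ j - x $ i * M $ k $ j))"
  show x: "deflation_vec k P = x" using assms(2) by (simp add: deflation_vec_def P_def vec_eq_iff)
  show "P $ k $ k = c" by (simp add: P_def)
  have rest: "deflation_rest k P i j = M $ i $ j" if "j \<noteq> k" for i j
    using that assms(2) unfolding deflation_rest_def x by (simp add: P_def)
  have "inflate k P $ i $ k = M $ i $ k" for i
  proof -
    have "(M *v x) $ i = M $ i $ k * x $ k + (\<Sum>l\<in>UNIV - {k}. M $ i $ l * x $ l)"
      unfolding matrix_vector_mult_def by (simp add: sum.remove[of UNIV k])
    then have "M $ i $ k = c * x $ i - (\<Sum>l\<in>UNIV - {k}. M $ i $ l * x $ l)"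
      using assms by (simp add: algebra_simps)
    also have "(\<Sum>l\<in>UNIV - {k}. M $ i $ l * x $ l) = (\<Sum>l\<in>UNIV - {k}. deflation_rest k P i l * P $ l $ k)"
    proof (intro sum.cong refl)
      fix l assume "l \<in> UNIV - {k}"
      then have "P $ l $ k = x $ l" "deflation_rest k P i l = M $ i $ l" by (simp_all add: P_def rest[unfolded P_def])
      then show "M $ i $ l * x $ l = deflation_rest k P i l * P $ l $ k" by simp
    qed
    finally show ?thesis unfolding inflate_def x by (simp add: P_def)
  qed
  then show "inflate k P = M" by (simp add: vec_eq_iff inflate_def rest)
qed

text \<open>K is the action of the matrix on the quotient by the deflated eigenvector, each class
  being represented by its member with entry \<open>k\<close> equal to 0.\<close>

lemma block_eigenpair_of_eigenvector:
  assumes v: "inflate k P *v v = \<mu> *s v" and w: "w = v - v $ k *s deflation_vec k P" and nz: "w \<noteq> 0"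
  shows "block_eigenpair k P \<mu> w"
proof -
  let ?x = "deflation_vec k P"
  have wk: "w $ k = 0" by (simp add: w)
  have "inflate k P *v w = \<mu> *s v - (v $ k * P $ k $ k) *s ?x"
    unfolding w by (simp add: matrix_vector_mult_diff_distrib v vector_scalar_commute inflate_deflation_vec vector_smult_assoc)
  then have eq: "(if i = k then 0 else (P *v w) $ i) + (P *v w) $ k * ?x $ i = \<mu> * v $ i - v $ k * P $ k $ k * ?x $ i" for i
    using inflate_mult[OF wk, of P] by (auto simp: vec_eq_iff)
  have Pk: "(P *v w) $ k = \<mu> * v $ k - v $ k * P $ k $ k" using eq[of k] by simp
  have "(P *v w) $ i = \<mu> * w $ i" if "i \<noteq> k" for i
  proof -
    have wi: "w $ i = v $ i - v $ k * ?x $ i" by (simp add: w)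
    show ?thesis using eq[of i] that unfolding Pk wi by (simp add: algebra_simps)
  qed
  then show ?thesis using nz wk by (simp add: block_eigenpair_def)
qed

lemma eigenvector_of_block_eigenpair:
  assumes w: "block_eigenpair k P \<mu> w" and ne: "\<mu> \<noteq> P $ k $ k"
  shows "\<exists>b. inflate k P *v (w + b *s deflation_vec k P) = \<mu> *s (w + b *s deflation_vec k P) \<and> w + b *s deflation_vec k P \<noteq> 0"
proof -
  let ?x = "deflation_vec k P"
  \<comment> \<open>The coefficient of the deflated eigenvector in the lift has to satisfy
    \<open>(P *v w) $ k + b * P $ k $ k = \<mu> * b\<close>, which is solvable as the two
    eigenvalues differ.\<close>
  define b where "b = (P *v w) $ k / (\<mu> - P $ k $ k)"
  have b: "(P *v w) $ k + b * P $ k $ k = \<mu> * b" using ne by (simp add: b_def field_simps)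
  have "inflate k P *v (w + b *s ?x) = \<mu> *s w + ((P *v w) $ k + b * P $ k $ k) *s ?x"
    by (simp add: matrix_vector_right_distrib vector_scalar_commute inflate_block_eigenpair[OF w] inflate_deflation_vec
        vector_smult_assoc vector_sadd_rdistrib add.assoc)
  then have "inflate k P *v (w + b *s ?x) = \<mu> *s (w + b *s ?x)"
    unfolding b by (simp add: vector_add_ldistrib vector_smult_assoc)
  moreover have "w + b *s ?x \<noteq> 0"
  proof
    assume 0: "w + b *s ?x = 0"
    then have "(w + b *s ?x) $ k = 0" by simp
    then have "b = 0" using w by (simp add: block_eigenpair_def)
    then show False using 0 w by (simp add: block_eigenpair_def)
  qed
  ultimately show ?thesis by blast
qed

lemma inflate_cancel:
  assumes "inflate k P = inflate k Q" "deflation_vec k P = deflation_vec k Q" "P $ k $ k = Q $ k $ k"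
  shows "P = Q"
proof -
  have col: "P $ i $ k = Q $ i $ k" for i
  proof (cases "i = k")
    case False
    have "deflation_vec k P $ i = deflation_vec k Q $ i" using assms(2) by simp
    then show ?thesis using False by (simp add: deflation_vec_def)
  qed (use assms(3) in simp)
  have rest: "deflation_rest k P i j = deflation_rest k Q i j" if "j \<noteq> k" for i j
    using assms(1) that by (auto simp: inflate_def vec_eq_iff) metis
  have row: "P $ k $ j = Q $ k $ j" for j
    using rest[of j k] assms(3) by (cases "j = k") (simp_all add: deflation_rest_def)
  have "P $ i $ j = Q $ i $ j" for i j
    using rest[of j i] row[of j] col assms(2) by (cases "j = k"; cases "i = k") (simp_all add: deflation_rest_def)
  then show ?thesis by (simp add: vec_eq_iff)
qed

text \<open>A domain on which deflation is unique: strict inequality singles out the deflated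
  eigenvalue and excludes that K has it too.\<close>

definition closest_block :: "'n \<Rightarrow> complex \<Rightarrow> (complex^'n^'n) set" where
  "closest_block k z = {P. \<forall>\<mu> w. block_eigenpair k P \<mu> w \<longrightarrow> cmod (P $ k $ k - z) < cmod (\<mu> - z)}"

text \<open>If two preimages deflated different vectors, the difference of these would be a block
  eigenvector of either one for the eigenvalue of the other, and each eigenvalue would be strictly
  closer to \<open>z\<close> than the other.\<close>

lemma inj_on_inflate: "inj_on (inflate k) (closest_block k z)"
proof (rule inj_onI)
  fix P Q assume P: "P \<in> closest_block k z" and Q: "Q \<in> closest_block k z" and eq: "inflate k P = inflate k Q"
  have other: "block_eigenpair k P (Q $ k $ k) (deflation_vec k Q - deflation_vec k P)"
    if "inflate k P = inflate k Q" "deflation_vec k P \<noteq> deflation_vec k Q" for P Q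
    using that inflate_deflation_vec[of k Q] by (intro block_eigenpair_of_eigenvector[where v="deflation_vec k Q"]) auto
  have same: "deflation_vec k P = deflation_vec k Q"
  proof (rule ccontr)
    assume ne: "deflation_vec k P \<noteq> deflation_vec k Q"
    have "cmod (P $ k $ k - z) < cmod (Q $ k $ k - z)" using P other[OF eq ne] by (auto simp: closest_block_def)
    moreover have "cmod (Q $ k $ k - z) < cmod (P $ k $ k - z)"
      using Q other[OF eq[symmetric] ne[symmetric]] by (auto simp: closest_block_def)
    ultimately show False by simp
  qed
  have "P $ k $ k *s deflation_vec k P = Q $ k $ k *s deflation_vec k P"
    by (metis inflate_deflation_vec eq same)
  from arg_cong[OF this, of "\<lambda>v. v $ k"] have "P $ k $ k = Q $ k $ k" by simp
  then show "P = Q" by (rule inflate_cancel[OF eq same])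
qed

section \<open>The derivative of the parametrisation and its Jacobian\<close>

definition inflate_deriv :: "'n \<Rightarrow> complex^'n^'n \<Rightarrow> complex^'n^'n \<Rightarrow> complex^'n^'n" where
  "inflate_deriv k P H =
    (let dx = (\<lambda>i. if i = k then 0 else H $ i $ k);
         dN = (\<lambda>i j. (if i = k then 0 else H $ i $ j) + (deflation_vec k P $ i * H $ k $ j + dx i * P $ k $ j))
     in \<chi> i j. if j = k then (P $ k $ k * dx i + H $ k $ k * deflation_vec k P $ i)
          - (\<Sum>l\<in>UNIV - {k}. deflation_rest k P i l * H $ l $ k + dN i l * P $ l $ k)
        else dN i j)"

lemma has_derivative_entry: "((\<lambda>P::complex^'n^'n. P $ i $ j) has_derivative (\<lambda>H. H $ i $ j)) (at P within S)"
  by (intro bounded_linear_imp_has_derivative bounded_linear_compose[OF bounded_linear_vec_nth bounded_linear_vec_nth])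

lemma has_derivative_inflate: "(inflate k has_derivative inflate_deriv k P) (at P within S)"
proof -
  note [derivative_intros] = has_derivative_entry
  have dx: "((\<lambda>P. deflation_vec k P $ i) has_derivative (\<lambda>H. if i = k then 0 else H $ i $ k)) (at P within S)" for i
    by (cases "i = k") (auto simp: deflation_vec_def intro!: derivative_eq_intros)
  have dN: "((\<lambda>P. deflation_rest k P i j) has_derivative (\<lambda>H. (if i = k then 0 else H $ i $ j) +
     (deflation_vec k P $ i * H $ k $ j + (if i = k then 0 else H $ i $ k) * P $ k $ j))) (at P within S)" for i j
    unfolding deflation_rest_def
    by (intro has_derivative_add has_derivative_mult dx has_derivative_entry)
      (cases "i = k", simp_all add: has_derivative_entry)
  show ?thesis
    unfolding inflate_def inflate_deriv_def Let_def
  proof (intro has_derivative_vec_lambda)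
    fix i j
    show "((\<lambda>P. if j = k then P $ k $ k * deflation_vec k P $ i - (\<Sum>l\<in>UNIV - {k}. deflation_rest k P i l * P $ l $ k)
        else deflation_rest k P i j) has_derivative
      (\<lambda>H. if j = k then (P $ k $ k * (if i = k then 0 else H $ i $ k) + H $ k $ k * deflation_vec k P $ i)
          - (\<Sum>l\<in>UNIV - {k}. deflation_rest k P i l * H $ l $ k + ((if i = k then 0 else H $ i $ l) +
              (deflation_vec k P $ i * H $ k $ l + (if i = k then 0 else H $ i $ k) * P $ k $ l)) * P $ l $ k)
        else (if i = k then 0 else H $ i $ j) +
              (deflation_vec k P $ i * H $ k $ j + (if i = k then 0 else H $ i $ k) * P $ k $ j))) (at P within S)"
    proof (cases "j = k")
      case True
      show ?thesis unfolding True simp_thms if_True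
        by (intro has_derivative_diff has_derivative_mult has_derivative_sum has_derivative_entry dx dN)
    qed (simp add: dN)
  qed
qed

definition deriv_row :: "'n \<Rightarrow> complex^'n \<Rightarrow> complex^'n^'n \<Rightarrow> complex^'n^'n" where
  "deriv_row k r H = (\<chi> i j. if j = k then (if i = k then H $ k $ k - (\<Sum>l\<in>UNIV - {k}. r $ l * H $ l $ k) else H $ i $ k)
     else (if i = k then H $ k $ j else H $ i $ j + H $ i $ k * r $ j))"

text \<open>Multiplies the differential of y by \<lambda> - K.\<close>

definition deriv_block :: "'n \<Rightarrow> complex^'n^'n \<Rightarrow> complex^'n^'n \<Rightarrow> complex^'n^'n" where
  "deriv_block k P H = (\<chi> i j. if j = k \<and> i \<noteq> k then P $ k $ k * H $ i $ k - (\<Sum>l\<in>UNIV - {k}. P $ i $ l * H $ l $ k) else H $ i $ j)"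

text \<open>Conjugation of \<open>H\<close> by \<open>L\<close>.\<close>

definition deriv_column :: "'n \<Rightarrow> complex^'n^'n \<Rightarrow> complex^'n^'n \<Rightarrow> complex^'n^'n" where
  "deriv_column k P H = (let B = (\<lambda>i j. (if i = k then 0 else H $ i $ j) + deflation_vec k P $ i * H $ k $ j)
     in \<chi> i j. if j = k then B i k - (\<Sum>l\<in>UNIV - {k}. B i l * P $ l $ k) else B i j)"

text \<open>Differentiate M = L B inverse(L) with B the block matrix. As inverse(L) dL = dy
  \<open>e\<^sub>k\<^sup>T\<close>, one gets inverse(L) dM L = dB +
  [dy \<open>e\<^sub>k\<^sup>T\<close>, B]. The commutator adds dy r to dK, subtracts r dy from
  d\<lambda> and puts (\<lambda> - K) dy into column \<open>k\<close>. The row enters only through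
  the first, unipotent factor.\<close>

lemma inflate_deriv_factor: "inflate_deriv k P = deriv_column k P \<circ> deriv_block k P \<circ> deriv_row k (P $ k)"
proof (rule ext)
  fix H
  have "inflate_deriv k P H $ i $ j = deriv_column k P (deriv_block k P (deriv_row k (P $ k) H)) $ i $ j" for i j
  proof (cases "j = k")
    case False
    then show ?thesis
      by (simp add: inflate_deriv_def deriv_column_def deriv_block_def deriv_row_def Let_def algebra_simps)
  next
    case jk: True
    show ?thesis
    proof (cases "i = k")
      case True
      then show ?thesis
        by (simp add: jk inflate_deriv_def deriv_column_def deriv_block_def deriv_row_def Let_def deflation_rest_def
            sum.distrib sum_subtractf algebra_simps)
    next
      case False
      have "deriv_column k P (deriv_block k P (deriv_row k (P $ k) H)) $ i $ k
        = P $ k $ k * H $ i $ k - (\<Sum>l\<in>UNIV - {k}. P $ i $ l * H $ l $ k)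
          + deflation_vec k P $ i * (H $ k $ k - (\<Sum>l\<in>UNIV - {k}. P $ k $ l * H $ l $ k))
          - (\<Sum>l\<in>UNIV - {k}. (H $ i $ l + H $ i $ k * P $ k $ l + deflation_vec k P $ i * H $ k $ l) * P $ l $ k)"
        using False by (simp add: deriv_column_def deriv_block_def deriv_row_def Let_def)
      also have "\<dots> = inflate_deriv k P H $ i $ k"
        using False by (simp add: inflate_deriv_def Let_def deflation_rest_def sum.distrib sum_distrib_left algebra_simps)
      finally show ?thesis using jk by simp
    qed
  qed
  then show "inflate_deriv k P H = (deriv_column k P \<circ> deriv_block k P \<circ> deriv_row k (P $ k)) H"
    by (simp add: vec_eq_iff)
qed

lemma scaleR_entry: "((r *\<^sub>R H :: complex^'n^'n) $ i $ j) = complex_of_real r * H $ i $ j"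
  by (simp add: scaleR_conv_of_real[where 'a=complex])

lemma linear_deriv_row: "linear (deriv_row k r)"
  by (rule linearI) (simp_all add: deriv_row_def vec_eq_iff scaleR_entry algebra_simps sum.distrib sum_distrib_left scaleR_sum_right)

lemma linear_deriv_block: "linear (deriv_block k P)"
  by (rule linearI) (simp_all add: deriv_block_def vec_eq_iff scaleR_entry algebra_simps sum.distrib sum_distrib_left scaleR_sum_right)

lemma linear_deriv_column: "linear (deriv_column k P)"
  by (rule linearI) (simp_all add: deriv_column_def Let_def vec_eq_iff scaleR_entry algebra_simps sum.distrib sum_distrib_left scaleR_sum_right)

lemma jac_nonzero:
  assumes "linear A" "linear B" "A \<circ> B = id"
  shows "jac A \<noteq> 0"
  using jac_compose[OF assms(1,2)] jac_id assms(3) by (metis mult_zero_left zero_neq_one)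

text \<open>The shear depends additively on \<open>r\<close>, and doubling \<open>r\<close> amounts to a conjugation; so its
  Jacobian is idempotent.\<close>

lemma jac_deriv_row:
  fixes k :: "'n::finite"
  shows "jac (deriv_row k r) = 1"
proof -
  \<comment> \<open>Scales the differential of y by \<open>c\<close>. As r occurs in the shear only
    in products with that differential, commuting past \<open>Z c\<close> rescales r.\<close>
  define Z where "Z c H = (\<chi> i j. if j = k \<and> i \<noteq> k then c * H $ i $ j else H $ i $ j)" for c and H :: "complex^'n^'n"
  have linZ: "linear (Z c)" for c
    by (rule linearI) (simp_all add: Z_def vec_eq_iff scaleR_entry algebra_simps)
  have "Z (1/2) \<circ> Z 2 = id" "Z 2 \<circ> Z (1/2) = id" by (auto simp: fun_eq_iff Z_def vec_eq_iff)
  then have Z0: "jac (Z 2) \<noteq> 0" by (intro jac_nonzero[OF linZ linZ])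
  have add: "deriv_row k r \<circ> deriv_row k s = deriv_row k (r + s)" for r s
    by (auto simp: fun_eq_iff deriv_row_def vec_eq_iff algebra_simps sum.distrib sum_subtractf)
  have "deriv_row k r \<circ> deriv_row k (- r) = id"
    unfolding add by (auto simp: fun_eq_iff deriv_row_def vec_eq_iff)
  then have r0: "jac (deriv_row k r) \<noteq> 0" by (rule jac_nonzero[OF linear_deriv_row linear_deriv_row])
  have "deriv_row k r \<circ> Z 2 = Z 2 \<circ> deriv_row k (r + r)"
    by (auto simp: fun_eq_iff deriv_row_def Z_def vec_eq_iff algebra_simps sum.distrib intro!: sum.cong)
  then have "jac (deriv_row k r) * jac (Z 2) = jac (Z 2) * jac (deriv_row k (r + r))"
    using jac_compose[OF linear_deriv_row linZ] jac_compose[OF linZ linear_deriv_row] by metis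
  then have "jac (deriv_row k r) = jac (deriv_row k (r + r))" using Z0 by simp
  also have "\<dots> = jac (deriv_row k r) * jac (deriv_row k r)"
    unfolding add[symmetric] by (rule jac_compose[OF linear_deriv_row linear_deriv_row])
  finally show ?thesis using r0 by simp
qed

section \<open>Fibres, along which only the row r varies\<close>

definition leaf_eq :: "'n \<Rightarrow> complex^'n^'n \<Rightarrow> complex^'n^'n \<Rightarrow> bool" where
  "leaf_eq k P Q \<longleftrightarrow> (\<forall>i j. \<not> (i = k \<and> j \<noteq> k) \<longrightarrow> P $ i $ j = Q $ i $ j)"

lemma leaf_eq_deflation_vec: "leaf_eq k P Q \<Longrightarrow> deflation_vec k P = deflation_vec k Q"
  by (simp add: leaf_eq_def deflation_vec_def vec_eq_iff)

lemma leaf_eq_block_eigenpair: "leaf_eq k P Q \<Longrightarrow> block_eigenpair k P = block_eigenpair k Q"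
  by (auto simp: fun_eq_iff leaf_eq_def block_eigenpair_def matrix_vector_mult_def)

text \<open>Of the three factors of the derivative only \<open>deriv_row\<close> involves r, and its
  Jacobian is 1.\<close>

lemma leaf_eq_jac:
  fixes k :: "'n::finite"
  assumes "leaf_eq k P Q"
  shows "jac (inflate_deriv k P) = jac (inflate_deriv k Q)"
proof -
  have "jac (inflate_deriv k P) = jac (deriv_column k P) * jac (deriv_block k P)" for P :: "complex^'n^'n"
    unfolding inflate_deriv_factor
      jac_compose[OF linear_compose[OF linear_deriv_block linear_deriv_column] linear_deriv_row]
      jac_compose[OF linear_deriv_column linear_deriv_block] jac_deriv_row by simp
  moreover have "deriv_column k P = deriv_column k Q" "deriv_block k P = deriv_block k Q"
    using assms leaf_eq_deflation_vec[OF assms]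
    by (auto simp: fun_eq_iff deriv_column_def deriv_block_def leaf_eq_def Let_def vec_eq_iff intro!: sum.cong)
  ultimately show ?thesis by simp
qed

text \<open>An increment s of the row changes the matrix by L (0, s; 0, 0) inverse(L), a rank one
  matrix with columns along the eigenvector. In particular \<open>inflate\<close> is affine along a
  fibre.\<close>

lemma inflate_leaf:
  assumes "leaf_eq k P Q"
  shows "inflate k Q $ i $ j = inflate k P $ i $ j + deflation_vec k P $ i *
    (if j = k then - (\<Sum>l\<in>UNIV - {k}. (Q $ k $ l - P $ k $ l) * P $ l $ k) else Q $ k $ j - P $ k $ j)"
proof -
  have x: "deflation_vec k Q = deflation_vec k P" using leaf_eq_deflation_vec[OF assms] by simp
  have rest: "deflation_rest k Q i j = deflation_rest k P i j + deflation_vec k P $ i * (Q $ k $ j - P $ k $ j)" for i j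
    using assms by (auto simp: deflation_rest_def x leaf_eq_def algebra_simps)
  have col: "Q $ l $ k = P $ l $ k" for l using assms by (simp add: leaf_eq_def)
  show ?thesis
    by (simp add: inflate_def x rest col sum.distrib distrib_right sum_distrib_left mult.assoc)
qed

section \<open>The density on a fibre\<close>

lemma norm_vec_power2: "(norm (v :: 'a::real_normed_vector^'n))\<^sup>2 = (\<Sum>i\<in>UNIV. (norm (v $ i))\<^sup>2)"
  by (simp add: norm_vec_def L2_set_def sum_nonneg)

lemma norm_matrix_vector_le: "norm (M *v u) \<le> norm M * norm (u :: complex^'n)"
proof -
  have row: "(cmod ((M *v u) $ i))\<^sup>2 \<le> (norm (M $ i))\<^sup>2 * (norm u)\<^sup>2" for i
  proof -
    define r where "r = (\<chi> j. cnj (M $ i $ j))"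
    have "norm r = norm (M $ i)" by (simp add: r_def norm_vec_def L2_set_def)
    moreover have "(M *v u) $ i = hermitian_inner r u"
      by (simp add: r_def matrix_vector_mult_def hermitian_inner_def)
    ultimately show ?thesis
      using power_mono[OF hermitian_Cauchy_Schwarz[of r u], of 2] by (simp add: power_mult_distrib)
  qed
  have "(norm (M *v u))\<^sup>2 \<le> (\<Sum>i\<in>UNIV. (norm (M $ i))\<^sup>2 * (norm u)\<^sup>2)"
    unfolding norm_vec_power2[of "M *v u"] by (intro sum_mono row)
  also have "\<dots> = (norm M * norm u)\<^sup>2"
    by (simp add: norm_vec_power2[of M] power_mult_distrib sum_distrib_right)
  finally show ?thesis by (simp add: power2_le_iff_abs_le)
qed

section \<open>The reflection that flips the eigenvector\<close>

definition householder :: "complex^'n \<Rightarrow> complex^'n^'n" where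
  "householder x = (\<chi> i j. (if i = j then 1 else 0) - 2 * x $ i * cnj (x $ j) / complex_of_real ((norm x)\<^sup>2))"

lemma householder_mult: "householder x *v u = u - (2 * hermitian_inner x u / complex_of_real ((norm x)\<^sup>2)) *s x"
proof -
  have "(householder x *v u) $ i = u $ i - (2 * hermitian_inner x u / complex_of_real ((norm x)\<^sup>2)) * x $ i" for i
  proof -
    have "(householder x *v u) $ i = (\<Sum>j\<in>UNIV. (if i = j then u $ j else 0) - 2 * x $ i * cnj (x $ j) / complex_of_real ((norm x)\<^sup>2) * u $ j)"
      unfolding matrix_vector_mult_def householder_def by (simp add: left_diff_distrib if_distrib[where f="\<lambda>c. c * _"] cong: if_cong)
    also have "\<dots> = u $ i - (\<Sum>j\<in>UNIV. 2 * x $ i / complex_of_real ((norm x)\<^sup>2) * (cnj (x $ j) * u $ j))"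
      by (simp add: sum_subtractf mult.assoc)
    also have "\<dots> = u $ i - 2 * x $ i / complex_of_real ((norm x)\<^sup>2) * hermitian_inner x u"
      by (simp only: hermitian_inner_def sum_distrib_left)
    finally show ?thesis by simp
  qed
  then show ?thesis by (simp add: vec_eq_iff)
qed

lemma ctranspose_householder: "ctranspose (householder x) = householder x"
  by (simp add: householder_def vec_eq_iff mult.commute)

lemma householder_self: "x \<noteq> 0 \<Longrightarrow> householder x *v x = - x"
  by (simp add: householder_mult hermitian_inner_self vec_eq_iff)

lemma unitary_householder:
  assumes "x \<noteq> 0" shows "unitary_matrix (householder x)"
proof -
  have "(householder x ** householder x) *v u = mat 1 *v u" for u
  proof -
    let ?c = "2 * hermitian_inner x u / complex_of_real ((norm x)\<^sup>2)"
    have e: "householder x *v u = u - ?c *s x" by (rule householder_mult)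
    have "householder x *v (u - ?c *s x) = householder x *v u - ?c *s (- x)"
      by (simp only: matrix_vector_mult_diff_distrib vector_scalar_commute householder_self[OF assms])
    also have "\<dots> = u" unfolding e by (simp add: vec_eq_iff)
    finally show ?thesis unfolding matrix_vector_mul_assoc[symmetric] e by simp
  qed
  then have "householder x ** householder x = mat 1" by (simp add: matrix_eq)
  then show ?thesis by (simp add: unitary_matrix_def ctranspose_householder)
qed

text \<open>With M x = c x the four terms of the conjugation collapse to a rank one correction along
  \<open>x\<close>, the shape of a displacement inside a fibre.\<close>

lemma householder_conj:
  assumes x: "x \<noteq> 0" and Mx: "M *v x = c *s x"
  shows "(householder x ** M ** householder x) $ i $ j =
    M $ i $ j + 2 * x $ i / complex_of_real ((norm x)\<^sup>2) * (c * cnj (x $ j) - (\<Sum>l\<in>UNIV. cnj (x $ l) * M $ l $ j))"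
proof -
  let ?N = "complex_of_real ((norm x)\<^sup>2)" and ?g = "\<lambda>j. \<Sum>l\<in>UNIV. cnj (x $ l) * M $ l $ j"
  have N: "?N \<noteq> 0" using x by simp
  have HM: "(householder x ** M) $ i $ j = M $ i $ j - 2 * x $ i / ?N * ?g j" for i j
  proof -
    have "(householder x ** M) $ i $ j = (householder x *v column j M) $ i"
      by (simp add: matrix_matrix_mult_def matrix_vector_mult_def column_def)
    then show ?thesis by (simp add: householder_mult hermitian_inner_def column_def)
  qed
  have "householder x *v (M *v x) = - (c *s x)" unfolding Mx using x by (simp add: vector_scalar_commute householder_self vec_eq_iff)
  then have HMx: "(\<Sum>l\<in>UNIV. (householder x ** M) $ i $ l * x $ l) = - c * x $ i" for i
    by (simp add: matrix_vector_mul_assoc vec_eq_iff) (simp add: matrix_vector_mult_def)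
  define B where "B = householder x ** M"
  have "(B ** householder x) $ i $ j
    = (\<Sum>l\<in>UNIV. (if l = j then B $ i $ l else 0) - 2 * cnj (x $ j) / ?N * (B $ i $ l * x $ l))"
    by (simp add: matrix_matrix_mult_def householder_def right_diff_distrib if_distrib[where f="\<lambda>c. _ * c"] ac_simps cong: if_cong)
  also have "\<dots> = B $ i $ j - 2 * cnj (x $ j) / ?N * (\<Sum>l\<in>UNIV. B $ i $ l * x $ l)"
    by (simp add: sum_subtractf sum_distrib_left)
  also have "\<dots> = M $ i $ j + 2 * x $ i / ?N * (c * cnj (x $ j) - ?g j)"
    unfolding B_def HMx unfolding HM using N by (simp add: field_simps)
  finally show ?thesis unfolding B_def .
qed

text \<open>Conjugation by the reflection and a change of the row both add a rank one matrix along
  the eigenvector; matching the entries outside column \<open>k\<close> yields the formula for the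
  reflected row.\<close>

lemma inflate_reflect:
  fixes k :: "'n::finite" and P Q Q' :: "complex^'n^'n"
  defines "g \<equiv> \<lambda>Q j. P $ k $ k * cnj (deflation_vec k P $ j) - (\<Sum>l\<in>UNIV. cnj (deflation_vec k P $ l) * inflate k Q $ l $ j)"
  assumes PQ: "leaf_eq k P Q" and PQ': "leaf_eq k P Q'"
    and row: "\<And>j. j \<noteq> k \<Longrightarrow> Q' $ k $ j = Q $ k $ j + 2 * g Q j / complex_of_real ((norm (deflation_vec k P))\<^sup>2)"
  shows "inflate k Q' = householder (deflation_vec k P) ** inflate k Q ** householder (deflation_vec k P)"
proof -
  let ?x = "deflation_vec k P" and ?M = "inflate k Q"
  let ?N = "complex_of_real ((norm ?x)\<^sup>2)"
  have x0: "?x \<noteq> 0" by (rule deflation_vec_nonzero)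
  have N: "?N \<noteq> 0" using x0 by simp
  have xQ: "deflation_vec k Q = ?x" using leaf_eq_deflation_vec[OF PQ] by simp
  have QQ': "leaf_eq k Q Q'" using PQ PQ' by (simp add: leaf_eq_def)
  have Mx: "?M *v ?x = P $ k $ k *s ?x"
    using inflate_deflation_vec[of k Q] PQ unfolding xQ by (simp add: leaf_eq_def)
  \<comment> \<open>The correcting row annihilates the eigenvector. This fixes its entry
    \<open>k\<close> in terms of the others, exactly as \<open>inflate_leaf\<close> prescribes for
    column \<open>k\<close>.\<close>
  have gx: "(\<Sum>j\<in>UNIV. g Q j * ?x $ j) = 0"
  proof -
    have "(\<Sum>j\<in>UNIV. (\<Sum>l\<in>UNIV. cnj (?x $ l) * ?M $ l $ j) * ?x $ j) = hermitian_inner ?x (?M *v ?x)"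
      unfolding hermitian_inner_def matrix_vector_mult_def sum_distrib_right
      by (subst sum.swap) (simp add: sum_distrib_left mult.assoc)
    moreover have "(\<Sum>j\<in>UNIV. P $ k $ k * cnj (?x $ j) * ?x $ j) = P $ k $ k * hermitian_inner ?x ?x"
      by (simp add: hermitian_inner_def sum_distrib_left mult.assoc)
    ultimately show ?thesis
      unfolding g_def by (simp add: left_diff_distrib sum_subtractf Mx hermitian_inner_scale_right)
  qed
  have Qcol: "Q $ l $ k = ?x $ l" if "l \<noteq> k" for l using that PQ by (simp add: leaf_eq_def deflation_vec_def)
  have "inflate k Q' $ i $ j = (householder ?x ** ?M ** householder ?x) $ i $ j" for i j
  proof (cases "j = k")
    case False
    then show ?thesis
      unfolding inflate_leaf[OF QQ'] xQ householder_conj[OF x0 Mx] using row[OF False] by (simp add: g_def)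
  next
    case True
    have "(\<Sum>l\<in>UNIV - {k}. (Q' $ k $ l - Q $ k $ l) * Q $ l $ k) = (\<Sum>l\<in>UNIV - {k}. 2 / ?N * (g Q l * ?x $ l))"
      by (intro sum.cong) (auto simp: row Qcol)
    also have "\<dots> = 2 / ?N * (\<Sum>l\<in>UNIV - {k}. g Q l * ?x $ l)" by (simp only: sum_distrib_left)
    also have "(\<Sum>l\<in>UNIV - {k}. g Q l * ?x $ l) = - g Q k"
      using gx by (simp add: sum.remove[of UNIV k] add_eq_0_iff)
    finally have "(\<Sum>l\<in>UNIV - {k}. (Q' $ k $ l - Q $ k $ l) * Q $ l $ k) = 2 / ?N * (- g Q k)" .
    moreover have "P $ k $ k * cnj (?x $ k) - (\<Sum>l\<in>UNIV. cnj (?x $ l) * ?M $ l $ k) = g Q k" by (simp add: g_def)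
    ultimately show ?thesis
      unfolding inflate_leaf[OF QQ'] xQ householder_conj[OF x0 Mx] True if_P[OF refl] by (simp only:) simp
  qed
  then show ?thesis by (simp add: vec_eq_iff)
qed

lemma continuous_on_inflate: "continuous_on S (inflate k)"
  by (rule has_derivative_continuous_on[where f'="inflate_deriv k"]) (rule has_derivative_inflate)

section \<open>Coordinates on a fibre and the Gaussian tail there\<close>

definition leaf_basis :: "'n \<Rightarrow> (complex^'n^'n) set" where
  "leaf_basis k = {b \<in> Basis. \<forall>i j. \<not> (i = k \<and> j \<noteq> k) \<longrightarrow> b $ i $ j = 0}"

lemma leaf_basis_sum:
  assumes "\<And>i j. \<not> (i = k \<and> j \<noteq> k) \<Longrightarrow> H $ i $ j = 0"
  shows "(\<Sum>b\<in>leaf_basis k. (H \<bullet> b) *\<^sub>R b) = H"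
proof -
  have "H \<bullet> b = 0" if b: "b \<in> Basis - leaf_basis k" for b
  proof -
    obtain i j c where b': "b = axis i (axis j c)" "c \<in> Basis" using b unfolding Basis_vec_def by auto
    have "\<not> (i = k \<and> j \<noteq> k)"
    proof
      assume "i = k \<and> j \<noteq> k"
      then have "b \<in> leaf_basis k" using b b' by (auto simp: leaf_basis_def axis_def)
      then show False using b by simp
    qed
    then show ?thesis using assms[of i j] by (simp add: b' inner_axis)
  qed
  then have "(\<Sum>b\<in>leaf_basis k. (H \<bullet> b) *\<^sub>R b) = (\<Sum>b\<in>Basis. (H \<bullet> b) *\<^sub>R b)"
    by (intro sum.mono_neutral_left) (auto simp: leaf_basis_def)
  then show ?thesis by (simp add: euclidean_representation)
qed

definition leaf_point :: "'n \<Rightarrow> complex^'n^'n \<Rightarrow> (complex^'n^'n \<Rightarrow> real) \<Rightarrow> complex^'n^'n" where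
  "leaf_point k Y h = Y + (\<Sum>b\<in>leaf_basis k. h b *\<^sub>R b)"

lemma leaf_point_eq: "leaf_eq k Y (leaf_point k Y h)"
  by (auto simp: leaf_eq_def leaf_point_def leaf_basis_def intro!: sum.neutral)

lemma finite_leaf_basis: "finite (leaf_basis k)"
  unfolding leaf_basis_def by (rule finite_subset[OF _ finite_Basis]) auto

lemma leaf_point_meas[measurable]: "leaf_point k Y \<in> borel_measurable (Pi\<^sub>M (leaf_basis k) (\<lambda>_. lborel))"
  unfolding leaf_point_def[abs_def] by measurable

lemma inflate_leaf_mid:
  fixes k :: "'n::finite"
  shows "inflate k (leaf_point k Y (\<lambda>b\<in>leaf_basis k. (f b + g b) / 2))
    = (1/2) *\<^sub>R (inflate k (leaf_point k Y f) + inflate k (leaf_point k Y g))"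
proof -
  define H where "H f = (\<Sum>b\<in>leaf_basis k. f b *\<^sub>R b)" for f :: "complex^'n^'n \<Rightarrow> real"
  have mid: "H (\<lambda>b\<in>leaf_basis k. (f b + g b) / 2) = (1/2) *\<^sub>R (H f + H g)"
  proof -
    have "H (\<lambda>b\<in>leaf_basis k. (f b + g b) / 2) = (\<Sum>b\<in>leaf_basis k. (1/2) *\<^sub>R (f b *\<^sub>R b + g b *\<^sub>R b))"
      unfolding H_def by (intro sum.cong refl) (simp add: scaleR_add_left[symmetric])
    then show ?thesis unfolding H_def by (simp only: scaleR_sum_right[symmetric] sum.distrib)
  qed
  have lp: "leaf_point k Y f = Y + H f" for f by (simp add: leaf_point_def H_def)
  have entry: "inflate k (leaf_point k Y f) $ i $ j = inflate k Y $ i $ j + deflation_vec k Y $ i *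
    (if j = k then - (\<Sum>l\<in>UNIV - {k}. H f $ k $ l * Y $ l $ k) else H f $ k $ j)" for f i j
    unfolding inflate_leaf[OF leaf_point_eq] by (simp add: lp)
  have m: "H (\<lambda>b\<in>leaf_basis k. (f b + g b) / 2) $ i $ j = (H f $ i $ j + H g $ i $ j) / 2" for i j
    unfolding mid vector_scaleR_component vector_add_component by (simp add: scaleR_conv_of_real)
  show ?thesis
    unfolding vec_eq_iff scaleR_entry vector_add_component entry m
    by (auto simp: sum_divide_distrib[symmetric] sum.distrib distrib_right field_simps)
qed

text \<open>The functional \<open>T\<close> is a matrix entry between unit vectors, so |T A| \<le>
  |A| and |A|^2 - |T A|^2 is a nonnegative quadratic form, hence convex. Splitting off a |t|^2
  therefore leaves a convex \<Gamma>. The reflection in \<open>x\<close> preserves the norm and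
  \<Psi>, while it fixes \<open>u\<close> and negates \<open>x\<close>, so it changes the sign of
  t.\<close>

lemma leaf_tail:
  fixes k :: "'n::finite" and Y :: "complex^'n^'n" and u :: "complex^'n" and \<Psi> :: "complex^'n^'n \<Rightarrow> real"
    and a w :: real
  defines "x \<equiv> deflation_vec k Y"
  defines "t \<equiv> \<lambda>h. hermitian_inner x (inflate k (leaf_point k Y h) *v u) / complex_of_real (norm x * norm u)"
  defines "W \<equiv> \<lambda>h. exp (- a * (norm (inflate k (leaf_point k Y h)))\<^sup>2 - \<Psi> (inflate k (leaf_point k Y h)))"
  assumes xu: "hermitian_inner x u = 0" and u: "u \<noteq> 0"
    and conv: "convex_on UNIV \<Psi>" and inv: "\<And>D M. unitary_matrix D \<Longrightarrow> \<Psi> (D ** M ** D) = \<Psi> M"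
    and a: "a > 0" and w: "w > 0"
  shows "(\<integral>\<^sup>+h. indicator {w..} ((cmod (t h))\<^sup>2) * ennreal (W h) \<partial>Pi\<^sub>M (leaf_basis k) (\<lambda>_. lborel))
    \<le> ennreal (exp (- a * w)) * (\<integral>\<^sup>+h. ennreal (W h) \<partial>Pi\<^sub>M (leaf_basis k) (\<lambda>_. lborel))"
proof -
  let ?I = "leaf_basis k"
  have x0: "x \<noteq> 0" unfolding x_def by (rule deflation_vec_nonzero)
  define M where "M h = inflate k (leaf_point k Y h)" for h
  define T where "T A = hermitian_inner x (A *v u) / complex_of_real (norm x * norm u)" for A
  have tT: "t h = T (M h)" for h by (simp add: t_def T_def M_def)
  define \<Gamma> where "\<Gamma> h = a * ((norm (M h))\<^sup>2 - (cmod (T (M h)))\<^sup>2) + \<Psi> (M h)" for h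
  define N where "N = complex_of_real ((norm x)\<^sup>2)"
  have N0: "N \<noteq> 0" using x0 by (simp add: N_def)
  define G where "G Q j = Y $ k $ k * cnj (x $ j) - (\<Sum>l\<in>UNIV. cnj (x $ l) * inflate k Q $ l $ j)" for Q j
  \<comment> \<open>The reflection moves a row by 2 G / N, and moving the row by H lowers G by N H.
    Its fixed point is thus displaced from \<open>Y\<close> by G / N, and \<open>c\<close> lists the
    coordinates of that displacement.\<close>
  define H0 where "H0 = (\<chi> i j. if i = k \<and> j \<noteq> k then G Y j / N else 0)"
  define c where "c b = H0 \<bullet> b" for b
  have linT: "T (r *\<^sub>R (A + B)) = complex_of_real r * (T A + T B)" for r A B
  proof -
    have "(r *\<^sub>R (A + B)) *v u = complex_of_real r *s (A *v u + B *v u)"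
      by (simp add: vec_eq_iff matrix_vector_mult_def scaleR_conv_of_real[where 'a=complex] sum_distrib_left sum.distrib algebra_simps)
    then show ?thesis
      by (simp add: T_def hermitian_inner_scale_right hermitian_inner_add_right add_divide_distrib distrib_left)
  qed
  have linT': "T (r *\<^sub>R (A - B)) = complex_of_real r * (T A - T B)" for r A B
    using linT[of r A "- B"] linT[of "-1" B 0] linT[of 0 0 0] by simp
  have T_le: "cmod (T A) \<le> norm A" for A
  proof -
    have "cmod (hermitian_inner x (A *v u)) \<le> norm x * (norm A * norm u)"
      using hermitian_Cauchy_Schwarz[of x "A *v u"] mult_left_mono[OF norm_matrix_vector_le[of A u], of "norm x"] by simp
    then show ?thesis using x0 u by (simp add: T_def norm_divide norm_mult divide_le_eq ac_simps)
  qed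
  have quad: "(norm ((1/2) *\<^sub>R (A + B)))\<^sup>2 - (cmod (T ((1/2) *\<^sub>R (A + B))))\<^sup>2
    \<le> (((norm A)\<^sup>2 - (cmod (T A))\<^sup>2) + ((norm B)\<^sup>2 - (cmod (T B))\<^sup>2)) / 2" for A B
  proof -
    \<comment> \<open>The parallelogram law, applied to both squared norms: the defect in midpoint
      convexity is the quadratic form at half the difference.\<close>
    have par: "(norm ((1/2) *\<^sub>R (p + q)))\<^sup>2 = ((norm p)\<^sup>2 + (norm q)\<^sup>2) / 2 - (norm ((1/2) *\<^sub>R (p - q)))\<^sup>2"
      for p q :: "'b::real_inner"
      by (simp add: power2_norm_eq_inner inner_add_left inner_add_right inner_diff_left inner_diff_right inner_commute field_simps)
    have e1: "T ((1/2) *\<^sub>R (A + B)) = (1/2) *\<^sub>R (T A + T B)" and e2: "T ((1/2) *\<^sub>R (A - B)) = (1/2) *\<^sub>R (T A - T B)"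
      unfolding linT linT' by (simp_all add: scaleR_conv_of_real)
    have "(cmod (T ((1/2) *\<^sub>R (A - B))))\<^sup>2 \<le> (norm ((1/2) *\<^sub>R (A - B)))\<^sup>2"
      by (intro power_mono T_le) simp
    then show ?thesis unfolding e1 e2 par[of "T A" "T B"] par[of A B] by (simp add: field_simps)
  qed
  have mid: "M (\<lambda>b\<in>?I. (f b + g b) / 2) = (1/2) *\<^sub>R (M f + M g)" for f g
    unfolding M_def by (rule inflate_leaf_mid)
  have refl: "M (\<lambda>b\<in>?I. 2 * c b - f b) = householder x ** M f ** householder x" for f
    unfolding M_def x_def
  proof (rule inflate_reflect[OF leaf_point_eq leaf_point_eq])
    fix j assume j: "j \<noteq> k"
    define H where "H = (\<Sum>b\<in>?I. f b *\<^sub>R b)"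
    have sumc: "(\<Sum>b\<in>?I. c b *\<^sub>R b) = H0" unfolding c_def by (rule leaf_basis_sum) (auto simp: H0_def)
    have "(\<Sum>b\<in>?I. (2 * c b) *\<^sub>R b) = 2 *\<^sub>R H0" unfolding sumc[symmetric] by (simp add: scaleR_sum_right)
    then have "leaf_point k Y (\<lambda>b\<in>?I. 2 * c b - f b) = Y + 2 *\<^sub>R H0 - H"
      unfolding leaf_point_def H_def by (simp add: scaleR_diff_left sum_subtractf)
    then have lhs: "leaf_point k Y (\<lambda>b\<in>?I. 2 * c b - f b) $ k $ j = Y $ k $ j + 2 * (G Y j / N) - H $ k $ j"
      using j by (simp add: H0_def scaleR_conv_of_real)
    have fj: "leaf_point k Y f $ k $ j = Y $ k $ j + H $ k $ j" by (simp add: leaf_point_def H_def)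
    have "(\<Sum>l\<in>UNIV. cnj (x $ l) * inflate k (leaf_point k Y f) $ l $ j)
      = (\<Sum>l\<in>UNIV. cnj (x $ l) * inflate k Y $ l $ j) + (\<Sum>l\<in>UNIV. cnj (x $ l) * x $ l) * H $ k $ j"
      unfolding inflate_leaf[OF leaf_point_eq] using j
      by (simp add: x_def fj distrib_left sum.distrib sum_distrib_right mult.assoc)
    also have "(\<Sum>l\<in>UNIV. cnj (x $ l) * x $ l) = N" unfolding N_def hermitian_inner_self[symmetric] by (simp add: hermitian_inner_def)
    finally have GY: "G Y j = G (leaf_point k Y f) j + N * H $ k $ j" unfolding G_def by simp
    have "leaf_point k Y (\<lambda>b\<in>?I. 2 * c b - f b) $ k $ j = leaf_point k Y f $ k $ j + 2 * G (leaf_point k Y f) j / N"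
      unfolding lhs fj GY using N0 by (simp add: field_simps)
    then show "leaf_point k Y (\<lambda>b\<in>?I. 2 * c b - f b) $ k $ j = leaf_point k Y f $ k $ j +
       2 * (Y $ k $ k * cnj (deflation_vec k Y $ j) - (\<Sum>l\<in>UNIV. cnj (deflation_vec k Y $ l) * inflate k (leaf_point k Y f) $ l $ j))
       / complex_of_real ((norm (deflation_vec k Y))\<^sup>2)"
      unfolding G_def N_def x_def .
  qed
  have T_refl: "T (householder x ** A ** householder x) = - T A" for A
  proof -
    have "(householder x ** A ** householder x) *v u = householder x *v (A *v (householder x *v u))"
      by (simp add: matrix_vector_mul_assoc matrix_mul_assoc)
    also have "householder x *v u = u" by (simp add: householder_mult xu)
    finally have "hermitian_inner x ((householder x ** A ** householder x) *v u) = hermitian_inner (householder x *v x) (A *v u)"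
      by (simp add: hermitian_inner_matrix_right ctranspose_householder)
    also have "\<dots> = - hermitian_inner x (A *v u)"
      using hermitian_inner_diff_left[of 0 x "A *v u"] by (simp add: householder_self[OF x0])
    finally show ?thesis by (simp add: T_def)
  qed
  have unit: "unitary_matrix (householder x)" by (rule unitary_householder[OF x0])
  have contT: "continuous_on UNIV T"
  proof -
    have "continuous_on UNIV (\<lambda>A. hermitian_inner x (A *v u))"
      unfolding hermitian_inner_def matrix_vector_mult_def by (simp, intro continuous_intros)
    then show ?thesis unfolding T_def using x0 u by (intro continuous_on_divide continuous_intros) auto
  qed
  have [measurable]: "T \<in> borel_measurable borel" "\<Psi> \<in> borel_measurable borel"
    by (intro borel_measurable_continuous_onI contT convex_on_continuous[OF open_UNIV conv])+
  have [measurable]: "inflate k \<in> borel_measurable borel"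
    by (intro borel_measurable_continuous_onI continuous_on_inflate)
  have [measurable]: "M \<in> borel_measurable (Pi\<^sub>M ?I (\<lambda>_. lborel))" unfolding M_def[abs_def] by measurable
  interpret even_log_concave ?I \<Gamma> "\<lambda>h. T (M h)" c
  proof
    show "finite ?I" by (rule finite_leaf_basis)
    show "\<Gamma> \<in> borel_measurable (Pi\<^sub>M ?I (\<lambda>_. lborel))" unfolding \<Gamma>_def[abs_def] by measurable
    show "(\<lambda>h. T (M h)) \<in> borel_measurable (Pi\<^sub>M ?I (\<lambda>_. lborel))" by measurable
  next
    fix f g :: "complex^'n^'n \<Rightarrow> real"
    have "\<Psi> ((1/2) *\<^sub>R (M f + M g)) \<le> (\<Psi> (M f) + \<Psi> (M g)) / 2"
      using convex_onD[OF conv, of "1/2" "M f" "M g"] by (simp add: scaleR_add_right)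
    moreover have "a * ((norm ((1/2) *\<^sub>R (M f + M g)))\<^sup>2 - (cmod (T ((1/2) *\<^sub>R (M f + M g))))\<^sup>2)
      \<le> a * ((((norm (M f))\<^sup>2 - (cmod (T (M f)))\<^sup>2) + ((norm (M g))\<^sup>2 - (cmod (T (M g)))\<^sup>2)) / 2)"
      using a by (intro mult_left_mono quad) auto
    ultimately show "\<Gamma> (\<lambda>b\<in>?I. (f b + g b) / 2) \<le> (\<Gamma> f + \<Gamma> g) / 2"
      unfolding \<Gamma>_def mid by (simp add: field_simps)
    show "T (M (\<lambda>b\<in>?I. (f b + g b) / 2)) = (T (M f) + T (M g)) / 2" unfolding mid linT by simp
    show "T (M (\<lambda>b\<in>?I. 2 * c b - f b)) = - T (M f)" unfolding refl by (rule T_refl)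
    show "\<Gamma> (\<lambda>b\<in>?I. 2 * c b - f b) = \<Gamma> f"
      unfolding \<Gamma>_def refl T_refl inv[OF unit] norm_unitary_conj[OF unit unit] by simp
  qed
  have WE: "W h = exp (- a * (cmod (T (M h)))\<^sup>2 - \<Gamma> h)" for h
    by (simp add: W_def \<Gamma>_def M_def algebra_simps)
  show ?thesis unfolding tT WE by (rule gaussian_tail[OF a w])
qed

section \<open>The event in deflated coordinates\<close>

text \<open>An open set is a countable union of compact boxes; intersected with \<open>C\<close>
  they stay compact, and so do their projections. Sets defined by the existence of an eigenpair
  become Borel in this way.\<close>

lemma borel_fst_image:
  fixes U C :: "('a::euclidean_space \<times> 'b::euclidean_space) set"
  assumes U: "open U" and C: "closed C"
  shows "fst ` (U \<inter> C) \<in> sets borel"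
proof -
  obtain D where D: "countable D" "\<And>X. X \<in> D \<Longrightarrow> \<exists>a b. X = cbox a b" "\<Union>D = U"
    using open_countable_Union_open_cbox[OF U] by metis
  have "fst ` (X \<inter> C) \<in> sets borel" if "X \<in> D" for X
  proof -
    from D(2)[OF that] obtain a b where X: "X = cbox a b" by blast
    have "compact (X \<inter> C)" unfolding X using C by (intro compact_Int_closed compact_cbox)
    then have "compact (fst ` (X \<inter> C))"
      by (rule compact_continuous_image[rotated]) (intro continuous_intros)
    then show ?thesis by (rule borel_compact)
  qed
  then have "(\<Union>X\<in>D. fst ` (X \<inter> C)) \<in> sets borel" using D(1) by (intro sets.countable_UN') auto
  moreover have "(\<Union>X\<in>D. fst ` (X \<inter> C)) = fst ` (U \<inter> C)" unfolding D(3)[symmetric] by blast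
  ultimately show ?thesis by simp
qed

section \<open>Finiteness of the spectrum\<close>

lemma eigenvectors_independent:
  fixes A :: "complex^'n^'n" and e :: "complex \<Rightarrow> complex^'n"
  assumes "finite F" and "\<And>\<mu>. \<mu> \<in> F \<Longrightarrow> A *v e \<mu> = \<mu> *s e \<mu>" and "\<And>\<mu>. \<mu> \<in> F \<Longrightarrow> e \<mu> \<noteq> 0"
    and "(\<Sum>\<mu>\<in>F. c \<mu> *s e \<mu>) = 0" and "\<mu> \<in> F"
  shows "c \<mu> = 0"
  using assms
proof (induction F arbitrary: c \<mu> rule: finite_induct)
  case (insert \<nu> F)
  have lin: "A *v (\<Sum>k\<in>K. g k) = (\<Sum>k\<in>K. A *v g k)" for g :: "complex \<Rightarrow> complex^'n" and K
    by (rule linear_sum[OF matrix_vector_mul_linear])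
  have "(\<Sum>\<mu>\<in>insert \<nu> F. (c \<mu> * \<mu>) *s e \<mu>) = A *v (\<Sum>\<mu>\<in>insert \<nu> F. c \<mu> *s e \<mu>)"
    unfolding lin using insert.prems(1) by (intro sum.cong) (auto simp: vector_scalar_commute vector_smult_assoc)
  also have "\<dots> = 0" unfolding insert.prems(3) by simp
  finally have 1: "(\<Sum>\<mu>\<in>insert \<nu> F. (c \<mu> * \<mu>) *s e \<mu>) = 0" .
  have 2: "(\<Sum>\<mu>\<in>insert \<nu> F. (c \<mu> * \<nu>) *s e \<mu>) = \<nu> *s (\<Sum>\<mu>\<in>insert \<nu> F. c \<mu> *s e \<mu>)"
    by (simp add: vec_eq_iff sum_distrib_left algebra_simps insert.hyps)
  have "(\<Sum>\<mu>\<in>insert \<nu> F. (c \<mu> * (\<mu> - \<nu>)) *s e \<mu>)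
    = (\<Sum>\<mu>\<in>insert \<nu> F. (c \<mu> * \<mu>) *s e \<mu>) - (\<Sum>\<mu>\<in>insert \<nu> F. (c \<mu> * \<nu>) *s e \<mu>)"
    by (simp only: sum_subtractf[symmetric]) (simp add: right_diff_distrib vec_eq_iff left_diff_distrib)
  also have "\<dots> = 0" unfolding 1 2 insert.prems(3) by simp
  finally have F0: "(\<Sum>\<mu>\<in>F. (c \<mu> * (\<mu> - \<nu>)) *s e \<mu>) = 0"
    using insert.hyps by simp
  have cF: "c \<mu>' = 0" if "\<mu>' \<in> F" for \<mu>'
  proof -
    have "c \<mu>' * (\<mu>' - \<nu>) = 0"
      using insert.IH[of "\<lambda>\<mu>. c \<mu> * (\<mu> - \<nu>)", OF _ _ F0 that] insert.prems(1,2) by auto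
    then show ?thesis using that insert.hyps by auto
  qed
  then have "(\<Sum>\<mu>\<in>F. c \<mu> *s e \<mu>) = 0" by (intro sum.neutral) auto
  then have "c \<nu> *s e \<nu> = 0" using insert.prems(3) insert.hyps by simp
  then have "c \<nu> = 0" using insert.prems(2)[of \<nu>] by simp
  then show ?case using cF insert.prems(4) by auto
qed simp

lemma finite_spectrum: "finite (spectrum (A :: complex^'n^'n))"
proof (rule ccontr)
  assume "infinite (spectrum A)"
  then obtain F where F: "finite F" "card F = Suc (DIM(complex^'n))" "F \<subseteq> spectrum A"
    by (meson infinite_arbitrarily_large)
  have "\<forall>\<mu>\<in>F. \<exists>v. A *v v = \<mu> *s v \<and> v \<noteq> 0" using F(3) by (auto simp: spectrum_def)
  then obtain e where e: "\<And>\<mu>. \<mu> \<in> F \<Longrightarrow> A *v e \<mu> = \<mu> *s e \<mu>" "\<And>\<mu>. \<mu> \<in> F \<Longrightarrow> e \<mu> \<noteq> 0" by metis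
  have inj: "inj_on e F"
  proof (rule inj_onI)
    fix \<mu> \<nu> assume h: "\<mu> \<in> F" "\<nu> \<in> F" "e \<mu> = e \<nu>"
    then have "\<mu> *s e \<mu> = \<nu> *s e \<mu>" using e(1) by metis
    then show "\<mu> = \<nu>" using e(2)[OF h(1)] by simp
  qed
  have "independent (e ` F)"
  proof (rule independent_if_scalars_zero)
    fix f x assume 0: "(\<Sum>x\<in>e ` F. f x *\<^sub>R x) = 0" and x: "x \<in> e ` F"
    obtain \<mu> where \<mu>: "\<mu> \<in> F" "x = e \<mu>" using x by blast
    have "(\<Sum>\<mu>\<in>F. complex_of_real (f (e \<mu>)) *s e \<mu>) = 0"
      using 0 by (simp add: sum.reindex[OF inj] complex_of_real_scale_vec)
    from eigenvectors_independent[OF F(1) e this \<mu>(1)] show "f x = 0" by (simp add: \<mu>(2))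
  qed (use F in simp)
  then have "card (e ` F) \<le> DIM(complex^'n)" using independent_bound by blast
  then show False using F(2) card_image[OF inj] by simp
qed

text \<open>The closed half of \<open>block_eigenpair\<close>. The remaining condition that
  \<open>w\<close> be nonzero is open, which suits \<open>borel_fst_image\<close>.\<close>

definition block_equation :: "'n \<Rightarrow> complex^'n^'n \<Rightarrow> complex \<Rightarrow> complex^'n \<Rightarrow> bool" where
  "block_equation k P \<mu> w \<longleftrightarrow> w $ k = 0 \<and> (\<forall>i. i \<noteq> k \<longrightarrow> (P *v w) $ i = \<mu> * w $ i)"

lemma block_eigenpair_iff: "block_eigenpair k P \<mu> w \<longleftrightarrow> w \<noteq> 0 \<and> block_equation k P \<mu> w"
  by (simp add: block_eigenpair_def block_equation_def)

lemma finite_block_eigenvalues: "finite {\<mu>. \<exists>w. block_eigenpair k P \<mu> w}"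
proof (rule finite_subset[OF _ finite_spectrum])
  \<comment> \<open>Clearing row \<open>k\<close> turns block eigenvectors, whose entry
    \<open>k\<close> is 0, into ordinary eigenvectors.\<close>
  show "{\<mu>. \<exists>w. block_eigenpair k P \<mu> w} \<subseteq> spectrum (\<chi> i j. if i = k then 0 else P $ i $ j)"
  proof
    fix \<mu> assume "\<mu> \<in> {\<mu>. \<exists>w. block_eigenpair k P \<mu> w}"
    then obtain w where w: "block_eigenpair k P \<mu> w" by blast
    have "((\<chi> i j. if i = k then 0 else P $ i $ j) *v w) $ i = (\<mu> *s w) $ i" for i
      using w by (cases "i = k") (auto simp: block_eigenpair_def matrix_vector_mult_def)
    then show "\<mu> \<in> spectrum (\<chi> i j. if i = k then 0 else P $ i $ j)"
      using w unfolding spectrum_def by (auto simp: vec_eq_iff block_eigenpair_def)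
  qed
qed

section \<open>Continuity and measurability in deflated coordinates\<close>

lemma continuous_on_matrix_vector_mult [continuous_intros]:
  fixes f :: "'a::topological_space \<Rightarrow> complex^'n^'n"
  shows "continuous_on S f \<Longrightarrow> continuous_on S g \<Longrightarrow> continuous_on S (\<lambda>x. f x *v g x)"
  unfolding matrix_vector_mult_def by (intro continuous_intros)

lemma continuous_on_vector_scalar_mult [continuous_intros]:
  fixes f :: "'a::topological_space \<Rightarrow> complex"
  shows "continuous_on S f \<Longrightarrow> continuous_on S g \<Longrightarrow> continuous_on S (\<lambda>x. f x *s g x)"
  unfolding vector_scalar_mult_def by (intro continuous_intros)

lemma continuous_on_hermitian_inner [continuous_intros]:
  fixes f :: "'a::topological_space \<Rightarrow> complex^'n"
  shows "continuous_on S f \<Longrightarrow> continuous_on S g \<Longrightarrow> continuous_on S (\<lambda>x. hermitian_inner (f x) (g x))"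
  unfolding hermitian_inner_def by (intro continuous_intros)

lemma continuous_on_deflation_vec [continuous_intros]:
  fixes f :: "'a::topological_space \<Rightarrow> complex^'n^'n"
  assumes "continuous_on S f"
  shows "continuous_on S (\<lambda>x. deflation_vec k (f x))"
proof -
  have "continuous_on S (\<lambda>x. if i = k then 1 else f x $ i $ k)" for i
    using assms by (cases "i = k") (auto intro!: continuous_intros)
  then show ?thesis unfolding deflation_vec_def by (intro continuous_on_vec_lambda)
qed

lemma continuous_on_inflate_compose [continuous_intros]:
  fixes f :: "'a::topological_space \<Rightarrow> complex^'n^'n"
  shows "continuous_on S f \<Longrightarrow> continuous_on S (\<lambda>x. inflate k (f x))"
  by (rule continuous_on_compose2[OF continuous_on_inflate[of UNIV]]) auto

lemma closed_block_equation:
  fixes P :: "'a::topological_space \<Rightarrow> complex^'n^'n"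
  assumes "continuous_on UNIV P" "continuous_on UNIV \<mu>" "continuous_on UNIV w"
  shows "closed {p. block_equation k (P p) (\<mu> p) (w p)}"
  unfolding block_equation_def using assms
  by (intro closed_Collect_conj closed_Collect_all closed_Collect_imp open_Collect_const closed_Collect_eq continuous_intros)

lemma open_Collect_nonzero:
  fixes f :: "'a::topological_space \<Rightarrow> 'b::t2_space"
  assumes "continuous_on UNIV f" "continuous_on UNIV g"
  shows "open {x. f x \<noteq> g x}"
  using closed_Collect_eq[OF assms] by (simp add: closed_def Collect_neg_eq[symmetric])

lemma borel_closest_block:
  fixes k :: "'n::finite"
  shows "closest_block k z \<in> sets borel"
proof -
  let ?U = "{p :: (complex^'n^'n) \<times> complex \<times> (complex^'n). snd (snd p) \<noteq> 0}"
  let ?C = "{p. block_equation k (fst p) (fst (snd p)) (snd (snd p))} \<inter>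
    {p :: (complex^'n^'n) \<times> complex \<times> (complex^'n). cmod (fst (snd p) - z) \<le> cmod (fst p $ k $ k - z)}"
  have "open ?U" by (intro open_Collect_nonzero continuous_intros)
  moreover have "closed ?C"
    by (intro closed_Int closed_block_equation closed_Collect_le continuous_intros)
  ultimately have "fst ` (?U \<inter> ?C) \<in> sets borel" by (rule borel_fst_image)
  moreover have "- closest_block k z = fst ` (?U \<inter> ?C)"
    unfolding closest_block_def block_eigenpair_iff Compl_iff set_eq_iff image_iff mem_Collect_eq Int_iff Bex_def split_paired_Ex fst_conv snd_conv not_all not_imp not_less
    by blast
  ultimately have "- (- closest_block k z) \<in> sets borel" by (simp only: borel_comp)
  then show ?thesis by simp
qed

section \<open>Ties and other exceptional matrices\<close>

definition tie_block :: "'n \<Rightarrow> complex \<Rightarrow> (complex^'n^'n) set" where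
  "tie_block k z = {P. \<exists>\<mu> w. block_eigenpair k P \<mu> w \<and> cmod (P $ k $ k - z) = cmod (\<mu> - z)}"

lemma borel_tie_block:
  fixes k :: "'n::finite"
  shows "tie_block k z \<in> sets borel"
proof -
  let ?U = "{p :: (complex^'n^'n) \<times> complex \<times> (complex^'n). snd (snd p) \<noteq> 0}"
  let ?C = "{p. block_equation k (fst p) (fst (snd p)) (snd (snd p))} \<inter>
    {p :: (complex^'n^'n) \<times> complex \<times> (complex^'n). cmod (fst p $ k $ k - z) = cmod (fst (snd p) - z)}"
  have "open ?U" by (intro open_Collect_nonzero continuous_intros)
  moreover have "closed ?C"
    by (intro closed_Int closed_block_equation closed_Collect_eq continuous_intros)
  ultimately have "fst ` (?U \<inter> ?C) \<in> sets borel" by (rule borel_fst_image)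
  moreover have "tie_block k z = fst ` (?U \<inter> ?C)"
    unfolding tie_block_def block_eigenpair_iff set_eq_iff image_iff mem_Collect_eq Int_iff Bex_def split_paired_Ex fst_conv snd_conv by blast
  ultimately show ?thesis by simp
qed

lemma finite_line_circle: "finite {s::real. cmod (d + complex_of_real s) = r}"
proof (rule finite_subset)
  show "{s::real. cmod (d + complex_of_real s) = r} \<subseteq> {sqrt (r\<^sup>2 - (Im d)\<^sup>2) - Re d, - sqrt (r\<^sup>2 - (Im d)\<^sup>2) - Re d}"
  proof
    fix s :: real assume "s \<in> {s. cmod (d + complex_of_real s) = r}"
    then have "(Re d + s)\<^sup>2 + (Im d)\<^sup>2 = r\<^sup>2" using cmod_power2[of "d + complex_of_real s"] by auto
    then have "(Re d + s)\<^sup>2 = r\<^sup>2 - (Im d)\<^sup>2" by simp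
    then have "\<bar>Re d + s\<bar> = sqrt (r\<^sup>2 - (Im d)\<^sup>2)" by (metis real_sqrt_abs)
    then show "s \<in> {sqrt (r\<^sup>2 - (Im d)\<^sup>2) - Re d, - sqrt (r\<^sup>2 - (Im d)\<^sup>2) - Re d}" by (auto simp: abs_if split: if_splits)
  qed
qed simp

text \<open>Moving the diagonal entry \<open>k\<close> along the real direction leaves the block
  alone. The line meets each circle about \<open>z\<close> through one of the finitely many block
  eigenvalues in at most two points.\<close>

lemma negligible_tie_block: "negligible (tie_block k z :: (complex^'n^'n) set)"
proof (rule negligible_line_slices[OF borel_tie_block])
  let ?b = "axis k (axis k 1) :: complex^'n^'n"
  show "?b \<in> Basis" by (simp add: axis_in_Basis_iff)
  fix P :: "complex^'n^'n"
  have entry: "(P + s *\<^sub>R ?b) $ i $ j = P $ i $ j + (if i = k \<and> j = k then complex_of_real s else 0)" for s i j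
    by (simp add: axis_def scaleR_conv_of_real[where 'a=complex])
  have "((P + s *\<^sub>R ?b) *v w) $ i = (P *v w) $ i" if "i \<noteq> k" for s w i
    unfolding matrix_vector_mult_def using that by (simp add: axis_def)
  then have same: "block_eigenpair k (P + s *\<^sub>R ?b) = block_eigenpair k P" for s
    unfolding block_eigenpair_def fun_eq_iff by auto
  have "{s. P + s *\<^sub>R ?b \<in> tie_block k z} \<subseteq>
    (\<Union>\<mu>\<in>{\<mu>. \<exists>w. block_eigenpair k P \<mu> w}. {s. cmod ((P $ k $ k - z) + complex_of_real s) = cmod (\<mu> - z)})"
    unfolding tie_block_def mem_Collect_eq same entry by (auto simp: algebra_simps)
  then show "countable {s. P + s *\<^sub>R ?b \<in> tie_block k z}"
    by (rule countable_subset) (intro countable_finite finite_UN_I finite_block_eigenvalues finite_line_circle)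
qed

text \<open>The first two unions collect ties at \<open>z\<close> or \<open>z'\<close>, repeated
  eigenvalues of the block and the deflated vector included, with the eigenvector normalised at any
  coordinate \<open>j\<close>. In the third, column \<open>j\<close> holds the eigenvector, so its
  entry \<open>k\<close> is 0 and it cannot be normalised at \<open>k\<close>. All of this is null,
  as differentiable images of null sets are null.\<close>

definition exceptional :: "'n \<Rightarrow> complex \<Rightarrow> complex \<Rightarrow> (complex^'n^'n) set" where
  "exceptional k z z' = (\<Union>j. inflate j ` tie_block j z) \<union> (\<Union>j. inflate j ` tie_block j z')
     \<union> (\<Union>j\<in>-{k}. inflate j ` {P. P $ k $ j = 0})"

lemma negligible_inflate: "negligible S \<Longrightarrow> negligible (inflate k ` S)"
  by (rule negligible_differentiable_image_negligible)
    (auto simp: differentiable_on_def differentiable_def intro: has_derivative_inflate)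

lemma negligible_exceptional: "negligible (exceptional k z z' :: (complex^'n^'n) set)"
proof -
  have "negligible {P :: complex^'n^'n. P $ k $ j = 0}" for j
  proof (rule negligible_subset)
    show "negligible {P :: complex^'n^'n. P \<bullet> axis k (axis j 1) = 0}"
      by (rule negligible_standard_hyperplane) (simp add: axis_in_Basis_iff)
  qed (auto simp: inner_axis)
  then show ?thesis
    unfolding exceptional_def
    by (intro negligible_Un negligible_Union_nat negligible_countable_Union negligible_Union negligible_inflate negligible_tie_block finite_imageI) (auto intro: negligible_inflate negligible_tie_block)
qed


text \<open>The component of \<open>w\<close> orthogonal to the eigenvector, scaled so as to be polynomial in \<open>P\<close> and \<open>w\<close>.\<close>

definition schur_vec :: "'n \<Rightarrow> complex^'n^'n \<Rightarrow> complex^'n \<Rightarrow> complex^'n" where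
  "schur_vec k P w = (let x = deflation_vec k P in complex_of_real ((norm x)\<^sup>2) *s w - hermitian_inner x w *s x)"

text \<open>The inequality \<delta> \<le> n |t|^2 for t = <x, M u> / (|x| |u|), with x the deflated
  eigenvector and u the Schur vector. Clearing the denominators makes it a closed condition on
  \<open>P\<close> and \<open>w\<close>.\<close>

definition large_corner :: "'n \<Rightarrow> real \<Rightarrow> complex^'n^'n \<Rightarrow> complex^'n \<Rightarrow> bool" where
  "large_corner k \<delta> P w \<longleftrightarrow> \<delta> * ((norm (deflation_vec k P))\<^sup>2 * (norm (schur_vec k P w))\<^sup>2)
     \<le> real CARD('n) * (cmod (hermitian_inner (deflation_vec k P) (inflate k P *v schur_vec k P w)))\<^sup>2"

lemma continuous_on_schur_vec [continuous_intros]: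
  fixes f :: "'a::topological_space \<Rightarrow> complex^'n^'n"
  assumes "continuous_on S f" "continuous_on S g"
  shows "continuous_on S (\<lambda>x. schur_vec k (f x) (g x))"
  unfolding schur_vec_def Let_def by (intro continuous_intros assms)

definition event_in :: "'n \<Rightarrow> complex \<Rightarrow> real \<Rightarrow> real \<Rightarrow> (complex^'n^'n) set" where
  "event_in k z \<delta> q = {P. \<exists>\<mu> w. block_eigenpair k P \<mu> w \<and> cmod (\<mu> - z) < q \<and> large_corner k \<delta> P w}"

text \<open>The disc contains block eigenvalues with two eigenvectors that are not parallel.
  Nonvanishing of a two by two minor expresses this as an open condition.\<close>

definition ambiguous :: "'n \<Rightarrow> complex \<Rightarrow> real \<Rightarrow> (complex^'n^'n) set" where
  "ambiguous k z q = {P. \<exists>\<mu> w \<nu> u. block_eigenpair k P \<mu> w \<and> block_eigenpair k P \<nu> u \<and>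
     cmod (\<mu> - z) < q \<and> cmod (\<nu> - z) < q \<and> (\<exists>i j. w $ i * u $ j \<noteq> w $ j * u $ i)}"

text \<open>The eigenvalue closest to \<open>z\<close> of the block is isolated by a disc of rational radius, which
  keeps the event Borel.\<close>

definition event :: "'n \<Rightarrow> complex \<Rightarrow> complex \<Rightarrow> real \<Rightarrow> (complex^'n^'n) set" where
  "event k z z' \<delta> = closest_block k z \<inter> (\<Union>q\<in>\<rat>. event_in k z' \<delta> q - ambiguous k z' q)"

lemma borel_event_in:
  fixes k :: "'n::finite"
  shows "event_in k z \<delta> q \<in> sets borel"
proof -
  let ?U = "{p :: (complex^'n^'n) \<times> complex \<times> (complex^'n). snd (snd p) \<noteq> 0} \<inter> {p. cmod (fst (snd p) - z) < q}"
  let ?C = "{p. block_equation k (fst p) (fst (snd p)) (snd (snd p))} \<inter>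
    {p :: (complex^'n^'n) \<times> complex \<times> (complex^'n). large_corner k \<delta> (fst p) (snd (snd p))}"
  have "open ?U" by (intro open_Int open_Collect_nonzero open_Collect_less continuous_intros)
  moreover have "closed ?C"
    unfolding large_corner_def by (intro closed_Int closed_block_equation closed_Collect_le continuous_intros)
  ultimately have "fst ` (?U \<inter> ?C) \<in> sets borel" by (rule borel_fst_image)
  moreover have "event_in k z \<delta> q = fst ` (?U \<inter> ?C)"
    unfolding event_in_def block_eigenpair_iff set_eq_iff image_iff mem_Collect_eq Int_iff Bex_def split_paired_Ex fst_conv snd_conv by blast
  ultimately show ?thesis by simp
qed

lemma borel_ambiguous:
  fixes k :: "'n::finite"
  shows "ambiguous k z q \<in> sets borel"
proof -
  let ?w = "\<lambda>p. fst (snd (snd p)) :: complex^'n" and ?u = "\<lambda>p. snd (snd (snd (snd p))) :: complex^'n"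
  let ?m = "\<lambda>p. fst (snd p) :: complex" and ?n = "\<lambda>p. fst (snd (snd (snd p))) :: complex"
  let ?U = "{p :: (complex^'n^'n) \<times> complex \<times> (complex^'n) \<times> complex \<times> (complex^'n). ?w p \<noteq> 0} \<inter> {p. ?u p \<noteq> 0}
    \<inter> {p. cmod (?m p - z) < q} \<inter> {p. cmod (?n p - z) < q} \<inter> {p. \<exists>i j. ?w p $ i * ?u p $ j \<noteq> ?w p $ j * ?u p $ i}"
  let ?C = "{p :: (complex^'n^'n) \<times> complex \<times> (complex^'n) \<times> complex \<times> (complex^'n). block_equation k (fst p) (?m p) (?w p)}
    \<inter> {p. block_equation k (fst p) (?n p) (?u p)}"
  have "open ?U" by (intro open_Int open_Collect_ex open_Collect_nonzero open_Collect_less continuous_intros)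
  moreover have "closed ?C" by (intro closed_Int closed_block_equation continuous_intros)
  ultimately have "fst ` (?U \<inter> ?C) \<in> sets borel" by (rule borel_fst_image)
  moreover have "ambiguous k z q = fst ` (?U \<inter> ?C)"
    unfolding ambiguous_def block_eigenpair_iff set_eq_iff image_iff mem_Collect_eq Int_iff Bex_def split_paired_Ex fst_conv snd_conv
    by blast
  ultimately show ?thesis by simp
qed

lemma borel_event: "event k z z' \<delta> \<in> sets borel"
  unfolding event_def
  by (rule sets.Int[OF borel_closest_block], rule sets.countable_UN')
    (auto intro!: sets.Diff borel_event_in borel_ambiguous countable_rat)

section \<open>The event in terms of Y\<close>

lemma schur_vec_scale: "schur_vec k P (c *s w) = c *s schur_vec k P w"
  by (simp add: schur_vec_def Let_def hermitian_inner_scale_right vec_eq_iff algebra_simps)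

lemma large_corner_scale: "c \<noteq> 0 \<Longrightarrow> large_corner k \<delta> P (c *s w) \<longleftrightarrow> large_corner k \<delta> P w"
proof -
  assume c: "c \<noteq> 0"
  have "large_corner k \<delta> P (c *s w) \<longleftrightarrow> (cmod c)\<^sup>2 * (\<delta> * ((norm (deflation_vec k P))\<^sup>2 * (norm (schur_vec k P w))\<^sup>2))
     \<le> (cmod c)\<^sup>2 * (real CARD('a) * (cmod (hermitian_inner (deflation_vec k P) (inflate k P *v schur_vec k P w)))\<^sup>2)"
    unfolding large_corner_def schur_vec_scale
    by (simp add: norm_scale_vec vector_scalar_commute hermitian_inner_scale_right norm_mult power_mult_distrib ac_simps)
  then show ?thesis using c unfolding large_corner_def by simp
qed

lemma parallel_vectors:
  fixes w u :: "complex^'n"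
  assumes "w \<noteq> 0" "u \<noteq> 0" "\<And>i j. w $ i * u $ j = w $ j * u $ i"
  obtains c where "c \<noteq> 0" "u = c *s w"
proof -
  obtain i where i: "w $ i \<noteq> 0" using assms(1) by (auto simp: vec_eq_iff)
  define c where "c = u $ i / w $ i"
  have "u = c *s w" using assms(3)[of i] i by (simp add: vec_eq_iff c_def field_simps)
  moreover have "c \<noteq> 0" using calculation assms(2) by auto
  ultimately show ?thesis using that by blast
qed

text \<open>Eigenvectors for the disc are parallel, and \<open>large_corner\<close> is insensitive
  to nonzero scaling.\<close>

lemma not_ambiguous:
  assumes "P \<notin> ambiguous k z q" "block_eigenpair k P \<mu> w" "cmod (\<mu> - z) < q" "block_eigenpair k P \<nu> u" "cmod (\<nu> - z) < q"
  shows "large_corner k \<delta> Q w \<longleftrightarrow> large_corner k \<delta> Q u"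
proof -
  have "w $ i * u $ j = w $ j * u $ i" for i j using assms unfolding ambiguous_def by blast
  then obtain c where "c \<noteq> 0" "u = c *s w"
    using parallel_vectors[of w u] assms(2,4) by (auto simp: block_eigenpair_def)
  then show ?thesis by (simp add: large_corner_scale)
qed

lemma schur_vec_orthogonal: "hermitian_inner (deflation_vec k P) (schur_vec k P w) = 0"
  by (simp add: schur_vec_def Let_def hermitian_inner_diff_right hermitian_inner_scale_right hermitian_inner_self)

text \<open>Entry \<open>k\<close> of the Schur vector is minus the product of \<open>w\<close> with
  the deflated vector. If it vanishes, the Schur vector is a positive multiple of
  \<open>w\<close>.\<close>

lemma schur_vec_nonzero:
  assumes "block_eigenpair k P \<mu> w" shows "schur_vec k P w \<noteq> 0"
proof
  assume 0: "schur_vec k P w = 0"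
  then have "schur_vec k P w $ k = 0" by simp
  then have "hermitian_inner (deflation_vec k P) w = 0"
    using assms by (simp add: schur_vec_def Let_def block_eigenpair_def)
  then have "complex_of_real ((norm (deflation_vec k P))\<^sup>2) *s w = 0" using 0 by (simp add: schur_vec_def Let_def)
  then show False using assms deflation_vec_nonzero[of k P] by (simp add: block_eigenpair_def)
qed

text \<open>The identity Y = n |t|^2. The component p of \<open>v'\<close> orthogonal to
  \<open>v\<close> has |p|^2 = 1 - |\<kappa>|^2 and <v, M p> = (l' - l) \<kappa>, where \<kappa> =
  <v, v'>; dividing gives Y / n, and the normalisation of the deflated vector contributes the same
  factor to both sides.\<close>

lemma large_corner_iff_Y_value:
  fixes M :: "complex^'n^'n"
  assumes v: "unit_eigenvector M l v" and v': "unit_eigenvector M l' v'" and ne: "l \<noteq> l'" and vk: "v $ k \<noteq> 0"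
    and P: "inflate k P = M" "deflation_vec k P = (1 / v $ k) *s v" and \<delta>: "\<delta> > 0"
  shows "large_corner k \<delta> P (v' - v' $ k *s deflation_vec k P) \<longleftrightarrow> \<delta> \<le> Y_value l l' v v'"
proof -
  let ?x = "deflation_vec k P" and ?w = "v' - v' $ k *s deflation_vec k P"
  define a where "a = 1 / v $ k"
  define N where "N = (norm ?x)\<^sup>2"
  define \<kappa> where "\<kappa> = hermitian_inner v v'"
  define p where "p = v' - \<kappa> *s v"
  have x: "?x = a *s v" by (simp add: P a_def)
  have nv: "norm v = 1" "norm v' = 1" using v v' by (auto simp: unit_eigenvector_def)
  have ev: "M *v v = l *s v" "M *v v' = l' *s v'" using v v' by (auto simp: unit_eigenvector_def)
  have N: "N = (cmod a)\<^sup>2" "N > 0" using vk by (auto simp: N_def x norm_scale_vec nv a_def)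
  have Na: "complex_of_real N = a * cnj a" unfolding N(1) by (rule complex_norm_square)
  have xw: "hermitian_inner ?x ?w = cnj a * \<kappa> - v' $ k * complex_of_real N"
    by (simp add: hermitian_inner_diff_right hermitian_inner_scale_right hermitian_inner_self N_def[symmetric])
      (simp add: x hermitian_inner_scale_left \<kappa>_def)
  have u: "schur_vec k P ?w = complex_of_real N *s p"
  proof -
    have "schur_vec k P ?w = complex_of_real N *s ?w - hermitian_inner ?x ?w *s ?x" by (simp add: schur_vec_def Let_def N_def)
    also have "\<dots> = complex_of_real N *s v' - (cnj a * \<kappa>) *s ?x"
      unfolding xw by (simp add: vec_eq_iff algebra_simps)
    also have "\<dots> = complex_of_real N *s p"
      unfolding x p_def Na by (simp add: vec_eq_iff algebra_simps)
    finally show ?thesis .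
  qed
  have np: "(norm p)\<^sup>2 = 1 - (cmod \<kappa>)\<^sup>2"
  proof -
    have vv: "hermitian_inner v v = 1" "hermitian_inner v' v' = 1" using nv by (simp_all add: hermitian_inner_self)
    have "hermitian_inner p p = 1 - complex_of_real ((cmod \<kappa>)\<^sup>2)"
      unfolding p_def complex_norm_square
      by (simp add: hermitian_inner_diff_left hermitian_inner_diff_right hermitian_inner_scale_left hermitian_inner_scale_right
        vv hermitian_inner_commute[of v' v] \<kappa>_def[symmetric] algebra_simps)
    then have "complex_of_real ((norm p)\<^sup>2) = complex_of_real (1 - (cmod \<kappa>)\<^sup>2)" by (simp add: hermitian_inner_self)
    then show ?thesis by (simp only: of_real_eq_iff)
  qed
  have Mp: "hermitian_inner v (M *v p) = (l' - l) * \<kappa>"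
    by (simp add: p_def matrix_vector_mult_diff_distrib vector_scalar_commute ev hermitian_inner_diff_right
      hermitian_inner_scale_right hermitian_inner_self nv \<kappa>_def[symmetric] algebra_simps)
  have "hermitian_inner ?x (M *v schur_vec k P ?w) = complex_of_real N * cnj a * ((l' - l) * \<kappa>)"
    unfolding u unfolding x by (simp add: vector_scalar_commute hermitian_inner_scale_left hermitian_inner_scale_right Mp)
  then have "cmod (hermitian_inner ?x (M *v schur_vec k P ?w)) = N * cmod a * (cmod (l' - l) * cmod \<kappa>)"
    using N(2) by (simp only: norm_mult complex_mod_cnj norm_of_real abs_of_pos)
  then have c1: "(cmod (hermitian_inner ?x (M *v schur_vec k P ?w)))\<^sup>2 = N\<^sup>2 * N * ((cmod (l' - l))\<^sup>2 * (cmod \<kappa>)\<^sup>2)"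
    by (simp only: power_mult_distrib N(1)[symmetric])
  have c2: "(norm (schur_vec k P ?w))\<^sup>2 = N\<^sup>2 * (1 - (cmod \<kappa>)\<^sup>2)"
    unfolding u np[symmetric] norm_scale_vec norm_of_real abs_of_pos[OF N(2)] by (rule power_mult_distrib)
  have "large_corner k \<delta> P ?w \<longleftrightarrow> (N\<^sup>2 * N) * (\<delta> * (1 - (cmod \<kappa>)\<^sup>2))
    \<le> (N\<^sup>2 * N) * (real CARD('n) * ((cmod (l' - l))\<^sup>2 * (cmod \<kappa>)\<^sup>2))"
    unfolding large_corner_def P(1) c1 c2 N_def[symmetric] by (simp only: ac_simps)
  also have "\<dots> \<longleftrightarrow> \<delta> * (1 - (cmod \<kappa>)\<^sup>2) \<le> real CARD('n) * ((cmod (l' - l))\<^sup>2 * (cmod \<kappa>)\<^sup>2)"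
    using N by simp
  also have "\<dots> \<longleftrightarrow> \<delta> \<le> Y_value l l' v v'"
  proof (cases "\<kappa> = 0")
    \<comment> \<open>For orthogonal eigenvectors t is 0 and \<open>Y_value\<close> is 0 by
      convention, so both sides fail as \<delta> is positive.\<close>
    case True
    then show ?thesis using \<delta> by (simp add: Y_value_def \<kappa>_def[symmetric])
  next
    case False
    have "p \<noteq> 0"
    proof
      assume "p = 0"
      then have "v' = \<kappa> *s v" by (simp add: p_def)
      then have "l' *s v' = l *s v'" using ev by (metis vector_scalar_commute vector_smult_assoc mult.commute)
      then have "(l' - l) *s v' = 0" by (simp add: vec_eq_iff algebra_simps)
      then show False using ne nv by auto
    qed
    then have pos: "0 < 1 - (cmod \<kappa>)\<^sup>2" unfolding np[symmetric] by simp
    have k2: "0 < (cmod \<kappa>)\<^sup>2" using False by simp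
    have "cmod \<kappa> powi (-2) - 1 = (1 - (cmod \<kappa>)\<^sup>2) / (cmod \<kappa>)\<^sup>2"
      using k2 by (simp add: power_int_def field_simps)
    then have "Y_value l l' v v' = real CARD('n) * ((cmod (l' - l))\<^sup>2 * (cmod \<kappa>)\<^sup>2) / (1 - (cmod \<kappa>)\<^sup>2)"
      using False by (simp add: Y_value_def \<kappa>_def[symmetric])
    then show ?thesis using pos by (simp add: pos_le_divide_eq)
  qed
  finally show ?thesis .
qed

lemma tie_imp_exceptional:
  "P \<in> tie_block j y \<Longrightarrow> y = z \<or> y = z' \<Longrightarrow> inflate j P \<in> exceptional k z z'"
  unfolding exceptional_def by auto

lemma zero_entry_imp_exceptional: "P $ k $ j = 0 \<Longrightarrow> j \<noteq> k \<Longrightarrow> inflate j P \<in> exceptional k z z'"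
  unfolding exceptional_def by auto

lemma scale_eigenvector:
  fixes M :: "complex^'n^'n"
  assumes "M *v v = l *s v"
  shows "M *v (c *s v) = l *s (c *s v)"
  unfolding vector_scalar_commute assms by (simp add: vector_smult_assoc mult.commute)

text \<open>Deflate \<open>x\<close>, normalised at \<open>j\<close>. If \<open>u\<close> were not a
  multiple of it, its class modulo \<open>x\<close> would be a block eigenvector at the same
  distance from \<open>y\<close>, that is, a tie.\<close>

lemma exceptionalD_simple:
  fixes M :: "complex^'n^'n"
  assumes M: "M \<notin> exceptional k z z'" and z: "y = z \<or> y = z'"
    and x: "M *v x = l *s x" "x $ j \<noteq> 0" and u: "M *v u = m *s u" and d: "cmod (l - y) = cmod (m - y)"
  shows "\<exists>c. u = c *s x"
proof -
  define x' where "x' = (1 / x $ j) *s x"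
  have "M *v x' = l *s x'" "x' $ j = 1"
    using x(2) scale_eigenvector[OF x(1)] by (simp_all add: x'_def)
  then obtain P where P: "inflate j P = M" "deflation_vec j P = x'" "P $ j $ j = l" by (rule deflate)
  define w where "w = u - u $ j *s x'"
  have "w = 0"
  proof (rule ccontr)
    assume "w \<noteq> 0"
    then have "block_eigenpair j P m w" using u by (intro block_eigenpair_of_eigenvector[where v=u]) (auto simp: P w_def)
    then have "P \<in> tie_block j y" using d P(3) by (auto simp: tie_block_def)
    then show False using tie_imp_exceptional[OF _ z] M P(1) by blast
  qed
  then have "u = (u $ j / x $ j) *s x" by (simp add: w_def x'_def vector_smult_assoc)
  then show ?thesis by blast
qed

text \<open>Off the exceptional set the eigenvector for \<open>l\<close> can be normalised at
  \<open>k\<close>, and deflating it lands in \<open>closest_block\<close> because ties are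
  excluded. On this domain \<open>inflate\<close> is injective, so the event on matrices becomes a
  statement about one deflated point.\<close>

lemma event_iff_Y_value:
  fixes M :: "complex^'n^'n"
  assumes M: "M \<notin> exceptional k z z'" and sel: "selected_eigenvalues z z' M l l'"
    and v: "unit_eigenvector M l v" and v': "unit_eigenvector M l' v'" and \<delta>: "\<delta> > 0"
  obtains P where "P \<in> closest_block k z" "inflate k P = M" "P \<in> event k z z' \<delta> \<longleftrightarrow> \<delta> \<le> Y_value l l' v v'"
proof -
  have Mv: "M *v v = l *s v" "v \<noteq> 0" and Mv': "M *v v' = l' *s v'" "v' \<noteq> 0"
    using v v' by (auto simp: unit_eigenvector_def)
  have l_min: "cmod (l - z) \<le> cmod (m - z)" if "m \<in> spectrum M" for m
    using sel that by (auto simp: selected_eigenvalues_def closest_in_def is_arg_min_def not_less)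
  \<comment> \<open>Both branches of the selection make \<open>l'\<close> minimal among the
    eigenvalues other than \<open>l\<close>: if \<open>l\<close> is not closest to
    \<open>z'\<close>, the closest one automatically differs from it.\<close>
  have l'_ne: "l' \<noteq> l" and l'_min: "\<And>m. m \<in> spectrum M \<Longrightarrow> m \<noteq> l \<Longrightarrow> cmod (l' - z') \<le> cmod (m - z')"
    using sel by (auto simp: selected_eigenvalues_def closest_in_def is_arg_min_def not_less split: if_splits)
  have vk: "v $ k \<noteq> 0"
  proof
    assume 0: "v $ k = 0"
    obtain j where j: "v $ j \<noteq> 0" using Mv(2) by (auto simp: vec_eq_iff)
    define x where "x = (1 / v $ j) *s v"
    have "M *v x = l *s x" "x $ j = 1"
      using j scale_eigenvector[OF Mv(1)] by (simp_all add: x_def)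
    then obtain P where P: "inflate j P = M" "deflation_vec j P = x" "P $ j $ j = l" by (rule deflate)
    have kj: "k \<noteq> j" using 0 j by auto
    have "deflation_vec j P $ k = 0" unfolding P(2) by (simp add: x_def 0)
    then have "P $ k $ j = 0" using kj by (simp add: deflation_vec_def)
    then show False using zero_entry_imp_exceptional[of P k j z z'] M P(1) kj by simp
  qed
  define x where "x = (1 / v $ k) *s v"
  have "M *v x = l *s x" "x $ k = 1"
    using vk scale_eigenvector[OF Mv(1)] by (simp_all add: x_def)
  then obtain P where P: "inflate k P = M" "deflation_vec k P = x" "P $ k $ k = l" by (rule deflate)
  have notie: "cmod (l - z) \<noteq> cmod (m - z)" if "block_eigenpair k P m w" for m w
  proof
    assume "cmod (l - z) = cmod (m - z)"
    then have "P \<in> tie_block k z" unfolding tie_block_def using that P(3) by auto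
    then show False using tie_imp_exceptional[of P k z z z' k] M P(1) by simp
  qed
  have block_spec: "m \<in> spectrum M" "m \<noteq> l" if w: "block_eigenpair k P m w" for m w
  proof -
    show ne: "m \<noteq> l" using notie[OF w] by auto
    show "m \<in> spectrum M"
      using eigenvector_of_block_eigenpair[OF w] ne P unfolding spectrum_def by auto
  qed
  have PS: "P \<in> closest_block k z"
    unfolding closest_block_def using notie block_spec(1) l_min P(3) by (auto simp: less_le)
  define w' where "w' = v' - v' $ k *s deflation_vec k P"
  have "w' \<noteq> 0"
  proof
    assume "w' = 0"
    then have e: "v' = (v' $ k / v $ k) *s v" by (simp add: w'_def P(2) x_def vector_smult_assoc)
    have "M *v v' = l *s v'" by (subst (1 2) e) (rule scale_eigenvector[OF Mv(1)])
    then have "(l' - l) *s v' = 0" using Mv'(1) by (simp add: vec_eq_iff algebra_simps)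
    then show False using l'_ne Mv'(2) by simp
  qed
  then have w': "block_eigenpair k P l' w'"
    using Mv'(1) by (intro block_eigenpair_of_eigenvector[where v=v']) (auto simp: P(1) w'_def)
  have Y: "large_corner k \<delta> P w' \<longleftrightarrow> \<delta> \<le> Y_value l l' v v'"
    unfolding w'_def using v v' l'_ne vk P \<delta> by (intro large_corner_iff_Y_value) (auto simp: x_def)
  have "P \<in> event k z z' \<delta> \<longleftrightarrow> large_corner k \<delta> P w'"
  proof
    assume "P \<in> event k z z' \<delta>"
    then obtain q where q: "P \<in> event_in k z' \<delta> q" "P \<notin> ambiguous k z' q" unfolding event_def by blast
    then obtain m w where w: "block_eigenpair k P m w" "cmod (m - z') < q" "large_corner k \<delta> P w"
      unfolding event_in_def by blast
    have "cmod (l' - z') < q" using l'_min[OF block_spec[OF w(1)]] w(2) by linarith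
    then show "large_corner k \<delta> P w'" using not_ambiguous[OF q(2) w(1,2) w'] w(3) by blast
  next
    assume L: "large_corner k \<delta> P w'"
    let ?D = "{cmod (m - z') | m. (\<exists>w. block_eigenpair k P m w) \<and> cmod (l' - z') < cmod (m - z')}"
    have "?D = (\<lambda>m. cmod (m - z')) ` {m \<in> {m. \<exists>w. block_eigenpair k P m w}. cmod (l' - z') < cmod (m - z')}" by blast
    then have fin: "finite ?D" using finite_block_eigenvalues[of k P] by simp
    \<comment> \<open>The next larger distance of a block eigenvalue from \<open>z'\<close>; the
      entry plus 1 stands in when there is none. A rational \<open>q\<close> below it isolates the
      closest ones.\<close>
    define r where "r = Min (insert (cmod (l' - z') + 1) ?D)"
    have "r \<in> insert (cmod (l' - z') + 1) ?D" unfolding r_def using fin by (intro Min_in) auto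
    then have "cmod (l' - z') < r" by auto
    then obtain q where q: "q \<in> \<rat>" "cmod (l' - z') < q" "q < r" using Rats_dense_in_real by blast
    \<comment> \<open>A block eigenvalue within \<open>q\<close> is no farther from
      \<open>z'\<close> than \<open>l'\<close>, so by minimality the distances tie, and off the
      exceptional set tied eigenvectors are parallel.\<close>
    have near: "\<exists>c. w = c *s w'" if w: "block_eigenpair k P m w" "cmod (m - z') < q" for m w
    proof -
      have "\<not> cmod (l' - z') < cmod (m - z')"
      proof
        assume "cmod (l' - z') < cmod (m - z')"
        then have "cmod (m - z') \<in> insert (cmod (l' - z') + 1) ?D" using w by blast
        then have "r \<le> cmod (m - z')" unfolding r_def using fin by (intro Min_le) auto
        then show False using w(2) q(3) by linarith
      qed
      then have d: "cmod (l' - z') = cmod (m - z')" using l'_min[OF block_spec[OF w(1)]] by simp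
      obtain b where b: "M *v (w + b *s x) = m *s (w + b *s x)"
        using eigenvector_of_block_eigenpair[OF w(1)] block_spec(2)[OF w(1)] P by auto
      obtain j where "v' $ j \<noteq> 0" using Mv'(2) by (auto simp: vec_eq_iff)
      then obtain c where c: "w + b *s x = c *s v'" using exceptionalD_simple[OF M _ Mv'(1) _ b d] by blast
      have v'e: "v' = w' + v' $ k *s x" by (simp add: w'_def P(2))
      have wk: "w $ k = 0" using w(1) by (simp add: block_eigenpair_def)
      have "b = c * v' $ k" using arg_cong[OF c, of "\<lambda>y. y $ k"] wk \<open>x $ k = 1\<close> by simp
      then have "w = c *s w'" using c by (simp add: w'_def P(2) vec_eq_iff algebra_simps)
      then show ?thesis by blast
    qed
    have "P \<notin> ambiguous k z' q"
    proof
      assume "P \<in> ambiguous k z' q"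
      then obtain m w m2 u i j where h: "block_eigenpair k P m w" "block_eigenpair k P m2 u"
        "cmod (m - z') < q" "cmod (m2 - z') < q" "w $ i * u $ j \<noteq> w $ j * u $ i" unfolding ambiguous_def by blast
      obtain c c2 where "w = c *s w'" "u = c2 *s w'" using near[OF h(1,3)] near[OF h(2,4)] by blast
      then show False using h(5) by simp
    qed
    moreover have "P \<in> event_in k z' \<delta> q" unfolding event_in_def using w' q(2) L by blast
    ultimately show "P \<in> event k z z' \<delta>" unfolding event_def using PS q(1) by blast
  qed
  then show ?thesis using that PS P(1) Y by blast
qed

section \<open>Integration over the fibres\<close>

lemma leaf_event_bound:
  fixes k :: "'n::finite" and Y :: "complex^'n^'n" and \<Psi> :: "complex^'n^'n \<Rightarrow> real" and a \<delta> :: real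
  defines "W \<equiv> \<lambda>M. exp (- a * (norm M)\<^sup>2 - \<Psi> M)"
  assumes conv: "convex_on UNIV \<Psi>" and inv: "\<And>D M. unitary_matrix D \<Longrightarrow> \<Psi> (D ** M ** D) = \<Psi> M"
    and a: "a > 0" and \<delta>: "\<delta> > 0"
  shows "(\<integral>\<^sup>+h. ennreal (jac (inflate_deriv k (leaf_point k Y h))) * ennreal (W (inflate k (leaf_point k Y h)))
       * indicator (event k z z' \<delta>) (leaf_point k Y h) \<partial>Pi\<^sub>M (leaf_basis k) (\<lambda>_. lborel))
    \<le> ennreal (exp (- a * (\<delta> / CARD('n)))) *
      (\<integral>\<^sup>+h. ennreal (jac (inflate_deriv k (leaf_point k Y h))) * ennreal (W (inflate k (leaf_point k Y h)))
       * indicator (closest_block k z) (leaf_point k Y h) \<partial>Pi\<^sub>M (leaf_basis k) (\<lambda>_. lborel))"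
proof -
  let ?\<mu> = "Pi\<^sub>M (leaf_basis k) (\<lambda>_. lborel :: real measure)" and ?P = "leaf_point k Y"
  let ?w = "\<lambda>P. ennreal (jac (inflate_deriv k P)) * ennreal (W (inflate k P))"
  define J where "J = ennreal (jac (inflate_deriv k Y))"
  \<comment> \<open>On a fibre the Jacobian, the deflated vector, the block eigenpairs and the Schur
    vectors are constant, and so is membership in \<open>closest_block\<close> and
    \<open>ambiguous\<close>. The event thus depends on the row through the corner entry
    alone.\<close>
  have J: "ennreal (jac (inflate_deriv k (?P h))) = J" for h
    unfolding J_def by (rule arg_cong[where f=ennreal], rule leaf_eq_jac[symmetric], rule leaf_point_eq)
  have eig: "block_eigenpair k (?P h) = block_eigenpair k Y" for h
    by (rule leaf_eq_block_eigenpair[symmetric], rule leaf_point_eq)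
  have x: "deflation_vec k (?P h) = deflation_vec k Y" for h
    by (rule leaf_eq_deflation_vec[symmetric], rule leaf_point_eq)
  have Pkk: "?P h $ k $ k = Y $ k $ k" for h using leaf_point_eq[of k Y h] by (simp add: leaf_eq_def)
  have closest: "?P h \<in> closest_block k z \<longleftrightarrow> Y \<in> closest_block k z" for h
    by (simp add: closest_block_def eig Pkk)
  have amb: "?P h \<in> ambiguous k z' q \<longleftrightarrow> Y \<in> ambiguous k z' q" for h q
    by (simp add: ambiguous_def eig)
  have schur: "schur_vec k (?P h) w = schur_vec k Y w" for h w by (simp add: schur_vec_def x)
  show ?thesis
  proof (cases "\<exists>h. ?P h \<in> event k z z' \<delta>")
    case False
    then show ?thesis by simp
  next
    case True
    then obtain h0 q0 where h0: "?P h0 \<in> closest_block k z" "?P h0 \<in> event_in k z' \<delta> q0" "?P h0 \<notin> ambiguous k z' q0"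
      unfolding event_def by blast
    then obtain m0 w0 where w0: "block_eigenpair k Y m0 w0" "cmod (m0 - z') < q0"
      unfolding event_in_def mem_Collect_eq eig by blast
    have Yc: "Y \<in> closest_block k z" using h0(1) closest by simp
    define u where "u = schur_vec k Y w0"
    define t where "t h = hermitian_inner (deflation_vec k Y) (inflate k (?P h) *v u) / complex_of_real (norm (deflation_vec k Y) * norm u)" for h
    have u0: "u \<noteq> 0" unfolding u_def by (rule schur_vec_nonzero[OF w0(1)])
    have xu: "hermitian_inner (deflation_vec k Y) u = 0" unfolding u_def by (rule schur_vec_orthogonal)
    have sub: "\<delta> / CARD('n) \<le> (cmod (t h))\<^sup>2" if ev: "?P h \<in> event k z z' \<delta>" for h
    proof -
      obtain q where q: "?P h \<in> event_in k z' \<delta> q" "?P h \<notin> ambiguous k z' q" using ev unfolding event_def by blast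
      then obtain m w where w: "block_eigenpair k Y m w" "cmod (m - z') < q" "large_corner k \<delta> (?P h) w"
        unfolding event_in_def mem_Collect_eq eig by blast
      \<comment> \<open>The discs of radius \<open>q\<close> and \<open>q0\<close> about
        \<open>z'\<close> are nested and neither is ambiguous on this fibre; the larger one contains
        both eigenvalues. A single vector \<open>w0\<close> therefore serves all
        \<open>h\<close>.\<close>
      have "large_corner k \<delta> (?P h) w0"
      proof (cases "q0 \<le> q")
        case True
        then show ?thesis using not_ambiguous[of Y k z' q m w m0 w0 \<delta> "?P h"] q(2) w w0 unfolding amb by auto
      next
        case False
        then show ?thesis using not_ambiguous[of Y k z' q0 m w m0 w0 \<delta> "?P h"] h0(3) w w0 unfolding amb by auto
      qed
      then have "\<delta> * ((norm (deflation_vec k Y))\<^sup>2 * (norm u)\<^sup>2)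
        \<le> real CARD('n) * (cmod (hermitian_inner (deflation_vec k Y) (inflate k (?P h) *v u)))\<^sup>2"
        unfolding large_corner_def x schur u_def .
      moreover have "0 < (norm (deflation_vec k Y))\<^sup>2 * (norm u)\<^sup>2" using u0 deflation_vec_nonzero[of k Y] by simp
      ultimately show ?thesis
        by (simp add: t_def norm_divide norm_mult power_divide power_mult_distrib divide_le_eq pos_le_divide_eq mult.commute)
    qed
    have [measurable]: "\<Psi> \<in> borel_measurable borel" "inflate k \<in> borel_measurable borel"
      by (intro borel_measurable_continuous_onI convex_on_continuous[OF open_UNIV conv] continuous_on_inflate)+
    have [measurable]: "W \<in> borel_measurable borel" unfolding W_def by measurable
    have "(\<lambda>A. hermitian_inner (deflation_vec k Y) (A *v u)) \<in> borel_measurable borel"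
      by (intro borel_measurable_continuous_onI continuous_intros)
    from measurable_compose[OF _ this] have [measurable]: "t \<in> borel_measurable ?\<mu>"
      unfolding t_def[abs_def] by measurable
    have "(\<integral>\<^sup>+h. ?w (?P h) * indicator (event k z z' \<delta>) (?P h) \<partial>?\<mu>)
      \<le> (\<integral>\<^sup>+h. J * (indicator {\<delta> / CARD('n)..} ((cmod (t h))\<^sup>2) * ennreal (W (inflate k (?P h)))) \<partial>?\<mu>)"
      unfolding J using sub by (intro nn_integral_mono) (auto simp: indicator_def)
    also have "\<dots> = J * (\<integral>\<^sup>+h. indicator {\<delta> / CARD('n)..} ((cmod (t h))\<^sup>2) * ennreal (W (inflate k (?P h))) \<partial>?\<mu>)"
      by (rule nn_integral_cmult) measurable
    also have "\<dots> \<le> J * (ennreal (exp (- a * (\<delta> / CARD('n)))) * (\<integral>\<^sup>+h. ennreal (W (inflate k (?P h))) \<partial>?\<mu>))"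
      unfolding t_def W_def using \<delta>
      by (intro mult_left_mono leaf_tail[OF xu u0 conv inv a]) (auto simp: divide_pos_pos)
    also have "\<dots> = ennreal (exp (- a * (\<delta> / CARD('n)))) * (\<integral>\<^sup>+h. J * ennreal (W (inflate k (?P h))) \<partial>?\<mu>)"
      by (subst nn_integral_cmult) (auto simp: ac_simps)
    also have "(\<integral>\<^sup>+h. J * ennreal (W (inflate k (?P h))) \<partial>?\<mu>)
      = (\<integral>\<^sup>+h. ?w (?P h) * indicator (closest_block k z) (?P h) \<partial>?\<mu>)"
      unfolding J using closest Yc by (intro nn_integral_cong) simp
    finally show ?thesis .
  qed
qed

text \<open>Event and domain are pulled back to deflated coordinates, compared fibre by fibre, and
  the domain is pushed forward again.\<close>

lemma event_bound:
  fixes k :: "'n::finite" and \<Psi> :: "complex^'n^'n \<Rightarrow> real" and a \<delta> :: real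
  defines "W \<equiv> \<lambda>M. exp (- a * (norm M)\<^sup>2 - \<Psi> M)"
  assumes conv: "convex_on UNIV \<Psi>" and inv: "\<And>D M. unitary_matrix D \<Longrightarrow> \<Psi> (D ** M ** D) = \<Psi> M"
    and a: "a > 0" and \<delta>: "\<delta> > 0" and fin: "(\<integral>\<^sup>+M. ennreal (W M) \<partial>lborel) < \<infinity>"
  shows "inflate k ` event k z z' \<delta> \<in> sets lebesgue"
    and "(\<integral>\<^sup>+M. ennreal (W M) * indicator (inflate k ` event k z z' \<delta>) M \<partial>lborel)
      \<le> ennreal (exp (- a * (\<delta> / CARD('n)))) * (\<integral>\<^sup>+M. ennreal (W M) \<partial>lborel)"
proof -
  let ?w = "\<lambda>P. ennreal (jac (inflate_deriv k P)) * ennreal (W (inflate k P))"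
  let ?S = "closest_block k z" and ?E = "event k z z' \<delta>" and ?B = "leaf_basis k"
  have [measurable]: "\<Psi> \<in> borel_measurable borel" "inflate k \<in> borel_measurable borel"
    by (intro borel_measurable_continuous_onI convex_on_continuous[OF open_UNIV conv] continuous_on_inflate)+
  have [measurable]: "W \<in> borel_measurable borel" unfolding W_def by measurable
  have [measurable]: "?S \<in> sets borel" "?E \<in> sets borel" by (rule borel_closest_block borel_event)+
  have J[measurable]: "(\<lambda>P. jac (inflate_deriv k P)) \<in> borel_measurable borel"
  proof (rule borel_measurable_jac, rule borel_measurable_continuous_onI)
    fix H :: "complex^'n^'n"
    have c1: "continuous_on UNIV (\<lambda>P. deflation_vec k P $ i)" for i :: 'n by (intro continuous_intros)
    have c2: "continuous_on UNIV (\<lambda>P. deflation_rest k P i j)" for i j :: 'n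
      unfolding deflation_rest_def by (cases "i = k") (auto intro!: continuous_intros c1)
    show "continuous_on UNIV (\<lambda>P. inflate_deriv k P H)"
      unfolding inflate_deriv_def Let_def
    proof (intro continuous_on_vec_lambda)
      fix i j
      show "continuous_on UNIV (\<lambda>P. if j = k then P $ k $ k * (if i = k then 0 else H $ i $ k) + H $ k $ k * deflation_vec k P $ i
          - (\<Sum>l\<in>UNIV - {k}. deflation_rest k P i l * H $ l $ k + ((if i = k then 0 else H $ i $ l) +
              (deflation_vec k P $ i * H $ k $ l + (if i = k then 0 else H $ i $ k) * P $ k $ l)) * P $ l $ k)
        else (if i = k then 0 else H $ i $ j) + (deflation_vec k P $ i * H $ k $ j + (if i = k then 0 else H $ i $ k) * P $ k $ j))"
        by (cases "j = k") (auto intro!: continuous_intros c1 c2)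
    qed
  qed
  have W0: "0 \<le> W M" for M by (simp add: W_def)
  have ES: "?E \<subseteq> ?S" by (auto simp: event_def)
  have covS: "(\<integral>\<^sup>+M. ennreal (W M) * indicator (inflate k ` ?S) M \<partial>lebesgue)
    = (\<integral>\<^sup>+P. ?w P * indicator ?S P \<partial>lborel)"
    using fin W0
    by (intro nn_integral_change_of_variables(2) has_derivative_inflate inj_on_inflate) auto
  have injE: "inj_on (inflate k) ?E" by (rule inj_on_subset[OF inj_on_inflate ES])
  show "inflate k ` ?E \<in> sets lebesgue"
    using fin W0 injE by (intro nn_integral_change_of_variables(1)[where f=W and g'="inflate_deriv k"] has_derivative_inflate) auto
  have covE: "(\<integral>\<^sup>+M. ennreal (W M) * indicator (inflate k ` ?E) M \<partial>lebesgue)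
    = (\<integral>\<^sup>+P. ?w P * indicator ?E P \<partial>lborel)"
    using fin W0 injE by (intro nn_integral_change_of_variables(2) has_derivative_inflate) auto
  have split: "(\<integral>\<^sup>+P. f P \<partial>lborel) = (\<integral>\<^sup>+y. (\<integral>\<^sup>+h. f (leaf_point k (\<Sum>b\<in>Basis - ?B. y b *\<^sub>R b) h) \<partial>Pi\<^sub>M ?B (\<lambda>_. lborel))
     \<partial>Pi\<^sub>M (Basis - ?B) (\<lambda>_. lborel))" if "f \<in> borel_measurable borel" for f :: "complex^'n^'n \<Rightarrow> ennreal"
    using nn_integral_lborel_split[of ?B f] that unfolding leaf_point_def by (auto simp: leaf_basis_def)
  let ?q = "ennreal (exp (- a * (\<delta> / CARD('n))))"
  have "(\<integral>\<^sup>+M. ennreal (W M) * indicator (inflate k ` ?E) M \<partial>lborel)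
    = (\<integral>\<^sup>+P. ?w P * indicator ?E P \<partial>lborel)"
    using covE unfolding nn_integral_completion .
  also have "\<dots> \<le> ?q * (\<integral>\<^sup>+P. ?w P * indicator ?S P \<partial>lborel)"
  proof -
    have m: "(\<lambda>P. ?w P * indicator ?S P) \<in> borel_measurable borel"
      "(\<lambda>P. ?w P * indicator ?E P) \<in> borel_measurable borel"
      "(\<lambda>P. ?q * (?w P * indicator ?S P)) \<in> borel_measurable borel"
      by measurable
    have "(\<integral>\<^sup>+P. ?w P * indicator ?E P \<partial>lborel)
      \<le> (\<integral>\<^sup>+P. ?q * (?w P * indicator ?S P) \<partial>lborel)"
      unfolding split[OF m(2)] split[OF m(3)]
    proof -
      show "(\<integral>\<^sup>+y. (\<integral>\<^sup>+h. ?w (leaf_point k (\<Sum>b\<in>Basis - ?B. y b *\<^sub>R b) h) * indicator ?E (leaf_point k (\<Sum>b\<in>Basis - ?B. y b *\<^sub>R b) h) \<partial>Pi\<^sub>M ?B (\<lambda>_. lborel)) \<partial>Pi\<^sub>M (Basis - ?B) (\<lambda>_. lborel))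
        \<le> (\<integral>\<^sup>+y. (\<integral>\<^sup>+h. ?q * (?w (leaf_point k (\<Sum>b\<in>Basis - ?B. y b *\<^sub>R b) h) * indicator ?S (leaf_point k (\<Sum>b\<in>Basis - ?B. y b *\<^sub>R b) h)) \<partial>Pi\<^sub>M ?B (\<lambda>_. lborel)) \<partial>Pi\<^sub>M (Basis - ?B) (\<lambda>_. lborel))"
      proof (rule nn_integral_mono)
        fix y :: "complex^'n^'n \<Rightarrow> real"
        let ?Y = "\<Sum>b\<in>Basis - ?B. y b *\<^sub>R b"
        have "(\<integral>\<^sup>+h. ?w (leaf_point k ?Y h) * indicator ?E (leaf_point k ?Y h) \<partial>Pi\<^sub>M ?B (\<lambda>_. lborel))
          \<le> ?q * (\<integral>\<^sup>+h. ?w (leaf_point k ?Y h) * indicator ?S (leaf_point k ?Y h) \<partial>Pi\<^sub>M ?B (\<lambda>_. lborel))"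
          unfolding W_def by (rule leaf_event_bound[OF conv inv a \<delta>])
        also have "\<dots> = (\<integral>\<^sup>+h. ?q * (?w (leaf_point k ?Y h) * indicator ?S (leaf_point k ?Y h)) \<partial>Pi\<^sub>M ?B (\<lambda>_. lborel))"
          by (rule nn_integral_cmult[symmetric]) (rule measurable_compose[OF leaf_point_meas m(1)])
        finally show "(\<integral>\<^sup>+h. ?w (leaf_point k ?Y h) * indicator ?E (leaf_point k ?Y h) \<partial>Pi\<^sub>M ?B (\<lambda>_. lborel))
          \<le> (\<integral>\<^sup>+h. ?q * (?w (leaf_point k ?Y h) * indicator ?S (leaf_point k ?Y h)) \<partial>Pi\<^sub>M ?B (\<lambda>_. lborel))" .
      qed
    qed
    also have "\<dots> = ?q * (\<integral>\<^sup>+P. ?w P * indicator ?S P \<partial>lborel)"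
      by (rule nn_integral_cmult) (use m in simp)
    finally show ?thesis .
  qed
  \<comment> \<open>Injectivity on \<open>closest_block\<close> prevents double counting, so the
    pulled back mass is at most the total mass.\<close>
  also have "(\<integral>\<^sup>+P. ?w P * indicator ?S P \<partial>lborel)
    \<le> (\<integral>\<^sup>+M. ennreal (W M) \<partial>lborel)"
    unfolding covS[symmetric] nn_integral_completion by (intro nn_integral_mono) (auto simp: indicator_def)
  finally show "(\<integral>\<^sup>+M. ennreal (W M) * indicator (inflate k ` ?E) M \<partial>lborel) \<le> ?q * (\<integral>\<^sup>+M. ennreal (W M) \<partial>lborel)"
    by (simp add: mult_left_mono)
qed

section \<open>The tail bound\<close>

text \<open>The linear function with slope \<open>c\<close> has trace
  \<open>c * (norm M)\<^sup>2\<close>. This separates the Gaussian factor from the part of the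
  potential that is merely convex.\<close>

lemma trace_function_shift:
  fixes M :: "complex^'n^'n"
  shows "Re (trace (hermitian_fun V (ctranspose M ** M)))
    = c * (norm M)\<^sup>2 + Re (trace (hermitian_fun (\<lambda>y. V y - c * y) (ctranspose M ** M)))"
proof -
  have herm: "ctranspose (ctranspose M ** M) = ctranspose M ** M" by (simp add: ctranspose_mult)
  obtain U d where U: "unitary_matrix U" and A: "ctranspose M ** M = U ** real_diag d ** ctranspose U"
    using hermitian_diagonalizable[OF herm] by blast
  have "complex_of_real ((norm M)\<^sup>2) = complex_of_real (\<Sum>i\<in>UNIV. d i)"
    using trace_ctranspose_mult[of M] trace_real_diag_conj[OF U, of d] A by metis
  then have "(norm M)\<^sup>2 = (\<Sum>i\<in>UNIV. d i)" by (simp only: of_real_eq_iff)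
  then show ?thesis
    unfolding hermitian_fun_eq[OF U A] trace_real_diag_conj[OF U] by (simp add: sum_subtractf sum_distrib_left)
qed

theorem theorem1p1:
  fixes V :: "real \<Rightarrow> real" and \<alpha> \<delta> :: real
    and P :: "'a measure" and X :: "'a \<Rightarrow> complex^'n^'n"
    and z z' :: complex
    and lam lam' :: "'a \<Rightarrow> complex" and v v' :: "'a \<Rightarrow> complex^'n"
  assumes "\<alpha> > 0"
    and "convex_on UNIV (\<lambda>x::real. V (x\<^sup>2) - \<alpha> / 2 * x\<^sup>2)"
    and "CARD('n) \<ge> 2"
    and "prob_space P"
    and "distributed P lborel X (gibbs_density V)"
    and "AE \<omega> in P. selected_eigenvalues z z' (X \<omega>) (lam \<omega>) (lam' \<omega>)"
    and "AE \<omega> in P. unit_eigenvector (X \<omega>) (lam \<omega>) (v \<omega>)"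
    and "AE \<omega> in P. unit_eigenvector (X \<omega>) (lam' \<omega>) (v' \<omega>)"
    and "\<delta> > 0"
  shows "{\<omega> \<in> space P. Y_value (lam \<omega>) (lam' \<omega>) (v \<omega>) (v' \<omega>) \<ge> \<delta>} \<in> sets (completion P) \<and>
    measure (completion P)
      {\<omega> \<in> space P. Y_value (lam \<omega>) (lam' \<omega>) (v \<omega>) (v' \<omega>) \<ge> \<delta>}
      \<le> 2 * exp (- (\<alpha> / 2 * \<delta>))"
proof -
  interpret P: prob_space P by fact
  \<comment> \<open>Any coordinate serves: for each one, the matrices with an eigenvector vanishing
    there form a null set.\<close>
  obtain k :: 'n where True by simp
  define n where "n = real CARD('n)"
  have n: "n > 0" by (simp add: n_def)
  \<comment> \<open>The Gaussian rate in |M|^2. At the threshold \<delta>/n for |t|^2 it produces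
    the exponent \<alpha> \<delta>/2.\<close>
  define a where "a = n * (\<alpha> / 2)"
  have a: "a > 0" using n assms(1) by (simp add: a_def)
  define \<Psi> where "\<Psi> M = n * Re (trace (hermitian_fun (\<lambda>y. V y - \<alpha> / 2 * y) (ctranspose M ** M)))" for M :: "complex^'n^'n"
  have conv: "convex_on UNIV \<Psi>"
    unfolding \<Psi>_def using n
    by (intro convex_on_cmul convex_trace_function[OF assms(2)]) auto
  have inv: "\<Psi> (D ** M ** D) = \<Psi> M" if "unitary_matrix D" for D M
    unfolding \<Psi>_def trace_function_unitary_conj[OF that that] by (rule refl)
  have W: "gibbs_weight V = (\<lambda>M. exp (- a * (norm M)\<^sup>2 - \<Psi> M))"
    unfolding gibbs_weight_def \<Psi>_def a_def n_def
    by (rule ext, subst trace_function_shift[where c="\<alpha> / 2"]) (simp add: algebra_simps)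
  have [measurable]: "\<Psi> \<in> borel_measurable borel"
    by (intro borel_measurable_continuous_onI convex_on_continuous[OF open_UNIV conv])
  have W_meas[measurable]: "(gibbs_weight V :: complex^'n^'n \<Rightarrow> real) \<in> borel_measurable borel" unfolding W by measurable
  define Z where "Z = (\<integral>\<^sup>+M. ennreal (gibbs_weight V (M :: complex^'n^'n)) \<partial>lborel)"
  have dens: "gibbs_density V M = ennreal (gibbs_weight V M) / Z" for M :: "complex^'n^'n"
    by (simp add: gibbs_density_def Z_def)
  have X[measurable]: "X \<in> P \<rightarrow>\<^sub>M lborel" and law: "distr P lborel X = density lborel (gibbs_density V)"
    using assms(5) by (auto simp: distributed_def)
  have D_meas[measurable]: "(gibbs_density V :: complex^'n^'n \<Rightarrow> ennreal) \<in> borel_measurable lborel"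
    using assms(5) by (simp add: distributed_def)
  have P_X: "emeasure P (X -` B \<inter> space P) = (\<integral>\<^sup>+M. ennreal (gibbs_weight V M) * indicator B M \<partial>lborel) / Z"
    if B: "B \<in> sets lborel" for B
  proof -
    have "emeasure P (X -` B \<inter> space P) = emeasure (distr P lborel X) B"
      by (rule emeasure_distr[OF X B, symmetric])
    also have "\<dots> = (\<integral>\<^sup>+M. gibbs_density V M * indicator B M \<partial>lborel)"
      unfolding law using B by (subst emeasure_density) auto
    also have "\<dots> = (\<integral>\<^sup>+M. (ennreal (gibbs_weight V M) * indicator B M) / Z \<partial>lborel)"
      unfolding dens by (intro nn_integral_cong) (auto simp: indicator_def)
    also have "\<dots> = (\<integral>\<^sup>+M. ennreal (gibbs_weight V M) * indicator B M \<partial>lborel) / Z"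
      using B by (intro nn_integral_divide) auto
    finally show ?thesis .
  qed
  have "emeasure P (X -` UNIV \<inter> space P) = Z / Z" using P_X[of UNIV] by (simp add: Z_def)
  \<comment> \<open>An infinite \<open>Z\<close> would give quotient 0 here. That the law is a
    probability measure thus forces integrability of the Gibbs weight.\<close>
  then have ZZ: "Z / Z = 1" by (simp add: P.emeasure_space_1)
  then have Zfin: "Z < \<infinity>"
    by (cases "Z = top") (auto simp: less_top)
  define E where "E = inflate k ` event k z z' \<delta>"
  have fin: "(\<integral>\<^sup>+M. ennreal (exp (- a * (norm (M :: complex^'n^'n))\<^sup>2 - \<Psi> M)) \<partial>lborel) < \<infinity>"
    using Zfin unfolding Z_def W .
  have E: "E \<in> sets (completion lborel)"
    unfolding E_def by (rule event_bound(1)[OF conv inv a assms(9) fin])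
  have bound: "(\<integral>\<^sup>+M. ennreal (gibbs_weight V M) * indicator E M \<partial>lborel) \<le> ennreal (exp (- a * (\<delta> / CARD('n)))) * Z"
    unfolding E_def Z_def W by (rule event_bound(2)[OF conv inv a assms(9) fin])
  \<comment> \<open>\<open>X\<close> is measurable for Borel sets while \<open>E\<close> is a
    Lebesgue set, so \<open>E\<close> is traded for a Borel set up to a null set. The law of
    \<open>X\<close> has a density, so \<open>X\<close> almost surely avoids that null set.\<close>
  obtain B N N' where EB: "E = B \<union> N" and N: "N \<subseteq> N'" and N': "N' \<in> null_sets lborel" and B: "B \<in> sets lborel"
    using sets_completionE[OF E] by metis
  have notin: "AE \<omega> in P. X \<omega> \<notin> S" if "S \<in> null_sets lborel" for S
  proof (rule AE_distrD[OF X])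
    have "AE M in lborel. M \<notin> S" by (rule AE_not_in[OF that])
    then show "AE M in distr P lborel X. M \<notin> S" unfolding law AE_density[OF D_meas] by eventually_elim simp
  qed
  obtain S where S: "exceptional k z z' \<subseteq> S" "S \<in> null_sets lborel"
    using negligible_exceptional[of k z z'] unfolding negligible_iff_null_sets null_sets_completion_iff2 by blast
  define G where "G = {\<omega> \<in> space P. Y_value (lam \<omega>) (lam' \<omega>) (v \<omega>) (v' \<omega>) \<ge> \<delta>}"
  \<comment> \<open>The chosen eigenvalues and eigenvectors are not assumed measurable. Almost sure
    agreement with the preimage of a Borel set is what places \<open>G\<close> in the completion and
    gives its probability.\<close>
  have ae: "AE \<omega> in P. \<omega> \<in> X -` B \<inter> space P \<longleftrightarrow> \<omega> \<in> G"
    using assms(6-8) notin[OF N'] notin[OF S(2)] AE_space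
  proof eventually_elim
    case (elim \<omega>)
    obtain Q where Q: "Q \<in> closest_block k z" "inflate k Q = X \<omega>"
      "Q \<in> event k z z' \<delta> \<longleftrightarrow> \<delta> \<le> Y_value (lam \<omega>) (lam' \<omega>) (v \<omega>) (v' \<omega>)"
      using event_iff_Y_value[of "X \<omega>" k z z'] elim S(1) assms(9) by blast
    have "X \<omega> \<in> E \<longleftrightarrow> Q \<in> event k z z' \<delta>"
    proof
      assume "X \<omega> \<in> E"
      then obtain Q' where Q': "Q' \<in> event k z z' \<delta>" "inflate k Q' = X \<omega>" unfolding E_def by auto
      have "Q' \<in> closest_block k z" using Q'(1) by (simp add: event_def)
      then have "Q' = Q" using inj_onD[OF inj_on_inflate] Q Q' by metis
      then show "Q \<in> event k z z' \<delta>" using Q' by simp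
    qed (use Q(2) in \<open>metis E_def imageI\<close>)
    moreover have "X \<omega> \<in> E \<longleftrightarrow> X \<omega> \<in> B" using EB N elim(4) by auto
    ultimately show ?case using Q(3) elim(6) by (auto simp: G_def)
  qed
  have XB: "X -` B \<inter> space P \<in> sets P" using X B by (rule measurable_sets)
  have ae': "AE \<omega> in completion P. \<omega> \<in> X -` B \<inter> space P \<longleftrightarrow> \<omega> \<in> G" by (rule AE_completion[OF ae])
  have G: "G \<in> sets (completion P)"
    by (rule completion.in_sets_AE[OF ae']) (use XB in \<open>auto simp: G_def\<close>)
  have "emeasure (completion P) G = emeasure (completion P) (X -` B \<inter> space P)"
    using ae' G XB by (intro emeasure_eq_AE) auto
  also have "\<dots> = (\<integral>\<^sup>+M. ennreal (gibbs_weight V M) * indicator B M \<partial>lborel) / Z"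
    using XB P_X[OF B] by simp
  also have "\<dots> \<le> (\<integral>\<^sup>+M. ennreal (gibbs_weight V M) * indicator E M \<partial>lborel) / Z"
    unfolding EB by (intro divide_right_mono_ennreal nn_integral_mono) (auto simp: indicator_def)
  also have "\<dots> \<le> (ennreal (exp (- a * (\<delta> / CARD('n)))) * Z) / Z"
    by (intro divide_right_mono_ennreal bound)
  also have "\<dots> = ennreal (exp (- a * (\<delta> / CARD('n))))" using ZZ by (simp add: ennreal_times_divide[symmetric])
  also have "- a * (\<delta> / CARD('n)) = - (\<alpha> / 2 * \<delta>)" using n by (simp add: a_def n_def)
  finally have "emeasure (completion P) G \<le> ennreal (exp (- (\<alpha> / 2 * \<delta>)))" .
  then have "measure (completion P) G \<le> exp (- (\<alpha> / 2 * \<delta>))"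
    unfolding measure_def by (rule enn2real_leI[rotated]) simp
  \<comment> \<open>The tail has been obtained with constant 1; doubling gives the stated
    form.\<close>
  then have "measure (completion P) G \<le> 2 * exp (- (\<alpha> / 2 * \<delta>))"
    using exp_gt_zero[of "- (\<alpha> / 2 * \<delta>)"] by linarith
  then show ?thesis using G unfolding G_def by blast
qed

end
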